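(* Let $n\ge 2$ and let $\mathbb F_n$ be the free group on $n$ generators. For every positive $x\in\mathbb C[\mathbb F_n]$, $$\operatorname{Ent}(x^2)\le 2\,\tau(xLx).$$ Moreover, the inequality extends to the form domain of $L^{1/2}$: for every positive $x\in L_2(\widehat{\mathbb F_n})$ in the domain of $L^{1/2}$, one has $\operatorname{Ent}(x^2)\le 2\,\|L^{1/2}x\|_2^2$.
   Context: $|g|$ denotes the reduced word length of $g\in\mathbb F_n$ with respect to the $n$ free generators and their inverses. $\lambda:\mathbb F_n\to B(\ell_2(\mathbb F_n))$ is the left regular representation, and $\widehat{\mathbb F_n}$ is the von Neumann algebra generated by $\{\lambda_g\}$, with canonical tracial state $\tau(\lambda_g)=\delta_{g,e}$. $\mathbb C[\mathbb F_n]=\operatorname{span}\{\lambda_g:g\in\mathbb F_n\}\subset\widehat{\mathbb F_n}$; "positive" means positive as an operator (affiliated with $\widehat{\mathbb F_n}$). $L_2(\widehat{\mathbb F_n})$ is the noncommutative $L_2$-space with norm $\|x\|_2=\tau(x^*x)^{1/2}$. $L$ is the positive self-adjoint operator on $L_2(\widehat{\mathbb F_n})$ determined by $L(\lambda_g)=|g|\lambda_g$, so for $x=\sum_g x_g\lambda_g$ one has $\|L^{1/2}x\|_2^2=\sum_g|g||x_g|^2$, and this equals $\tau(xLx)$ for self-adjoint $x\in\mathbb C[\mathbb F_n]$. For a positive operator $a$ affiliated with $\widehat{\mathbb F_n}$, $\operatorname{Ent}(a)=\tau(a\log a)-\tau(a)\log\tau(a)$, with the convention $0\log 0=0$. *)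

theory Defs
  imports "HOL-Analysis.Analysis" "HOL-Algebra.Group"
begin

section \<open>The free group on \<open>n\<close> generators\<close>

text \<open>
  A letter \<open>(i, True)\<close> is the \<open>i\<close>-th generator and \<open>(i, False)\<close> its inverse.  Group elements
  are reduced words, so the reduced word length is \<^const>\<open>length\<close>.
\<close>

type_synonym letter = "nat \<times> bool"

definition inv_letter :: "letter \<Rightarrow> letter" where
  "inv_letter a = (fst a, \<not> snd a)"

definition reduced :: "letter list \<Rightarrow> bool" where
  "reduced w \<longleftrightarrow> successively (\<lambda>a b. b \<noteq> inv_letter a) w"

fun push_letter :: "letter \<Rightarrow> letter list \<Rightarrow> letter list" where
  "push_letter a [] = [a]"
| "push_letter a (b # w) = (if b = inv_letter a then w else a # b # w)"

definition free_group :: "nat \<Rightarrow> letter list monoid" where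
  "free_group n =
     \<lparr> carrier = {w. reduced w \<and> fst ` set w \<subseteq> {..<n}},
       mult = (\<lambda>u v. foldr push_letter u v),
       one = [] \<rparr>"

lemma inv_letter_inv_letter [simp]: "inv_letter (inv_letter a) = a"
  by (simp add: inv_letter_def)

lemma fst_inv_letter [simp]: "fst (inv_letter a) = fst a"
  by (simp add: inv_letter_def)

lemma reduced_Nil: "reduced []"
  by (simp add: reduced_def)

lemma reduced_Cons: "reduced (a # w) \<longleftrightarrow> (w = [] \<or> hd w \<noteq> inv_letter a) \<and> reduced w"
  by (cases w) (auto simp: reduced_def)

lemma reduced_push: "reduced w \<Longrightarrow> reduced (push_letter a w)"
  by (cases w) (auto simp: reduced_Cons reduced_Nil)

lemma set_push: "fst ` set w \<subseteq> A \<Longrightarrow> fst a \<in> A \<Longrightarrow> fst ` set (push_letter a w) \<subseteq> A"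
  by (cases w) auto

lemma push_push_inv:
  assumes "reduced w"
  shows "push_letter a (push_letter (inv_letter a) w) = w"
  using assms by (cases w; cases "tl w") (auto simp: reduced_Cons)

lemma reduced_foldr_push: "reduced v \<Longrightarrow> reduced (foldr push_letter u v)"
  by (induction u) (auto intro: reduced_push)

lemma push_foldr:
  assumes "reduced w"
  shows "foldr push_letter (push_letter a u) w = push_letter a (foldr push_letter u w)"
  using assms push_push_inv[OF reduced_foldr_push[OF assms], of a]
  by (cases u) auto

lemma foldr_push_assoc:
  assumes "reduced w"
  shows "foldr push_letter (foldr push_letter u v) w = foldr push_letter u (foldr push_letter v w)"
  by (induction u) (auto simp: push_foldr[OF assms])

lemma foldr_push_reduced: "reduced u \<Longrightarrow> foldr push_letter u [] = u"
proof (induction u)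
  case (Cons a u)
  then show ?case by (cases u) (auto simp: reduced_Cons)
qed simp

lemma group_free_group: "group (free_group n)"
proof (rule groupI)
  fix u v assume "u \<in> carrier (free_group n)" "v \<in> carrier (free_group n)"
  then have "reduced v" "fst ` set v \<subseteq> {..<n}" "fst ` set u \<subseteq> {..<n}"
    by (auto simp: free_group_def)
  moreover have "fst ` set (foldr push_letter u v) \<subseteq> {..<n}"
    using calculation(2,3)
  proof (induction u)
    case (Cons a u)
    then show ?case by (simp add: set_push)
  qed simp
  ultimately show "u \<otimes>\<^bsub>free_group n\<^esub> v \<in> carrier (free_group n)"
    by (simp add: free_group_def reduced_foldr_push)
next
  fix u assume u: "u \<in> carrier (free_group n)"
  have "\<exists>v. reduced v \<and> fst ` set v \<subseteq> {..<n} \<and> foldr push_letter v u = []"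
    using u unfolding free_group_def
  proof (simp, induction u)
    case Nil
    then show ?case by (auto simp: reduced_Nil intro!: exI[of _ "[]"])
  next
    case (Cons a u)
    then obtain v where v: "reduced v" "fst ` set v \<subseteq> {..<n}" "foldr push_letter v u = []"
      by (auto simp: reduced_Cons)
    have red: "reduced (a # u)" using Cons.prems by simp
    define v' where "v' = foldr push_letter v [inv_letter a]"
    have r: "reduced [inv_letter a]" by (simp add: reduced_def)
    have "foldr push_letter v' (a # u) = foldr push_letter v (foldr push_letter [inv_letter a] (a # u))"
      unfolding v'_def by (rule foldr_push_assoc[OF red])
    also have "\<dots> = []" using v by simp
    finally have 1: "foldr push_letter v' (a # u) = []" .
    have 2: "reduced v'" unfolding v'_def by (rule reduced_foldr_push[OF r])
    have 3: "fst ` set v' \<subseteq> {..<n}"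
      unfolding v'_def using v(2)
    proof (induction v)
      case Nil
      then show ?case using Cons.prems by auto
    next
      case (Cons b v)
      then show ?case by (simp add: set_push)
    qed
    from 1 2 3 show ?case by blast
  qed
  then show "\<exists>v\<in>carrier (free_group n). v \<otimes>\<^bsub>free_group n\<^esub> u = \<one>\<^bsub>free_group n\<^esub>"
    by (auto simp: free_group_def)
qed (auto simp: free_group_def reduced_Nil foldr_push_assoc)


section \<open>Operators on \<open>\<ell>\<^sub>2(I)\<close>\<close>

text \<open>
  Vectors of \<open>\<ell>\<^sub>2(I)\<close> are functions on the ambient type vanishing outside \<open>I\<close>.  A (possibly
  unbounded, partially defined) operator is identified with its graph.
\<close>

type_synonym 'g vec = "'g \<Rightarrow> complex"
type_synonym 'g lop = "('g vec \<times> 'g vec) set"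

definition ell2 :: "'g set \<Rightarrow> 'g vec set" where
  "ell2 I = {\<xi>. (\<forall>i. i \<notin> I \<longrightarrow> \<xi> i = 0) \<and> (\<lambda>i. (cmod (\<xi> i))\<^sup>2) summable_on UNIV}"

definition cip :: "'g vec \<Rightarrow> 'g vec \<Rightarrow> complex" where
  "cip \<xi> \<eta> = (\<Sum>\<^sub>\<infinity>i. cnj (\<xi> i) * \<eta> i)"

definition ell2_norm :: "'g vec \<Rightarrow> real" where
  "ell2_norm \<xi> = sqrt (\<Sum>\<^sub>\<infinity>i. (cmod (\<xi> i))\<^sup>2)"

definition delta :: "'g \<Rightarrow> 'g vec" where
  "delta g = (\<lambda>h. if h = g then 1 else 0)"

definition op_app :: "'g lop \<Rightarrow> 'g vec \<Rightarrow> 'g vec" where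
  "op_app A \<xi> = (THE \<eta>. (\<xi>, \<eta>) \<in> A)"

text \<open>The product \<open>AB\<close> (first \<open>B\<close>, then \<open>A\<close>), with its natural maximal domain.\<close>

definition op_comp :: "'g lop \<Rightarrow> 'g lop \<Rightarrow> 'g lop" (infixl \<open>\<circ>\<^sub>o\<close> 70) where
  "A \<circ>\<^sub>o B = B O A"

definition linear_op :: "'g set \<Rightarrow> 'g lop \<Rightarrow> bool" where
  "linear_op I A \<longleftrightarrow>
     A \<subseteq> ell2 I \<times> ell2 I \<and> single_valued A \<and> (\<lambda>i. 0, \<lambda>i. 0) \<in> A \<and>
     (\<forall>(\<xi>, \<eta>) \<in> A. \<forall>(\<xi>', \<eta>') \<in> A. (\<lambda>i. \<xi> i + \<xi>' i, \<lambda>i. \<eta> i + \<eta>' i) \<in> A) \<and>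
     (\<forall>c. \<forall>(\<xi>, \<eta>) \<in> A. (\<lambda>i. c * \<xi> i, \<lambda>i. c * \<eta> i) \<in> A)"

definition densely_defined :: "'g set \<Rightarrow> 'g lop \<Rightarrow> bool" where
  "densely_defined I A \<longleftrightarrow>
     (\<forall>\<xi>\<in>ell2 I. \<forall>\<epsilon>>0. \<exists>\<zeta>\<in>Domain A. ell2_norm (\<lambda>i. \<xi> i - \<zeta> i) < \<epsilon>)"

definition closed_op :: "'g set \<Rightarrow> 'g lop \<Rightarrow> bool" where
  "closed_op I A \<longleftrightarrow>
     (\<forall>X Y. \<forall>\<xi>\<in>ell2 I. \<forall>\<eta>\<in>ell2 I.
        (\<forall>k. (X k, Y k) \<in> A) \<longrightarrow>
        (\<lambda>k. ell2_norm (\<lambda>i. X k i - \<xi> i)) \<longlonglongrightarrow> 0 \<longrightarrow>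
        (\<lambda>k. ell2_norm (\<lambda>i. Y k i - \<eta> i)) \<longlonglongrightarrow> 0 \<longrightarrow> (\<xi>, \<eta>) \<in> A)"

definition bounded_ops :: "'g set \<Rightarrow> 'g lop set" where
  "bounded_ops I =
     {A. linear_op I A \<and> Domain A = ell2 I \<and> (\<exists>K. \<forall>(\<xi>, \<eta>) \<in> A. ell2_norm \<eta> \<le> K * ell2_norm \<xi>)}"

definition adjoint_op :: "'g set \<Rightarrow> 'g lop \<Rightarrow> 'g lop" where
  "adjoint_op I A =
     {(\<xi>, \<eta>). \<xi> \<in> ell2 I \<and> \<eta> \<in> ell2 I \<and> (\<forall>(\<zeta>, \<theta>) \<in> A. cip \<xi> \<theta> = cip \<eta> \<zeta>)}"

definition self_adjoint_op :: "'g set \<Rightarrow> 'g lop \<Rightarrow> bool" where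
  "self_adjoint_op I A \<longleftrightarrow> linear_op I A \<and> densely_defined I A \<and> adjoint_op I A = A"

text \<open>For self-adjoint \<open>A\<close> the number \<open>\<langle>\<xi>, A\<xi>\<rangle>\<close> is real, so only its real part needs a sign.\<close>

definition positive_op :: "'g set \<Rightarrow> 'g lop \<Rightarrow> bool" where
  "positive_op I A \<longleftrightarrow> self_adjoint_op I A \<and> (\<forall>(\<xi>, \<eta>) \<in> A. 0 \<le> Re (cip \<xi> \<eta>))"

definition unitary_op :: "'g set \<Rightarrow> 'g lop \<Rightarrow> bool" where
  "unitary_op I U \<longleftrightarrow>
     U \<in> bounded_ops I \<and> adjoint_op I U \<circ>\<^sub>o U = Id_on (ell2 I) \<and> U \<circ>\<^sub>o adjoint_op I U = Id_on (ell2 I)"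

definition commutant :: "'g set \<Rightarrow> 'g lop set \<Rightarrow> 'g lop set" where
  "commutant I S = {A \<in> bounded_ops I. \<forall>B\<in>S. A \<circ>\<^sub>o B = B \<circ>\<^sub>o A}"

definition diag_op :: "'g set \<Rightarrow> ('g \<Rightarrow> real) \<Rightarrow> 'g lop" where
  "diag_op I d =
     {(\<xi>, \<eta>). \<xi> \<in> ell2 I \<and> \<eta> \<in> ell2 I \<and> \<eta> = (\<lambda>i. complex_of_real (d i) * \<xi> i)}"


section \<open>Spectral resolutions\<close>

definition projection_valued_measure :: "'g set \<Rightarrow> (real set \<Rightarrow> 'g lop) \<Rightarrow> bool" where
  "projection_valued_measure I E \<longleftrightarrow>
     (\<forall>B\<in>sets borel. E B \<in> bounded_ops I \<and> adjoint_op I (E B) = E B \<and> E B \<circ>\<^sub>o E B = E B) \<and>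
     E UNIV = Id_on (ell2 I) \<and>
     (\<forall>B\<in>sets borel. \<forall>C\<in>sets borel. E (B \<inter> C) = E B \<circ>\<^sub>o E C) \<and>
     (\<forall>\<xi>\<in>ell2 I. measure_space UNIV (sets borel) (\<lambda>B. ennreal (Re (cip \<xi> (op_app (E B) \<xi>)))))"

definition vector_measure :: "(real set \<Rightarrow> 'g lop) \<Rightarrow> 'g vec \<Rightarrow> real measure" where
  "vector_measure E \<xi> =
     measure_of UNIV (sets borel) (\<lambda>B. ennreal (Re (cip \<xi> (op_app (E B) \<xi>))))"

text \<open>
  \<open>E\<close> is the spectral measure of the self-adjoint operator \<open>A = \<integral> t dE(t)\<close>: the domain of \<open>A\<close>
  consists of the \<open>\<xi>\<close> with \<open>\<integral> t\<^sup>2 d\<langle>\<xi>, E\<xi>\<rangle> < \<infinity>\<close>, and \<open>\<langle>\<xi>, A\<xi>\<rangle> = \<integral> t d\<langle>\<xi>, E\<xi>\<rangle>\<close> there (which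
  determines \<open>A\<close> by polarization).  By the spectral theorem, each self-adjoint operator has a
  spectral measure, unique on the Borel sets, so that the choice below does not matter.
\<close>

definition is_spectral_measure :: "'g set \<Rightarrow> 'g lop \<Rightarrow> (real set \<Rightarrow> 'g lop) \<Rightarrow> bool" where
  "is_spectral_measure I A E \<longleftrightarrow>
     projection_valued_measure I E \<and>
     Domain A = {\<xi> \<in> ell2 I. (\<integral>\<^sup>+t. ennreal (t\<^sup>2) \<partial>vector_measure E \<xi>) < \<infinity>} \<and>
     (\<forall>(\<xi>, \<eta>) \<in> A. cip \<xi> \<eta> = complex_of_real (\<integral>t. t \<partial>vector_measure E \<xi>))"

definition spectral_measure :: "'g set \<Rightarrow> 'g lop \<Rightarrow> real set \<Rightarrow> 'g lop" where
  "spectral_measure I A = (SOME E. is_spectral_measure I A E)"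


section \<open>The group von Neumann algebra\<close>

definition left_translate :: "('g, 'm) monoid_scheme \<Rightarrow> 'g \<Rightarrow> 'g vec \<Rightarrow> 'g vec" where
  "left_translate G g \<xi> = (\<lambda>h. if h \<in> carrier G then \<xi> (inv\<^bsub>G\<^esub> g \<otimes>\<^bsub>G\<^esub> h) else 0)"

definition lreg :: "('g, 'm) monoid_scheme \<Rightarrow> 'g \<Rightarrow> 'g lop" where
  "lreg G g = {(\<xi>, left_translate G g \<xi>) | \<xi>. \<xi> \<in> ell2 (carrier G)}"

text \<open>The operator \<open>\<Sum>\<^sub>g c\<^sub>g \<lambda>\<^sub>g\<close> for finitely supported \<open>c\<close>.\<close>

definition group_alg_op :: "('g, 'm) monoid_scheme \<Rightarrow> 'g vec \<Rightarrow> 'g lop" where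
  "group_alg_op G c =
     {(\<xi>, \<lambda>h. \<Sum>g | c g \<noteq> 0. c g * left_translate G g \<xi> h) | \<xi>. \<xi> \<in> ell2 (carrier G)}"

definition group_algebra :: "('g, 'm) monoid_scheme \<Rightarrow> 'g lop set" where
  "group_algebra G = {group_alg_op G c | c. finite {g. c g \<noteq> 0} \<and> {g. c g \<noteq> 0} \<subseteq> carrier G}"

text \<open>The von Neumann algebra generated by the \<open>\<lambda>\<^sub>g\<close> is their bicommutant.\<close>

definition group_vN :: "('g, 'm) monoid_scheme \<Rightarrow> 'g lop set" where
  "group_vN G = commutant (carrier G) (commutant (carrier G) (lreg G ` carrier G))"

definition affiliated :: "('g, 'm) monoid_scheme \<Rightarrow> 'g lop \<Rightarrow> bool" where
  "affiliated G A \<longleftrightarrow>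
     linear_op (carrier G) A \<and> densely_defined (carrier G) A \<and> closed_op (carrier G) A \<and>
     (\<forall>U \<in> commutant (carrier G) (group_vN G). unitary_op (carrier G) U \<longrightarrow>
        U \<circ>\<^sub>o A \<circ>\<^sub>o adjoint_op (carrier G) U = A)"

text \<open>The canonical trace \<open>\<tau>(a) = \<langle>\<delta>\<^sub>e, a \<delta>\<^sub>e\<rangle>\<close> on bounded operators.\<close>

definition vtau :: "('g, 'm) monoid_scheme \<Rightarrow> 'g lop \<Rightarrow> complex" where
  "vtau G A = cip (delta \<one>\<^bsub>G\<^esub>) (op_app A (delta \<one>\<^bsub>G\<^esub>))"

text \<open>
  For \<open>a\<close> self-adjoint and affiliated, with spectral measure \<open>E\<close>, the distribution of \<open>a\<close> is
  \<open>\<mu>(B) = \<tau>(E(B))\<close>, and the trace of the functional calculus is \<open>\<tau>(f(a)) = \<integral> f d\<mu>\<close>.  The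
  latter is the standard extension of \<open>\<tau>\<close> to unbounded operators; it has values in the extended
  reals and is meaningful as soon as the positive or the negative part of \<open>f\<close> is integrable.
\<close>

definition spectral_distribution :: "('g, 'm) monoid_scheme \<Rightarrow> 'g lop \<Rightarrow> real measure" where
  "spectral_distribution G A =
     measure_of UNIV (sets borel) (\<lambda>B. ennreal (Re (vtau G (spectral_measure (carrier G) A B))))"

definition vtau_fun :: "('g, 'm) monoid_scheme \<Rightarrow> (real \<Rightarrow> real) \<Rightarrow> 'g lop \<Rightarrow> ereal" where
  "vtau_fun G f A =
     enn2ereal (\<integral>\<^sup>+t. ennreal (f t) \<partial>spectral_distribution G A) -
     enn2ereal (\<integral>\<^sup>+t. ennreal (- f t) \<partial>spectral_distribution G A)"

text \<open>
  The entropy of a positive affiliated \<open>a\<close> with \<open>\<tau>(a) < \<infinity>\<close>.  Since \<open>t log t\<close> is bounded below on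
  \<open>[0, \<infinity>)\<close>, it is well defined with values in \<open>(-\<infinity>, \<infinity>]\<close>.  The convention \<open>0 log 0 = 0\<close> is
  automatic.
\<close>

definition Ent :: "('g, 'm) monoid_scheme \<Rightarrow> 'g lop \<Rightarrow> ereal" where
  "Ent G A =
     vtau_fun G (\<lambda>t. t * ln t) A -
     (let s = real_of_ereal (vtau_fun G (\<lambda>t. t) A) in ereal (s * ln s))"

definition nc_L2 :: "('g, 'm) monoid_scheme \<Rightarrow> 'g lop set" where
  "nc_L2 G = {x. affiliated G x \<and> vtau_fun G (\<lambda>t. t) (adjoint_op (carrier G) x \<circ>\<^sub>o x) < \<infinity>}"

text \<open>
  For \<open>x\<close> in \<open>L\<^sub>2\<close> the vector \<open>\<delta>\<^sub>e\<close> is in the domain of \<open>x\<close>, and \<open>x \<mapsto> x \<delta>\<^sub>e\<close> is the canonical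
  unitary from \<open>L\<^sub>2\<close> onto \<open>\<ell>\<^sub>2(G)\<close> sending \<open>\<lambda>\<^sub>g\<close> to \<open>\<delta>\<^sub>g\<close>; the coordinates of \<open>x \<delta>\<^sub>e\<close> are the
  coefficients \<open>x\<^sub>g = \<tau>(\<lambda>\<^sub>g\<^sup>* x)\<close> of \<open>x = \<Sum>\<^sub>g x\<^sub>g \<lambda>\<^sub>g\<close>.
\<close>

definition L2_vec :: "('g, 'm) monoid_scheme \<Rightarrow> 'g lop \<Rightarrow> 'g vec" where
  "L2_vec G x = op_app x (delta \<one>\<^bsub>G\<^esub>)"


section \<open>The word length generator\<close>

text \<open>\<open>L\<close> and \<open>L\<^sup>1\<^sup>/\<^sup>2\<close>, transported to \<open>\<ell>\<^sub>2\<close> by the above unitary.\<close>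

definition L_gen :: "nat \<Rightarrow> letter list lop" where
  "L_gen n = diag_op (carrier (free_group n)) (\<lambda>g. real (length g))"

definition L_half :: "nat \<Rightarrow> letter list lop" where
  "L_half n = diag_op (carrier (free_group n)) (\<lambda>g. sqrt (real (length g)))"

text \<open>The element \<open>Lx\<close> of the group algebra, for \<open>x\<close> in the group algebra.\<close>

definition L_alg :: "nat \<Rightarrow> letter list lop \<Rightarrow> letter list lop" where
  "L_alg n x = group_alg_op (free_group n) (op_app (L_gen n) (L2_vec (free_group n) x))"


section \<open>Consistency of the definitions\<close>

lemma L_half_squared: "L_half n \<circ>\<^sub>o L_half n = L_gen n"
proof (intro equalityI subsetI)
  fix p assume "p \<in> L_half n \<circ>\<^sub>o L_half n"
  then show "p \<in> L_gen n"
    by (auto simp: op_comp_def L_half_def L_gen_def diag_op_def relcomp_unfold fun_eq_iff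
        simp flip: mult.assoc of_real_mult)
next
  fix p assume "p \<in> L_gen n"
  then obtain \<xi> where p: "p = (\<xi>, \<lambda>g. complex_of_real (real (length g)) * \<xi> g)"
    and \<xi>: "\<xi> \<in> ell2 (carrier (free_group n))"
    and L\<xi>: "(\<lambda>g. complex_of_real (real (length g)) * \<xi> g) \<in> ell2 (carrier (free_group n))"
    by (auto simp: L_gen_def diag_op_def)
  define \<eta> where "\<eta> = (\<lambda>g. complex_of_real (sqrt (real (length g))) * \<xi> g)"
  have "(\<lambda>g. (cmod (\<eta> g))\<^sup>2) summable_on UNIV"
  proof (rule summable_on_comparison_test)
    show "(\<lambda>g. (cmod (complex_of_real (real (length g)) * \<xi> g))\<^sup>2) summable_on UNIV"
      using L\<xi> by (simp add: ell2_def)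
    fix g :: "letter list"
    have "real (length g) \<le> (real (length g))\<^sup>2"
      by (cases "length g") (simp_all add: power2_eq_square)
    then show "(cmod (\<eta> g))\<^sup>2 \<le> (cmod (complex_of_real (real (length g)) * \<xi> g))\<^sup>2"
      by (simp add: \<eta>_def norm_mult power_mult_distrib mult_right_mono)
  qed simp
  then have "\<eta> \<in> ell2 (carrier (free_group n))"
    using \<xi> by (simp add: ell2_def \<eta>_def)
  moreover have "(\<lambda>g. complex_of_real (real (length g)) * \<xi> g)
      = (\<lambda>g. complex_of_real (sqrt (real (length g))) * \<eta> g)"
    by (simp add: \<eta>_def fun_eq_iff flip: mult.assoc of_real_mult)
  ultimately show "p \<in> L_half n \<circ>\<^sub>o L_half n"
    using \<xi> L\<xi> unfolding p op_comp_def L_half_def diag_op_def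
    by (auto simp: \<eta>_def intro!: relcompI[of _ \<eta>])
qed

lemma delta_in_ell2: "g \<in> I \<Longrightarrow> delta g \<in> ell2 I"
proof -
  assume g: "g \<in> I"
  have "(\<lambda>i. (cmod (delta g i))\<^sup>2) summable_on {g}"
    by simp
  then have "(\<lambda>i. (cmod (delta g i))\<^sup>2) summable_on UNIV"
    by (rule summable_on_cong_neutral[THEN iffD1, rotated -1]) (auto simp: delta_def)
  then show ?thesis using g by (auto simp: ell2_def delta_def)
qed

lemma vtau_lreg:
  assumes "group G" "g \<in> carrier G"
  shows "vtau G (lreg G g) = (if g = \<one>\<^bsub>G\<^esub> then 1 else 0)"
proof -
  interpret group G by fact
  have "left_translate G g (delta \<one>\<^bsub>G\<^esub>) = delta g"
    using assms(2) by (auto simp: left_translate_def delta_def fun_eq_iff inv_equality inv_solve_left')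
  moreover have "op_app (lreg G g) (delta \<one>\<^bsub>G\<^esub>) = left_translate G g (delta \<one>\<^bsub>G\<^esub>)"
    by (auto simp: op_app_def lreg_def delta_in_ell2)
  ultimately have "vtau G (lreg G g) = cip (delta \<one>\<^bsub>G\<^esub>) (delta g)"
    by (simp add: vtau_def)
  also have "\<dots> = (\<Sum>\<^sub>\<infinity>i\<in>{g}. cnj (delta \<one>\<^bsub>G\<^esub> i) * delta g i)"
    unfolding cip_def by (rule infsum_cong_neutral) (auto simp: delta_def)
  finally show ?thesis by (simp add: delta_def)
qed

end

theory Submission
  imports Defs "HOL-Probability.Probability"
begin

text \<open>
  Let \<open>\<mu>\<close> be the distribution of \<open>x\<close>, \<open>m = \<tau>(x)\<close>, \<open>s = \<Sum>\<^bsub>g \<noteq> e\<^esub> |x\<^sub>g|\<^sup>2\<close> and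
  \<open>\<alpha>\<^sup>2 = \<Sum>\<^bsub>g \<noteq> e\<^esub> (|g| - 1) |x\<^sub>g|\<^sup>2\<close>, so that \<open>\<parallel>x\<parallel>\<^sub>2\<^sup>2 = m\<^sup>2 + s\<close> and the right-hand side is
  \<open>2 (s + \<alpha>\<^sup>2)\<close>.  On \<open>[0, \<infinity>)\<close> the function \<open>u\<^sup>2 ln u\<^sup>2\<close> lies below its cubic Taylor polynomial at any
  \<open>\<kappa> > 0\<close>, so only the first three moments of \<open>\<mu>\<close> enter.  In \<open>\<tau>(x\<^sup>3) = \<Sum> x\<^sub>a x\<^sub>b x\<^sub>c\<close>, the sum being
  over \<open>a b c = e\<close>, each triple spans a tripod in the Cayley tree, and the Cauchy-Schwarz inequality
  gives \<open>\<tau>(x\<^sup>3) \<le> m\<^sup>3 + 3 m s + 3 s \<alpha> + \<alpha>\<^sup>3\<close>: a word \<open>g\<close> is split in \<open>|g| - 1\<close> ways into two nonempty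
  legs.  With \<open>\<kappa> = m + \<alpha>\<close> the resulting bound is exactly \<open>2 (s + \<alpha>\<^sup>2)\<close>, up to
  \<open>ln t \<le> t - 1\<close>.  For unbounded \<open>x\<close> the third moment is controlled by lower semicontinuity of
  \<open>v \<mapsto> \<langle>v, x v\<rangle>\<close> along finite truncations of \<open>v = x \<delta>\<^sub>e\<close>.

  The entropy is defined through the spectral measure of \<open>x\<^sup>2\<close>, which makes the spectral theorem for
  positive operators necessary.  Existence comes from the moment problem on \<open>[0, 1]\<close> for the resolvent
  \<open>(1 + x)\<^sup>-\<^sup>1\<close>, uniqueness from the growth of \<open>\<parallel>x\<^sup>2\<^sup>k v\<parallel>\<close>.
\<close>

section \<open>Real Hilbert spaces\<close>

text \<open>Degree three is natural: the second moment does not see word lengths, and the quadratic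
  Taylor polynomial crosses u^2 ln (u^2) at \<kappa>, the third derivative 4 / u being positive. The
  cubic one stays above and costs one more moment. Since m^3 + \<alpha>^3 + 3 s (m + \<alpha>) is
  divisible by m + \<alpha>, the choice \<kappa> = m + \<alpha> cancels the factor 1 / \<kappa> of
  the cubic term. The formal obstacle is that \<open>spectral_measure\<close> is a choice:
  \<open>Ent\<close> cannot be computed before one spectral measure of
  \<open>x \<circ>\<^sub>o x\<close> is exhibited and all of them are shown to have the same scalar
  measures. Uniqueness is delicate because \<open>is_spectral_measure\<close> ties an operator to E
  only through its domain and its quadratic form; that the two commute has to be derived. The
  resolvent is bounded with spectrum in [0, 1], where polynomials are dense in the continuous
  functions, so moments determine measures. Hilbert space arguments are over the reals, with the
  real part of \<open>cip\<close> as inner product; complex linearity returns by showing that the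
  constructions commute with complex scalars.\<close>

lemma hilbert_projection:
  fixes S :: "'a::{real_inner, complete_space} set"
  assumes S: "subspace S" "closed S"
  obtains p where "p \<in> S" "\<And>y. y \<in> S \<Longrightarrow> inner (u - p) y = 0"
proof -
  define D where "D = (INF y\<in>S. (norm (u - y))\<^sup>2)"
  have ne: "S \<noteq> {}" using S(1) subspace_0 by blast
  have bdd: "bdd_below ((\<lambda>y. (norm (u - y))\<^sup>2) ` S)" by (auto intro!: bdd_belowI[of _ 0])
  have D: "D \<le> (norm (u - y))\<^sup>2" if "y \<in> S" for y
    unfolding D_def by (rule cINF_lower[OF bdd that])
  have "\<exists>y\<in>S. (norm (u - y))\<^sup>2 < D + 1 / real (Suc n)" for n
    using cINF_less_iff[OF ne bdd, of "D + 1 / real (Suc n)"] by (simp add: D_def)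
  then obtain p where p: "\<And>n. p n \<in> S" "\<And>n. (norm (u - p n))\<^sup>2 < D + 1 / real (Suc n)"
    by metis
  \<comment> \<open>Parallelogram law: the midpoint of two almost minimizers lies in S, so its
    distance is at least the infimum, which forces the two points together.\<close>
  have par: "(norm (p n - p m))\<^sup>2 \<le> 2 / real (Suc n) + 2 / real (Suc m)" for n m
  proof -
    have "(1/2) *\<^sub>R (p n + p m) \<in> S"
      using S(1) p(1) by (intro subspace_scale subspace_add) auto
    from D[OF this] have "4 * D \<le> 4 * (norm (u - (1/2) *\<^sub>R (p n + p m)))\<^sup>2" by simp
    also have "\<dots> = (norm ((u - p n) + (u - p m)))\<^sup>2"
    proof -
      have "(u - p n) + (u - p m) = 2 *\<^sub>R (u - (1/2) *\<^sub>R (p n + p m))"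
        by (simp add: scaleR_2 algebra_simps)
      then show ?thesis by (simp add: power_mult_distrib)
    qed
    also have "\<dots> = 2 * (norm (u - p n))\<^sup>2 + 2 * (norm (u - p m))\<^sup>2 - (norm (p n - p m))\<^sup>2"
      by (simp add: power2_norm_eq_inner inner_simps inner_commute)
    finally show ?thesis
      using p(2)[of n] p(2)[of m] divide_inverse[of 2 "real (Suc n)"] divide_inverse[of 2 "real (Suc m)"]
        divide_inverse[of 1 "real (Suc n)"] divide_inverse[of 1 "real (Suc m)"] by linarith
  qed
  have "Cauchy p"
  proof (rule metric_CauchyI)
    fix e :: real assume e: "0 < e"
    obtain N where N: "4 / e\<^sup>2 < real N" using reals_Archimedean2 by blast
    have "dist (p n) (p m) < e" if "n \<ge> N" "m \<ge> N" for n m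
    proof -
      have Np: "real N > 0" using N e by (smt (verit) divide_pos_pos zero_less_power)
      have "2 / real (Suc n) \<le> 2 / real N" "2 / real (Suc m) \<le> 2 / real N"
        using that Np by (auto intro!: divide_left_mono)
      with par[of n m] have "(norm (p n - p m))\<^sup>2 \<le> 4 / real N" by simp
      also have "\<dots> < e\<^sup>2" using N e Np by (simp add: field_simps)
      finally show ?thesis using e by (simp add: dist_norm power2_less_imp_less)
    qed
    then show "\<exists>M. \<forall>m\<ge>M. \<forall>n\<ge>M. dist (p m) (p n) < e" by blast
  qed
  then obtain q where q: "p \<longlonglongrightarrow> q" using Cauchy_convergent convergent_def by blast
  have qS: "q \<in> S" using closed_sequentially[OF S(2) p(1) q] .
  have "(\<lambda>n. (norm (u - p n))\<^sup>2) \<longlonglongrightarrow> (norm (u - q))\<^sup>2" by (intro tendsto_intros q)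
  moreover have "(\<lambda>n. D + 1 / real (Suc n)) \<longlonglongrightarrow> D + 0"
    by (intro tendsto_intros LIMSEQ_Suc lim_1_over_n)
  ultimately have qD: "(norm (u - q))\<^sup>2 \<le> D"
    using p(2) by (intro LIMSEQ_le[of _ _ _ D]) (auto intro!: exI[of _ 0] less_imp_le)
  have "inner (u - q) y = 0" if y: "y \<in> S" for y
  proof -
    define b where "b = inner (u - q) y"
    have ineq: "2 * t * b \<le> t\<^sup>2 * (norm y)\<^sup>2" for t
    proof -
      have "q + t *\<^sub>R y \<in> S" using S(1) qS y by (intro subspace_add subspace_scale)
      from qD D[OF this] have "(norm (u - q))\<^sup>2 \<le> (norm ((u - q) - t *\<^sub>R y))\<^sup>2"
        unfolding diff_diff_eq by (rule order_trans)
      also have "\<dots> = (norm (u - q))\<^sup>2 - 2 * t * b + t\<^sup>2 * (norm y)\<^sup>2"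
        unfolding b_def power2_norm_eq_inner
        by (simp add: inner_diff_left inner_diff_right inner_commute power2_eq_square algebra_simps)
      finally show ?thesis by simp
    qed
    show ?thesis
    proof (cases "y = 0")
      case False
      then have "norm y > 0" by simp
      \<comment> \<open>The value of t that minimizes the distance along y; it turns the
        first-variation inequality into 2 b^2 \<le> b^2.\<close>
      from ineq[of "b / (norm y)\<^sup>2"] have "2 * b\<^sup>2 / (norm y)\<^sup>2 \<le> b\<^sup>2 / (norm y)\<^sup>2"
        using \<open>norm y > 0\<close> by (simp add: power2_eq_square)
      then have "2 * b\<^sup>2 \<le> b\<^sup>2" using \<open>norm y > 0\<close> by (simp add: divide_le_cancel)
      then show ?thesis by (simp add: b_def)
    qed simp
  qed
  then show ?thesis by (rule that[OF qS])
qed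

text \<open>Both range arguments to come, for coercive maps and for 1 + x, reduce to this.\<close>

lemma closed_subspace_eq_UNIV:
  fixes S :: "'a::{real_inner, complete_space} set"
  assumes "subspace S" "closed S" "\<And>v. (\<And>y. y \<in> S \<Longrightarrow> inner v y = 0) \<Longrightarrow> v = 0"
  shows "S = UNIV"
proof -
  have "u \<in> S" for u
  proof -
    obtain p where p: "p \<in> S" "\<And>y. y \<in> S \<Longrightarrow> inner (u - p) y = 0"
      by (rule hilbert_projection[OF assms(1,2), of u]) (rule that)
    from assms(3)[OF p(2)] have "u - p = 0" .
    with p(1) show ?thesis by simp
  qed
  then show ?thesis by blast
qed

lemma riesz_representation:
  fixes f :: "'a::{real_inner, complete_space} \<Rightarrow> real"
  assumes f: "bounded_linear f"
  obtains v where "\<And>x. f x = inner v x"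
proof (cases "\<forall>x. f x = 0")
  case True
  then show ?thesis using that[of 0] by simp
next
  case False
  interpret f: bounded_linear f by fact
  obtain u where u: "f u \<noteq> 0" using False by blast
  have K: "subspace {x. f x = 0}" by (auto simp: subspace_def f.add f.scale f.zero)
  have "closed {x. f x = 0}"
    by (rule closed_Collect_eq[OF linear_continuous_on[OF f] continuous_on_const])
  then obtain p where p: "f p = 0" "\<And>y. f y = 0 \<Longrightarrow> inner (u - p) y = 0"
    by (rule hilbert_projection[OF K, of u]) (rule that, auto)
  \<comment> \<open>A vector orthogonal to the kernel; a functional is determined by its kernel and
    its value at w.\<close>
  define w where "w = u - p"
  have w: "f w \<noteq> 0" "w \<noteq> 0" using u p(1) by (auto simp: w_def f.diff f.zero)
  have "f x = inner ((f w / inner w w) *\<^sub>R w) x" for x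
  proof -
    have "f (x - (f x / f w) *\<^sub>R w) = 0" using w by (simp add: f.diff f.scale)
    from p(2)[OF this] have "inner w x = (f x / f w) * inner w w"
      by (simp add: w_def inner_diff_right)
    then show ?thesis using w by (simp add: field_simps)
  qed
  then show ?thesis by (rule that)
qed

text \<open>Coercivity bounds A from below, which makes its range closed. A vector v orthogonal to
  the range is orthogonal to A v, and coercivity forces v = 0.\<close>

lemma coercive_surj:
  fixes A :: "'a::{real_inner, complete_space} \<Rightarrow> 'a"
  assumes A: "bounded_linear A" and sym: "\<And>x y. inner (A x) y = inner x (A y)"
    and c: "c > 0" "\<And>x. c * (norm x)\<^sup>2 \<le> inner x (A x)"
  shows "surj A"
proof -
  interpret A: bounded_linear A by fact
  have below: "c * norm x \<le> norm (A x)" for x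
  proof (cases "x = 0")
    case False
    have "c * (norm x)\<^sup>2 \<le> norm x * norm (A x)"
      by (rule order_trans[OF c(2) norm_cauchy_schwarz])
    then have "norm x * (c * norm x) \<le> norm x * norm (A x)"
      by (simp only: power2_eq_square mult.left_commute[of c])
    then show ?thesis using False by simp
  qed simp
  have "closed (range A)"
  proof (rule closed_sequential_limits[THEN iffD2], intro allI impI, elim conjE)
    fix y l assume y: "\<forall>n. y n \<in> range A" and l: "y \<longlonglongrightarrow> l"
    from y have "\<forall>n. \<exists>x. y n = A x" by blast
    then obtain x where x: "\<And>n. y n = A (x n)" by metis
    have "Cauchy x"
    proof (rule metric_CauchyI)
      fix e :: real assume "0 < e"
      then obtain N where N: "\<And>m n. m \<ge> N \<Longrightarrow> n \<ge> N \<Longrightarrow> dist (y m) (y n) < c * e"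
        using metric_CauchyD[OF LIMSEQ_imp_Cauchy[OF l], of "c * e"] c(1) by auto
      have "dist (x m) (x n) < e" if "m \<ge> N" "n \<ge> N" for m n
      proof -
        have "c * norm (x m - x n) \<le> norm (A (x m - x n))" by (rule below)
        also have "\<dots> < c * e" using N[OF that] by (simp add: x dist_norm A.diff)
        finally show ?thesis using c(1) by (simp add: dist_norm)
      qed
      then show "\<exists>M. \<forall>m\<ge>M. \<forall>n\<ge>M. dist (x m) (x n) < e" by blast
    qed
    then obtain z where "x \<longlonglongrightarrow> z" using Cauchy_convergent convergent_def by blast
    from A.tendsto[OF this] have "y \<longlonglongrightarrow> A z" by (simp add: x[THEN ext])
    with l show "l \<in> range A" using LIMSEQ_unique by blast
  qed
  moreover have "subspace (range A)"
    using A.linear_axioms linear_subspace_image subspace_UNIV by blast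
  moreover have "v = 0" if "\<And>y. y \<in> range A \<Longrightarrow> inner v y = 0" for v
  proof -
    have "inner v (A v) = 0" using that by blast
    with c(2)[of v] c(1) show ?thesis by (simp add: mult_le_0_iff)
  qed
  ultimately show ?thesis by (intro closed_subspace_eq_UNIV) auto
qed

section \<open>The Hilbert space of square summable functions\<close>

text \<open>Limits and bounded linear maps live on type classes, while \<open>ell2 I\<close> is a
  set of functions. The type carries no support condition; it returns as the subspace
  \<open>l2_on I\<close>.\<close>

typedef 'g l2 = "{f :: 'g \<Rightarrow> complex. (\<lambda>i. (cmod (f i))\<^sup>2) summable_on UNIV}"
  morphisms coord Abs_l2
  by (rule exI[of _ "\<lambda>_. 0"]) simp

setup_lifting type_definition_l2

lemma l2_eqI: "(\<And>i. coord x i = coord y i) \<Longrightarrow> x = y"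
  by (rule coord_inject[THEN iffD1], rule ext)

lemma coord_summable: "(\<lambda>i. (cmod (coord x i))\<^sup>2) summable_on UNIV"
  using coord[of x] by simp

lemma square_summable_prod:
  assumes "(\<lambda>i. (cmod (f i))\<^sup>2) summable_on UNIV" "(\<lambda>i. (cmod (g i))\<^sup>2) summable_on UNIV"
  shows "(\<lambda>i. cmod (f i) * cmod (g i)) summable_on UNIV"
proof (rule summable_on_comparison_test)
  show "(\<lambda>i. (cmod (f i))\<^sup>2 + (cmod (g i))\<^sup>2) summable_on UNIV"
    using assms by (rule summable_on_add)
  show "cmod (f i) * cmod (g i) \<le> (cmod (f i))\<^sup>2 + (cmod (g i))\<^sup>2" for i
    using sum_squares_bound[of "cmod (f i)" "cmod (g i)"] mult_nonneg_nonneg[OF norm_ge_zero norm_ge_zero, of "f i" "g i"]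
    by linarith
qed simp

lemma square_summable_add:
  assumes "(\<lambda>i. (cmod (f i))\<^sup>2) summable_on UNIV" "(\<lambda>i. (cmod (g i))\<^sup>2) summable_on UNIV"
  shows "(\<lambda>i. (cmod (f i + g i))\<^sup>2) summable_on UNIV"
proof (rule summable_on_comparison_test)
  show "(\<lambda>i. 2 * (cmod (f i))\<^sup>2 + 2 * (cmod (g i))\<^sup>2) summable_on UNIV"
    using assms by (intro summable_on_add summable_on_cmult_right)
  show "(cmod (f i + g i))\<^sup>2 \<le> 2 * (cmod (f i))\<^sup>2 + 2 * (cmod (g i))\<^sup>2" for i
  proof -
    have "(cmod (f i + g i))\<^sup>2 \<le> (cmod (f i) + cmod (g i))\<^sup>2"
      by (intro power_mono norm_triangle_ineq) auto
    then show ?thesis using sum_squares_bound[of "cmod (f i)" "cmod (g i)"] by (simp add: power2_sum)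
  qed
qed simp

lemma square_summable_scale:
  assumes "(\<lambda>i. (cmod (f i))\<^sup>2) summable_on UNIV"
  shows "(\<lambda>i. (cmod (c * f i))\<^sup>2) summable_on UNIV"
  using summable_on_cmult_right[OF assms, of "(cmod c)\<^sup>2"] by (simp add: norm_mult power_mult_distrib)

lift_definition scaleC :: "complex \<Rightarrow> 'g l2 \<Rightarrow> 'g l2" is "\<lambda>c f i. c * f i"
  by (rule square_summable_scale)

instantiation l2 :: (type) real_vector
begin

lift_definition zero_l2 :: "'a l2" is "\<lambda>_. 0" by simp
lift_definition plus_l2 :: "'a l2 \<Rightarrow> 'a l2 \<Rightarrow> 'a l2" is "\<lambda>f g i. f i + g i"
  by (rule square_summable_add)
lift_definition uminus_l2 :: "'a l2 \<Rightarrow> 'a l2" is "\<lambda>f i. - f i" by simp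
lift_definition minus_l2 :: "'a l2 \<Rightarrow> 'a l2 \<Rightarrow> 'a l2" is "\<lambda>f g i. f i - g i"
  using square_summable_add[of _ "\<lambda>i. - _ i"] by simp
lift_definition scaleR_l2 :: "real \<Rightarrow> 'a l2 \<Rightarrow> 'a l2" is "\<lambda>c f i. complex_of_real c * f i"
  by (rule square_summable_scale)

instance
  by standard (transfer; simp add: fun_eq_iff algebra_simps)+

end

lemma summable_cip: "(\<lambda>i. cnj (coord x i) * coord y i) summable_on UNIV"
proof (rule abs_summable_summable)
  show "(\<lambda>i. norm (cnj (coord x i) * coord y i)) summable_on UNIV"
    using square_summable_prod[OF coord_summable coord_summable, of x y] by (simp add: norm_mult)
qed

instantiation l2 :: (type) real_inner
begin

definition inner_l2 :: "'a l2 \<Rightarrow> 'a l2 \<Rightarrow> real" where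
  "inner_l2 x y = Re (cip (coord x) (coord y))"
definition norm_l2 :: "'a l2 \<Rightarrow> real" where
  "norm_l2 x = sqrt (inner x x)"
definition dist_l2 :: "'a l2 \<Rightarrow> 'a l2 \<Rightarrow> real" where
  "dist_l2 x y = norm (x - y)"
definition sgn_l2 :: "'a l2 \<Rightarrow> 'a l2" where
  "sgn_l2 x = inverse (norm x) *\<^sub>R x"
definition uniformity_l2 :: "('a l2 \<times> 'a l2) filter" where
  "uniformity_l2 = (INF e\<in>{0 <..}. principal {(x, y). dist x y < e})"
definition open_l2 :: "'a l2 set \<Rightarrow> bool" where
  "open_l2 U = (\<forall>x\<in>U. eventually (\<lambda>(x', y). x' = x \<longrightarrow> y \<in> U) uniformity)"

lemma inner_l2_infsum: "inner x y = (\<Sum>\<^sub>\<infinity>i. Re (cnj (coord x i) * coord y i))" for x y :: "'a l2"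
  unfolding inner_l2_def cip_def by (rule infsum_Re[OF summable_cip, symmetric])

lemma summable_Re_cip: "(\<lambda>i. Re (cnj (coord x i) * coord y i)) summable_on UNIV"
  by (rule summable_on_Re[OF summable_cip])

lemma Re_cnj_mult_self: "Re (cnj z * z) = (cmod z)\<^sup>2"
  by (simp add: cmod_power2) (simp add: power2_eq_square)

instance
proof
  fix x y z :: "'a l2" and r :: real
  show "dist x y = norm (x - y)" by (rule dist_l2_def)
  show "sgn x = inverse (norm x) *\<^sub>R x" by (rule sgn_l2_def)
  show "uniformity = (INF e\<in>{0 <..}. principal {(x, y). dist x (y::'a l2) < e})"
    by (rule uniformity_l2_def)
  show "open U = (\<forall>x\<in>U. eventually (\<lambda>(x', y). x' = x \<longrightarrow> y \<in> U) uniformity)" for U :: "'a l2 set"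
    by (rule open_l2_def)
  show "norm x = sqrt (inner x x)" by (rule norm_l2_def)
  show "inner x y = inner y x"
    unfolding inner_l2_infsum by (rule infsum_cong) (simp add: mult.commute)
  show "inner (x + y) z = inner x z + inner y z"
    unfolding inner_l2_infsum infsum_add[OF summable_Re_cip summable_Re_cip, symmetric]
    by (rule infsum_cong) (simp add: plus_l2.rep_eq algebra_simps)
  show "inner (r *\<^sub>R x) y = r * inner x y"
    unfolding inner_l2_infsum infsum_cmult_right'[symmetric]
    by (rule infsum_cong) (simp add: scaleR_l2.rep_eq algebra_simps)
  show "0 \<le> inner x x"
    unfolding inner_l2_infsum by (rule infsum_nonneg) (simp only: Re_cnj_mult_self zero_le_power2)
  show "(inner x x = 0) = (x = 0)"
  proof
    assume "inner x x = 0"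
    then have 0: "(\<Sum>\<^sub>\<infinity>i. (cmod (coord x i))\<^sup>2) = 0" by (simp only: inner_l2_infsum Re_cnj_mult_self)
    have "(cmod (coord x i))\<^sup>2 = 0" for i
      using nonneg_infsum_le_0D[OF order.eq_iff[THEN iffD1, OF 0, THEN conjunct1] coord_summable] by simp
    then show "x = 0" by (intro l2_eqI) (simp add: zero_l2.rep_eq)
  qed (simp add: inner_l2_infsum zero_l2.rep_eq)
qed

end

lemma norm_l2_power2: "(norm x)\<^sup>2 = (\<Sum>\<^sub>\<infinity>i. (cmod (coord x i))\<^sup>2)" for x :: "'g l2"
  by (simp only: power2_norm_eq_inner[of x] inner_l2_infsum Re_cnj_mult_self)

lemma ell2_norm_coord: "ell2_norm (coord x) = norm x"
  unfolding ell2_norm_def norm_l2_power2[symmetric] by simp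

lemma sum_coord_le_norm:
  fixes x :: "'g l2"
  assumes "finite F"
  shows "(\<Sum>i\<in>F. (cmod (coord x i))\<^sup>2) \<le> (norm x)\<^sup>2"
  unfolding norm_l2_power2 by (rule finite_sum_le_infsum[OF coord_summable]) (use assms in auto)

lemma cmod_coord_le: "cmod (coord x i) \<le> norm x"
  using sum_coord_le_norm[of "{i}" x] by (simp add: abs_le_square_iff[symmetric])

text \<open>The limit is taken coordinatewise. Bounds on finite partial sums survive it and do not
  depend on the finite set, so they pass to the full sums.\<close>

instance l2 :: (type) complete_space
proof
  fix X :: "nat \<Rightarrow> 'a l2" assume X: "Cauchy X"
  have "Cauchy (\<lambda>n. coord (X n) i)" for i
  proof (rule metric_CauchyI)
    fix e :: real assume "0 < e"
    then obtain M where M: "\<And>m n. m \<ge> M \<Longrightarrow> n \<ge> M \<Longrightarrow> dist (X m) (X n) < e"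
      using metric_CauchyD[OF X] by blast
    have "dist (coord (X m) i) (coord (X n) i) < e" if "m \<ge> M" "n \<ge> M" for m n
      using M[OF that] cmod_coord_le[of "X m - X n" i]
      by (simp add: dist_norm minus_l2.rep_eq)
    then show "\<exists>M. \<forall>m\<ge>M. \<forall>n\<ge>M. dist (coord (X m) i) (coord (X n) i) < e" by blast
  qed
  then have "\<exists>l. (\<lambda>n. coord (X n) i) \<longlonglongrightarrow> l" for i
    using Cauchy_convergent convergent_def by blast
  then obtain f where f: "\<And>i. (\<lambda>n. coord (X n) i) \<longlonglongrightarrow> f i" by metis
  have bound: "(\<Sum>i\<in>F. (cmod (coord (X n) i - f i))\<^sup>2) \<le> e\<^sup>2"
    if F: "finite F" and e: "\<And>m. m \<ge> M \<Longrightarrow> dist (X n) (X m) \<le> e" for F n M e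
  proof (rule tendsto_upperbound)
    show "(\<lambda>m. \<Sum>i\<in>F. (cmod (coord (X n) i - coord (X m) i))\<^sup>2)
        \<longlonglongrightarrow> (\<Sum>i\<in>F. (cmod (coord (X n) i - f i))\<^sup>2)"
      by (intro tendsto_intros f)
    show "\<forall>\<^sub>F m in sequentially. (\<Sum>i\<in>F. (cmod (coord (X n) i - coord (X m) i))\<^sup>2) \<le> e\<^sup>2"
      using eventually_ge_at_top[of M]
    proof eventually_elim
      case (elim m)
      have "(\<Sum>i\<in>F. (cmod (coord (X n) i - coord (X m) i))\<^sup>2) \<le> (norm (X n - X m))\<^sup>2"
        using sum_coord_le_norm[OF F, of "X n - X m"] by (simp add: minus_l2.rep_eq)
      also have "\<dots> \<le> e\<^sup>2" using e[OF elim] by (intro power_mono) (auto simp: dist_norm)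
      finally show ?case .
    qed
  qed simp
  have sq: "(\<lambda>i. (cmod (coord (X n) i - f i))\<^sup>2) summable_on UNIV
      \<and> (\<Sum>\<^sub>\<infinity>i. (cmod (coord (X n) i - f i))\<^sup>2) \<le> e\<^sup>2"
    if e: "\<And>m. m \<ge> M \<Longrightarrow> dist (X n) (X m) \<le> e" for n M e
  proof
    show *: "(\<lambda>i. (cmod (coord (X n) i - f i))\<^sup>2) summable_on UNIV"
      using bound[OF _ e] by (intro nonneg_bdd_above_summable_on bdd_aboveI[of _ "e\<^sup>2"]) auto
    show "(\<Sum>\<^sub>\<infinity>i. (cmod (coord (X n) i - f i))\<^sup>2) \<le> e\<^sup>2"
      using bound[OF _ e] by (intro infsum_le_finite_sums[OF *]) auto
  qed
  obtain M1 where "\<And>m n. m \<ge> M1 \<Longrightarrow> n \<ge> M1 \<Longrightarrow> dist (X m) (X n) < 1"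
    using metric_CauchyD[OF X, of 1] by auto
  then have "(\<lambda>i. (cmod (coord (X M1) i - f i))\<^sup>2) summable_on UNIV"
    using sq[of M1 M1 1] by (simp add: less_imp_le)
  from square_summable_add[OF coord_summable[of "- X M1"] this]
  have "(\<lambda>i. (cmod (f i))\<^sup>2) summable_on UNIV" by (simp add: uminus_l2.rep_eq)
  then have fc: "coord (Abs_l2 f) = f" by (simp add: Abs_l2_inverse)
  have "X \<longlonglongrightarrow> Abs_l2 f"
  proof (rule metric_LIMSEQ_I)
    fix e :: real assume "0 < e"
    then obtain M where M: "\<And>m n. m \<ge> M \<Longrightarrow> n \<ge> M \<Longrightarrow> dist (X m) (X n) < e / 2"
      using metric_CauchyD[OF X, of "e/2"] by auto
    have "dist (X n) (Abs_l2 f) < e" if "n \<ge> M" for n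
    proof -
      have "(norm (X n - Abs_l2 f))\<^sup>2 \<le> (e/2)\<^sup>2"
        using sq[of M n "e/2"] M[OF that] by (simp add: norm_l2_power2 minus_l2.rep_eq fc less_imp_le)
      then have "norm (X n - Abs_l2 f) \<le> e / 2" by (rule power2_le_imp_le) (use \<open>0 < e\<close> in simp)
      then show ?thesis using \<open>0 < e\<close> by (simp add: dist_norm)
    qed
    then show "\<exists>no. \<forall>n\<ge>no. dist (X n) (Abs_l2 f) < e" by blast
  qed
  then show "convergent X" by (auto simp: convergent_def)
qed

text \<open>As \<open>cip\<close> is conjugate linear in its first argument, its imaginary part is a
  real inner product with \<i> x. Real identities valid for x and \<i> x alike thus become complex
  ones.\<close>

lemma cip_eq_inner: "cip (coord x) (coord y) = Complex (inner x y) (inner (scaleC \<i> x) y)"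
proof (rule complex_eqI)
  have "inner (scaleC \<i> x) y = (\<Sum>\<^sub>\<infinity>i. Im (cnj (coord x i) * coord y i))"
    unfolding inner_l2_infsum by (rule infsum_cong) (simp add: scaleC.rep_eq)
  also have "\<dots> = Im (cip (coord x) (coord y))"
    unfolding cip_def by (rule infsum_Im[OF summable_cip])
  finally show "Im (cip (coord x) (coord y)) = Im (Complex (inner x y) (inner (scaleC \<i> x) y))"
    by simp
qed (simp add: inner_l2_def)

lemma inner_scaleC: "inner (scaleC c x) y = inner x (scaleC (cnj c) y)"
  unfolding inner_l2_infsum by (rule infsum_cong) (simp add: scaleC.rep_eq algebra_simps)

lemma bounded_linear_scaleC: "bounded_linear (scaleC c :: 'g l2 \<Rightarrow> 'g l2)"
proof (rule bounded_linear_intro[of _ "cmod c"])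
  fix x y :: "'g l2" and r :: real
  show "scaleC c (x + y) = scaleC c x + scaleC c y"
    by (rule l2_eqI) (simp add: scaleC.rep_eq plus_l2.rep_eq algebra_simps)
  show "scaleC c (r *\<^sub>R x) = r *\<^sub>R scaleC c x"
    by (rule l2_eqI) (simp add: scaleC.rep_eq scaleR_l2.rep_eq algebra_simps)
  have "(norm (scaleC c x))\<^sup>2 = (norm x * cmod c)\<^sup>2"
    by (simp add: norm_l2_power2 power_mult_distrib scaleC.rep_eq norm_mult infsum_cmult_right' mult.commute)
  then show "norm (scaleC c x) \<le> norm x * cmod c" by (simp add: power2_eq_iff_nonneg)
qed

section \<open>The spectral measure of a bounded operator\<close>

text \<open>Pascal's rule in the shape of the induction step of \<open>W_sum\<close>.\<close>

lemma sum_choose_Suc: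
  fixes f :: "nat \<Rightarrow> real"
  shows "(\<Sum>i\<le>Suc n. real (Suc n choose i) * f i) =
    (\<Sum>i\<le>n. real (n choose i) * f (Suc i)) + (\<Sum>i\<le>n. real (n choose i) * f i)"
proof -
  have "(\<Sum>i\<le>Suc n. real (n choose i) * f i) = f 0 + (\<Sum>i\<le>n. real (n choose Suc i) * f (Suc i))"
    by (subst sum.atMost_Suc_shift) simp
  then have "(\<Sum>i\<le>n. real (n choose i) * f i) = f 0 + (\<Sum>i\<le>n. real (n choose Suc i) * f (Suc i))"
    by (simp add: binomial_eq_0)
  moreover have "(\<Sum>i\<le>Suc n. real (Suc n choose i) * f i) =
      f 0 + (\<Sum>i\<le>n. real (n choose i) * f (Suc i)) + (\<Sum>i\<le>n. real (n choose Suc i) * f (Suc i))"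
    by (subst sum.atMost_Suc_shift) (simp add: algebra_simps sum.distrib)
  ultimately show ?thesis by simp
qed

section \<open>Scalar spectral measures of a positive contraction: the Hausdorff moment
  problem\<close>

locale positive_contraction =
  fixes T :: "'a::{real_inner, complete_space} \<Rightarrow> 'a"
  assumes bounded_linear_T: "bounded_linear T"
    and T_sym: "inner (T x) y = inner x (T y)"
    and T_nonneg: "0 \<le> inner x (T x)"
    and T_le: "inner x (T x) \<le> inner x x"
begin

sublocale T: bounded_linear T by (rule bounded_linear_T)

definition D :: "'a \<Rightarrow> 'a" where "D x = x - T x"

lemma D_sym: "inner (D x) y = inner x (D y)"
  by (simp add: D_def inner_diff_left inner_diff_right T_sym)

lemma D_nonneg: "0 \<le> inner x (D x)"
  using T_le[of x] by (simp add: D_def inner_diff_right)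

lemma TD: "T (D x) = D (T x)"
  by (simp add: D_def T.diff)

lemma T_pow_D: "T ((D ^^ j) x) = (D ^^ j) (T x)"
  by (induction j) (simp_all add: TD)

lemma T_pow_linear: "linear (T ^^ k)"
proof (induction k)
  case (Suc k)
  then show ?case using linear_compose[OF Suc T.linear_axioms] by (simp add: comp_def)
qed (simp add: linear_iff)

lemma T_pow_sym: "inner ((T ^^ k) x) y = inner x ((T ^^ k) y)"
  by (induction k arbitrary: x y) (simp_all add: T_sym funpow_swap1)

text \<open>For a spectral measure of T this would be the integral of t^i (1 - t)^j. Nonnegativity
  of all these numbers is Hausdorff's criterion for moments on [0, 1].\<close>

definition W :: "nat \<Rightarrow> nat \<Rightarrow> 'a \<Rightarrow> real" where
  "W i j x = inner x ((T ^^ i) ((D ^^ j) x))"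

lemma W_0: "W k 0 x = inner x ((T ^^ k) x)"
  by (simp add: W_def)

lemma W_rec: "W i j x = W (Suc i) j x + W i (Suc j) x"
proof -
  have "(T ^^ i) (T y) + (T ^^ i) (D y) = (T ^^ i) y" for y
    by (simp add: D_def linear_diff[OF T_pow_linear])
  from this[of "(D ^^ j) x"] show ?thesis
    by (simp add: W_def inner_add_right[symmetric] funpow_swap1)
qed

text \<open>Two equal factors move to the two sides of the inner product, so only exponents 0 and 1
  remain. The mixed case rests on T D = T D T + D T D, which replaces a square root of T.\<close>

lemma W_nonneg: "0 \<le> W i j x"
proof (induction i arbitrary: x rule: induct_nat_012)
  case 0
  show ?case
  proof (induction j arbitrary: x rule: induct_nat_012)
    case (ge2 j)
    then show ?case using ge2(1)[of "D x"] by (simp add: W_def D_sym funpow_swap1)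
  qed (simp_all add: W_def D_nonneg)
next
  case 1
  show ?case
  proof (induction j arbitrary: x rule: induct_nat_012)
    case 1
    have "inner x (T (D x)) = inner (T x) (D (T x)) + inner (D x) (T (D x))"
      by (simp add: D_def T.diff inner_diff_left inner_diff_right T_sym)
    then show ?case using D_nonneg[of "T x"] T_nonneg[of "D x"] by (simp add: W_def)
  next
    case (ge2 j)
    then show ?case using ge2(1)[of "D x"]
      by (simp add: W_def D_sym funpow_swap1 TD[symmetric])
  qed (simp add: W_def T_nonneg)
next
  case (ge2 i)
  then show ?case using ge2(1)[of "T x"] by (simp add: W_def T_sym funpow_swap1 T_pow_D)
qed

text \<open>Binomial expansion of (T + D)^n = 1.\<close>

lemma W_sum: "W k l x = (\<Sum>i\<le>n. real (n choose i) * W (k + i) (l + (n - i)) x)"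
proof (induction n arbitrary: k l)
  case (Suc n)
  have "(\<Sum>i\<le>n. real (n choose i) * W (k + i) (l + (Suc n - i)) x) =
      (\<Sum>i\<le>n. real (n choose i) * W (k + i) (Suc l + (n - i)) x)"
    by (rule sum.cong) (simp_all add: Suc_diff_le)
  then show ?case
    unfolding sum_choose_Suc W_rec[of k l] Suc[of "Suc k" l] Suc[of k "Suc l"] by simp
qed simp

text \<open>
  The Bernstein weights \<open>(n choose j) W j (n - j)\<close> at the points \<open>j / n\<close> form positive measures
  whose moments converge to those of \<open>T\<close>.
\<close>

lemma Bernstein_moments:
  "(\<lambda>n. \<Sum>j\<le>n. real (n choose j) * W (a + j) (n - j) x * (real j / real n) ^ k)
    \<longlonglongrightarrow> W (a + k) 0 x"
proof (induction k arbitrary: a)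
  case 0
  show ?case using W_sum[of a 0 x] by simp
next
  case (Suc k)
  define F where "F n = (\<Sum>j\<le>n. real (n choose j) * W (Suc a + j) (n - j) x * (real j / real n) ^ k)" for n
  define H where "H n = (\<Sum>j\<le>n. real (n choose j) * W (Suc a + j) (n - j) x * (real (Suc j) / real (Suc n)) ^ k)" for n
  have F: "F \<longlonglongrightarrow> W (a + Suc k) 0 x" using Suc[of "Suc a"] by (simp add: F_def[THEN ext])
  \<comment> \<open>One factor j / n is absorbed by the binomial coefficient and raises a by one.
    What remains differs from the induction hypothesis only in the sample points, (j + 1) / (n + 1)
    instead of j / n.\<close>
  have eq: "(\<Sum>j\<le>Suc n. real (Suc n choose j) * W (a + j) (Suc n - j) x * (real j / real (Suc n)) ^ Suc k) = H n" for n
  proof -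
    have ch: "real (Suc n choose Suc j) * (real (Suc j) / real (Suc n)) = real (n choose j)" for j
    proof -
      have "real (Suc j) * real (Suc n choose Suc j) = real (Suc n) * real (n choose j)"
        by (simp only: of_nat_mult[symmetric] Suc_times_binomial)
      then show ?thesis by (simp only: times_divide_eq_right mult.commute[of _ "real (Suc j)"]) simp
    qed
    have "(\<Sum>j\<le>Suc n. real (Suc n choose j) * W (a + j) (Suc n - j) x * (real j / real (Suc n)) ^ Suc k) =
        (\<Sum>j\<le>n. (real (Suc n choose Suc j) * (real (Suc j) / real (Suc n))) * W (Suc a + j) (n - j) x
             * (real (Suc j) / real (Suc n)) ^ k)"
      by (subst sum.atMost_Suc_shift) (simp add: mult_ac)
    also have "\<dots> = H n" by (simp only: ch H_def)
    finally show ?thesis .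
  qed
  \<comment> \<open>Corresponding sample points in [0, 1] are at most 1 / (n + 1) apart, and the
    weights add up to \<open>W (Suc a) 0 x\<close>. For n = 0 the point j / n is 0 by the convention
    on division, and the bound persists.\<close>
  have diff: "\<bar>H n - F n\<bar> \<le> W (Suc a) 0 x * (real k * (1 / real (Suc n)))" for n
  proof -
    have "\<bar>(real (Suc j) / real (Suc n)) ^ k - (real j / real n) ^ k\<bar> \<le> real k * (1 / real (Suc n))"
      if j: "j \<le> n" for j
    proof -
      have "\<bar>(real (Suc j) / real (Suc n)) ^ k - (real j / real n) ^ k\<bar>
          \<le> real k * \<bar>real (Suc j) / real (Suc n) - real j / real n\<bar>"
        using norm_power_diff[of "real (Suc j) / real (Suc n)" "real j / real n" k] j
        by (simp add: divide_le_eq)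
      moreover have "\<bar>real (Suc j) / real (Suc n) - real j / real n\<bar> \<le> 1 / real (Suc n)"
      proof (cases "n = 0")
        case False
        have "real (Suc j) / real (Suc n) - real j / real n = (1 - real j / real n) / real (Suc n)"
          using False by (simp add: field_simps)
        moreover have "0 \<le> 1 - real j / real n" "1 - real j / real n \<le> 1" using j False by auto
        ultimately show ?thesis by (simp add: divide_right_mono)
      qed (use j in simp)
      ultimately show ?thesis by (rule order_trans[OF _ mult_left_mono]) simp
    qed note * = this
    have "\<bar>H n - F n\<bar> = \<bar>\<Sum>j\<le>n. real (n choose j) * W (Suc a + j) (n - j) x *
        ((real (Suc j) / real (Suc n)) ^ k - (real j / real n) ^ k)\<bar>"
      by (simp add: H_def F_def sum_subtractf right_diff_distrib)
    also have "\<dots> \<le> (\<Sum>j\<le>n. real (n choose j) * W (Suc a + j) (n - j) x * (real k * (1 / real (Suc n))))"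
    proof (rule order_trans[OF sum_abs sum_mono])
      fix j assume "j \<in> {..n}"
      then have j: "j \<le> n" by simp
      have w: "0 \<le> real (n choose j) * W (Suc a + j) (n - j) x" by (simp add: W_nonneg)
      show "\<bar>real (n choose j) * W (Suc a + j) (n - j) x *
          ((real (Suc j) / real (Suc n)) ^ k - (real j / real n) ^ k)\<bar>
        \<le> real (n choose j) * W (Suc a + j) (n - j) x * (real k * (1 / real (Suc n)))"
        unfolding abs_mult[of "real (n choose j) * W (Suc a + j) (n - j) x"] abs_of_nonneg[OF w]
        by (rule mult_left_mono[OF *[OF j] w])
    qed
    also have "\<dots> = W (Suc a) 0 x * (real k * (1 / real (Suc n)))"
      unfolding sum_distrib_right[symmetric] using W_sum[of "Suc a" 0 x n] by simp
    finally show ?thesis .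
  qed
  have "(\<lambda>n. W (Suc a) 0 x * (real k * (1 / real (Suc n)))) \<longlonglongrightarrow> W (Suc a) 0 x * (real k * 0)"
    by (rule tendsto_mult_left[OF tendsto_mult_left[OF LIMSEQ_Suc[OF lim_1_over_n]]])
  then have lim0: "(\<lambda>n. W (Suc a) 0 x * (real k * (1 / real (Suc n)))) \<longlonglongrightarrow> 0"
    by (simp only: mult_zero_right)
  have "(\<lambda>n. H n - F n) \<longlonglongrightarrow> 0"
    by (rule Lim_null_comparison[OF always_eventually lim0]) (unfold real_norm_def, intro allI diff)
  from tendsto_add[OF this F] have "H \<longlonglongrightarrow> W (a + Suc k) 0 x" by simp
  then show ?case unfolding eq[symmetric] by (rule LIMSEQ_imp_Suc)
qed

definition is_moment_measure :: "'a \<Rightarrow> real measure \<Rightarrow> bool" where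
  "is_moment_measure x N \<longleftrightarrow> finite_measure N \<and> sets N = sets borel \<and> (AE t in N. 0 \<le> t \<and> t \<le> 1) \<and>
     (\<forall>k. (\<integral>t. t ^ k \<partial>N) = inner x ((T ^^ k) x))"

text \<open>The Bernstein measures sit on [0, 1], hence form a tight family, and a weak limit of a
  subsequence has the right moments. The normalization of x makes them probability measures, as the
  compactness theorem demands.\<close>

lemma moment_measure_exists_unit:
  assumes x: "norm x = 1"
  shows "\<exists>N. is_moment_measure x N"
proof -
  define \<mu> where "\<mu> n = distr (point_measure {..n} (\<lambda>j. ennreal (real (n choose j) * W j (n - j) x)))
    borel (\<lambda>j. real j / real n)" for n
  have meas: "(\<lambda>j. real j / real n) \<in> measurable (point_measure {..n} w) borel" for n w
    by (simp add: measurable_def space_point_measure sets_point_measure)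
  have em: "emeasure (\<mu> n) A = 1" if A: "A \<in> sets borel" "{0..1} \<subseteq> A" for n A
  proof -
    have sub: "(\<lambda>j. real j / real n) -` A \<inter> {..n} = {..n}"
      using A(2) by (auto simp: divide_le_eq intro!: subsetD[OF A(2)])
    have "emeasure (\<mu> n) A = emeasure (point_measure {..n} (\<lambda>j. ennreal (real (n choose j) * W j (n - j) x))) {..n}"
      unfolding \<mu>_def by (subst emeasure_distr[OF meas A(1)]) (simp add: space_point_measure sub)
    also have "\<dots> = (\<Sum>j\<le>n. ennreal (real (n choose j) * W j (n - j) x))"
      by (simp add: emeasure_point_measure_finite)
    also have "\<dots> = ennreal (\<Sum>j\<le>n. real (n choose j) * W j (n - j) x)"
      by (rule sum_ennreal) (simp add: W_nonneg)
    also have "(\<Sum>j\<le>n. real (n choose j) * W j (n - j) x) = 1"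
      using W_sum[of 0 0 x n] x by (simp add: W_0 dot_square_norm)
    finally show ?thesis by simp
  qed
  have rd: "real_distribution (\<mu> n)" for n
  proof -
    have "prob_space (\<mu> n)" by (rule prob_spaceI) (use em[of UNIV n] in \<open>simp add: \<mu>_def\<close>)
    then show ?thesis by (simp add: real_distribution_def real_distribution_axioms_def \<mu>_def)
  qed
  have int: "(\<integral>t. f t \<partial>\<mu> n) = (\<Sum>j\<le>n. real (n choose j) * W j (n - j) x * f (real j / real n))"
    if "f \<in> borel_measurable borel" for f :: "real \<Rightarrow> real" and n
    unfolding \<mu>_def
    by (subst integral_distr[OF meas that], subst lebesgue_integral_point_measure_finite)
      (auto simp: W_nonneg)
  \<comment> \<open>Tightness is phrased with half-open intervals; the left end -1 keeps the atom at
    0 inside.\<close>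
  have m1: "measure (\<mu> n) {-1<..1} = 1" for n
    using em[of "{-1<..1}" n] by (simp add: measure_def subset_eq)
  have "\<exists>a b. a < b \<and> (\<forall>n. measure (\<mu> n) {a<..b} > 1 - \<epsilon>)" if "\<epsilon> > 0" for \<epsilon> :: real
    by (rule exI[of _ "-1"], rule exI[of _ 1]) (simp add: m1 that)
  with rd have "tight \<mu>" unfolding tight_def by blast
  from tight_imp_convergent_subsubsequence[OF this strict_mono_id] obtain r M
    where r: "strict_mono r" and M: "real_distribution M" and conv: "weak_conv_m (\<mu> \<circ> r) M"
    by (auto simp: id_def comp_def)
  interpret M: real_distribution M by fact
  have lim: "(\<lambda>n. \<integral>t. f t \<partial>\<mu> (r n)) \<longlonglongrightarrow> (\<integral>t. f t \<partial>M)"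
    if "continuous_on UNIV f" "\<And>t. \<bar>f t\<bar> \<le> B" for f :: "real \<Rightarrow> real" and B
    using weak_conv_imp_integral_bdd_continuous_conv[of "\<mu> \<circ> r" M f B] rd M conv that
    by (simp add: continuous_on_eq_continuous_at)
  \<comment> \<open>Powers are unbounded on the line; composed with this clamp they become
    admissible test functions and are unchanged on [0, 1].\<close>
  define q where "q t = max 0 (min 1 t)" for t :: real
  have q: "continuous_on UNIV q" "\<And>t. 0 \<le> q t" "\<And>t. q t \<le> 1" "\<And>t. 0 \<le> t \<Longrightarrow> t \<le> 1 \<Longrightarrow> q t = t"
    unfolding q_def by (auto intro!: continuous_intros)
  have qm: "q \<in> borel_measurable borel" using q(1) by (simp add: borel_measurable_continuous_onI)
  have supp: "AE t in M. 0 \<le> t \<and> t \<le> 1"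
  proof -
    \<comment> \<open>A bounded continuous function vanishing exactly on [0, 1]. Its integrals
      against the approximating measures are zero, hence so is the one against the limit.\<close>
    define g where "g t = min 1 \<bar>t - q t\<bar>" for t
    have g: "continuous_on UNIV g" "\<And>t. \<bar>g t\<bar> \<le> 1" "\<And>t. 0 \<le> g t"
      unfolding g_def by (auto intro!: continuous_intros q(1))
    have gm: "g \<in> borel_measurable borel" using g(1) by (simp add: borel_measurable_continuous_onI)
    have "(\<integral>t. g t \<partial>\<mu> n) = 0" for n
      unfolding int[OF gm] by (rule sum.neutral) (auto simp: g_def q(4) divide_le_eq)
    with lim[OF g(1,2)] have "(\<integral>t. g t \<partial>M) = 0" by (simp add: LIMSEQ_const_iff)
    moreover have "integrable M g"
      by (rule M.integrable_const_bound[of _ 1]) (use g gm in \<open>auto\<close>)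
    ultimately have "AE t in M. g t = 0"
      using integral_nonneg_eq_0_iff_AE[of M g] g(3) by simp
    then show ?thesis
      by eventually_elim (auto simp: g_def q_def min_def max_def split: if_splits)
  qed
  have "(\<integral>t. t ^ k \<partial>M) = inner x ((T ^^ k) x)" for k
  proof -
    have "(\<lambda>n. \<integral>t. q t ^ k \<partial>\<mu> (r n)) \<longlonglongrightarrow> (\<integral>t. q t ^ k \<partial>M)"
      by (rule lim[of _ 1]) (auto intro!: continuous_intros q(1) power_le_one simp: q)
    moreover have "(\<lambda>n. \<integral>t. q t ^ k \<partial>\<mu> n) \<longlonglongrightarrow> W k 0 x"
    proof -
      have "(\<integral>t. q t ^ k \<partial>\<mu> n) = (\<Sum>j\<le>n. real (n choose j) * W (0 + j) (n - j) x * (real j / real n) ^ k)" for n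
        unfolding int[OF borel_measurable_power[OF qm]]
        by (rule sum.cong) (auto simp: q(4) divide_le_eq)
      then show ?thesis using Bernstein_moments[of 0 x k] by simp
    qed
    from LIMSEQ_subseq_LIMSEQ[OF this r] have "(\<lambda>n. \<integral>t. q t ^ k \<partial>\<mu> (r n)) \<longlonglongrightarrow> W k 0 x"
      by (simp add: comp_def)
    ultimately have "(\<integral>t. q t ^ k \<partial>M) = W k 0 x" by (rule LIMSEQ_unique)
    moreover have "(\<integral>t. q t ^ k \<partial>M) = (\<integral>t. t ^ k \<partial>M)"
      by (rule integral_cong_AE) (use supp qm in \<open>auto simp: q(4)\<close>)
    ultimately show ?thesis by (simp add: W_0)
  qed
  with supp show ?thesis
    unfolding is_moment_measure_def by (intro exI[of _ M]) (auto intro: M.finite_measure_axioms)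
qed

lemma moment_measure_exists: "\<exists>N. is_moment_measure x N"
proof (cases "x = 0")
  case True
  have "is_moment_measure x (null_measure borel)"
    unfolding is_moment_measure_def using True
    by (auto intro!: finite_measureI AE_I[of _ _ UNIV])
  then show ?thesis by blast
next
  case False
  define u where "u = (1 / norm x) *\<^sub>R x"
  have u: "norm u = 1" "x = norm x *\<^sub>R u" using False by (simp_all add: u_def)
  obtain N where N: "is_moment_measure u N" using moment_measure_exists_unit[OF u(1)] by blast
  interpret N: finite_measure N using N by (simp add: is_moment_measure_def)
  let ?N = "density N (\<lambda>_. ennreal ((norm x)\<^sup>2))"
  have "finite_measure ?N"
    by (rule finite_measureI) (simp add: emeasure_density_const ennreal_mult_eq_top_iff N.emeasure_finite)
  moreover have "(\<integral>t. t ^ k \<partial>?N) = inner x ((T ^^ k) x)" for k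
  proof -
    have [measurable]: "(\<lambda>t. t ^ k) \<in> borel_measurable N"
      using N by (simp add: is_moment_measure_def cong: measurable_cong_sets)
    have "(\<integral>t. t ^ k \<partial>?N) = (norm x)\<^sup>2 * (\<integral>t. t ^ k \<partial>N)"
      by (subst integral_density) auto
    also have "\<dots> = inner (norm x *\<^sub>R u) ((T ^^ k) (norm x *\<^sub>R u))"
      using N by (simp add: is_moment_measure_def linear_scale[OF T_pow_linear] power2_eq_square)
    finally show ?thesis by (simp only: u(2)[symmetric])
  qed
  moreover have "AE t in ?N. 0 \<le> t \<and> t \<le> 1"
    using N by (subst AE_density) (auto simp: is_moment_measure_def)
  ultimately have "is_moment_measure x ?N"
    using N by (simp add: is_moment_measure_def)
  then show ?thesis by blast
qed

definition \<nu> :: "'a \<Rightarrow> real measure" where "\<nu> x = (SOME N. is_moment_measure x N)"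

lemma \<nu>: "is_moment_measure x (\<nu> x)"
  unfolding \<nu>_def by (rule someI_ex[OF moment_measure_exists])

end

section \<open>Uniqueness in the moment problem on [0, 1]\<close>

locale unit_interval_measure = finite_measure N for N :: "real measure" +
  assumes sets_N [measurable_cong]: "sets N = sets borel"
    and AE_N: "AE t in N. 0 \<le> t \<and> t \<le> 1"
begin

lemma space_N [simp]: "space N = UNIV"
  using sets_eq_imp_space_eq[OF sets_N] by simp

lemma integrable_bounded:
  fixes f :: "real \<Rightarrow> real"
  assumes [measurable]: "f \<in> borel_measurable borel" and b: "\<And>t. 0 \<le> t \<Longrightarrow> t \<le> 1 \<Longrightarrow> \<bar>f t\<bar> \<le> B"
  shows "integrable N f"
proof (rule integrable_const_bound[of _ B])
  show "AE t in N. norm (f t) \<le> B" using AE_N by eventually_elim (use b in auto)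
qed measurable

lemma integrable_power: "integrable N (\<lambda>t. t ^ k)"
  by (rule integrable_bounded[of _ 1]) (simp_all add: power_le_one)

lemma unit_interval_density:
  fixes f :: "real \<Rightarrow> real"
  assumes [measurable]: "f \<in> borel_measurable borel"
    and b: "\<And>t. 0 \<le> t \<Longrightarrow> t \<le> 1 \<Longrightarrow> 0 \<le> f t \<and> f t \<le> B"
  shows "unit_interval_measure (density N (\<lambda>t. ennreal (f t)))"
    and "g \<in> borel_measurable borel \<Longrightarrow> (\<integral>t. g t \<partial>density N (\<lambda>t. ennreal (f t))) = (\<integral>t. f t * g t \<partial>N)"
    and "A \<in> sets borel \<Longrightarrow> measure (density N (\<lambda>t. ennreal (f t))) A = (\<integral>t. f t * indicator A t \<partial>N)"
proof -
  have int: "(\<integral>t. g t \<partial>density N (\<lambda>t. ennreal (f t))) = (\<integral>t. f t * g t \<partial>N)"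
    if [measurable]: "g \<in> borel_measurable borel" for g :: "real \<Rightarrow> real"
  proof (subst integral_density)
    show "AE t in N. 0 \<le> f t" using AE_N by eventually_elim (use b in auto)
  qed auto
  then show "g \<in> borel_measurable borel \<Longrightarrow> (\<integral>t. g t \<partial>density N (\<lambda>t. ennreal (f t))) = (\<integral>t. f t * g t \<partial>N)" .
  have "finite_measure (density N (\<lambda>t. ennreal (f t)))"
  proof (rule finite_measureI)
    have "emeasure (density N (\<lambda>t. ennreal (f t))) UNIV = (\<integral>\<^sup>+t. ennreal (f t) \<partial>N)"
      by (subst emeasure_density) (auto intro!: nn_integral_cong)
    also have "\<dots> \<le> (\<integral>\<^sup>+t. ennreal B \<partial>N)"
      by (rule nn_integral_mono_AE) (use AE_N in eventually_elim, use b in \<open>auto intro!: ennreal_leI\<close>)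
    also have "\<dots> < \<top>"
      using emeasure_finite[of UNIV] by (auto simp: ennreal_mult_eq_top_iff less_top[symmetric])
    finally show "emeasure (density N (\<lambda>t. ennreal (f t))) (space (density N (\<lambda>t. ennreal (f t)))) \<noteq> \<infinity>"
      by simp
  qed
  moreover have "AE t in density N (\<lambda>t. ennreal (f t)). 0 \<le> t \<and> t \<le> 1"
    using AE_N by (subst AE_density) auto
  ultimately show "unit_interval_measure (density N (\<lambda>t. ennreal (f t)))"
    by (simp add: unit_interval_measure_def unit_interval_measure_axioms_def sets_N)
  assume [measurable]: "A \<in> sets borel"
  have "measure (density N (\<lambda>t. ennreal (f t))) A = (\<integral>t. indicator A t \<partial>density N (\<lambda>t. ennreal (f t)))"
    by simp
  also have "\<dots> = (\<integral>t. f t * indicator A t \<partial>N)" by (rule int) simp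
  finally show "measure (density N (\<lambda>t. ennreal (f t))) A = (\<integral>t. f t * indicator A t \<partial>N)" .
qed

end

text \<open>Serves to recognize the scalar measure of a projected vector as a restriction of the
  original one.\<close>

lemma density_indicator_eqI:
  fixes N N' :: "real measure"
  assumes N: "finite_measure N" "sets N = sets borel" and N': "finite_measure N'" "sets N' = sets borel"
    and C: "C \<in> sets borel" and eq: "\<And>B. B \<in> sets borel \<Longrightarrow> measure N' B = measure N (B \<inter> C)"
  shows "N' = density N (indicator C)"
proof (rule measure_eqI)
  interpret N: finite_measure N by fact
  interpret N': finite_measure N' by fact
  fix B assume "B \<in> sets N'"
  then have B: "B \<in> sets borel" by (simp add: N')
  have "emeasure (density N (indicator C)) B = (\<integral>\<^sup>+t. indicator C t * indicator B t \<partial>N)"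
    by (rule emeasure_density) (use B C N in auto)
  also have "\<dots> = (\<integral>\<^sup>+t. indicator (B \<inter> C) t \<partial>N)"
    by (rule nn_integral_cong) (auto simp: indicator_def)
  also have "\<dots> = emeasure N (B \<inter> C)" by (rule nn_integral_indicator) (use B C N in auto)
  finally show "emeasure N' B = emeasure (density N (indicator C)) B"
    by (simp add: N.emeasure_eq_measure N'.emeasure_eq_measure eq[OF B])
qed (simp add: N N')

text \<open>Posed for finite signed combinations because polarized forms are differences of
  measures. The relation passes from polynomials to continuous functions by Stone-Weierstrass, to
  half lines by piecewise linear functions, and to Borel sets by a Dynkin argument.\<close>

lemma moments_determine_measure:
  fixes c :: "'i \<Rightarrow> real" and N :: "'i \<Rightarrow> real measure"
  assumes J: "finite J" and N: "\<And>i. i \<in> J \<Longrightarrow> unit_interval_measure (N i)"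
    and mom: "\<And>k. (\<Sum>i\<in>J. c i * (\<integral>t. t ^ k \<partial>N i)) = 0"
    and B: "B \<in> sets borel"
  shows "(\<Sum>i\<in>J. c i * measure (N i) B) = 0"
proof -
  have cont: "(\<Sum>i\<in>J. c i * (\<integral>t. f t \<partial>N i)) = 0" if f: "continuous_on UNIV f" for f :: "real \<Rightarrow> real"
  proof -
    have fm [measurable]: "f \<in> borel_measurable borel" using f by (rule borel_measurable_continuous_onI)
    have "bounded (f ` {0..1})"
      by (rule compact_imp_bounded[OF compact_continuous_image[OF continuous_on_subset[OF f subset_UNIV]]]) simp
    then obtain F where F': "\<forall>t\<in>{0..1}. \<bar>f t\<bar> \<le> F" by (auto simp: bounded_iff)
    then have F: "\<bar>f t\<bar> \<le> F" if "0 \<le> t" "t \<le> 1" for t using that by auto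
    define K where "K = (\<Sum>i\<in>J. \<bar>c i\<bar> * measure (N i) UNIV)"
    have K: "\<bar>\<Sum>i\<in>J. c i * (\<integral>t. f t \<partial>N i)\<bar> \<le> e * K" if "e > 0" for e
    proof -
      obtain g where g: "real_polynomial_function g" and fg: "\<And>t. t \<in> {0..1} \<Longrightarrow> \<bar>f t - g t\<bar> < e"
        using Stone_Weierstrass_real_polynomial_function[of "{0..1::real}" f e] continuous_on_subset[OF f] \<open>e > 0\<close>
        by (metis compact_Icc subset_UNIV)
      obtain a n where an: "g = (\<lambda>x. \<Sum>i\<le>n. a i * x ^ i)"
        using g real_polynomial_function_iff_sum by blast
      have gm [measurable]: "g \<in> borel_measurable borel" unfolding an by measurable
      have ig: "(\<integral>t. g t \<partial>N i) = (\<Sum>j\<le>n. a j * (\<integral>t. t ^ j \<partial>N i))" if "i \<in> J" for i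
      proof -
        interpret unit_interval_measure "N i" using N[OF that] .
        show ?thesis unfolding an by (simp add: integrable_power)
      qed
      have "(\<Sum>i\<in>J. c i * (\<integral>t. g t \<partial>N i)) = (\<Sum>i\<in>J. \<Sum>j\<le>n. a j * (c i * (\<integral>t. t ^ j \<partial>N i)))"
        by (rule sum.cong) (simp_all add: ig sum_distrib_left mult.left_commute)
      also have "\<dots> = (\<Sum>j\<le>n. a j * (\<Sum>i\<in>J. c i * (\<integral>t. t ^ j \<partial>N i)))"
        by (subst sum.swap) (simp add: sum_distrib_left)
      finally have g0: "(\<Sum>i\<in>J. c i * (\<integral>t. g t \<partial>N i)) = 0" by (simp add: mom)
      have "\<bar>c i * (\<integral>t. f t \<partial>N i) - c i * (\<integral>t. g t \<partial>N i)\<bar> \<le> e * (\<bar>c i\<bar> * measure (N i) UNIV)" if "i \<in> J" for i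
      proof -
        interpret unit_interval_measure "N i" using N[OF that] .
        have if': "integrable (N i) f" by (rule integrable_bounded[OF fm F])
        have ig': "integrable (N i) g" unfolding an by (simp add: integrable_power)
        have "\<bar>(\<integral>t. f t \<partial>N i) - (\<integral>t. g t \<partial>N i)\<bar> = \<bar>\<integral>t. f t - g t \<partial>N i\<bar>"
          using if' ig' by simp
        also have "\<dots> \<le> (\<integral>t. \<bar>f t - g t\<bar> \<partial>N i)" by (rule integral_abs_bound)
        also have "\<dots> \<le> (\<integral>t. e \<partial>N i)"
        proof (rule integral_mono_AE)
          show "AE t in N i. \<bar>f t - g t\<bar> \<le> e"
            using AE_N by eventually_elim (use fg in \<open>auto intro: less_imp_le\<close>)
        qed (use if' ig' in auto)
        also have "\<dots> = e * measure (N i) UNIV" by simp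
        finally have "\<bar>c i\<bar> * \<bar>(\<integral>t. f t \<partial>N i) - (\<integral>t. g t \<partial>N i)\<bar> \<le> \<bar>c i\<bar> * (e * measure (N i) UNIV)"
          by (rule mult_left_mono) simp
        then show ?thesis by (simp add: abs_mult[symmetric] right_diff_distrib mult.left_commute)
      qed
      then have "(\<Sum>i\<in>J. \<bar>c i * (\<integral>t. f t \<partial>N i) - c i * (\<integral>t. g t \<partial>N i)\<bar>) \<le> e * K"
        unfolding K_def sum_distrib_left by (rule sum_mono)
      then have "\<bar>\<Sum>i\<in>J. (c i * (\<integral>t. f t \<partial>N i) - c i * (\<integral>t. g t \<partial>N i))\<bar> \<le> e * K"
        by (rule order_trans[OF sum_abs])
      then show ?thesis by (simp add: sum_subtractf g0)
    qed
    have K0: "K \<ge> 0" unfolding K_def by (intro sum_nonneg mult_nonneg_nonneg) auto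
    have "\<bar>\<Sum>i\<in>J. c i * (\<integral>t. f t \<partial>N i)\<bar> \<le> e" if "e > 0" for e
    proof -
      \<comment> \<open>K may vanish, hence the division by K + 1.\<close>
      have "\<bar>\<Sum>i\<in>J. c i * (\<integral>t. f t \<partial>N i)\<bar> \<le> (e / (K + 1)) * K" using K[of "e / (K + 1)"] K0 that by simp
      also have "\<dots> \<le> e" using K0 that by (simp add: field_simps)
      finally show ?thesis .
    qed
    then have "\<bar>\<Sum>i\<in>J. c i * (\<integral>t. f t \<partial>N i)\<bar> \<le> 0" by (rule field_le_epsilon) simp
    then show ?thesis by simp
  qed
  have half: "(\<Sum>i\<in>J. c i * measure (N i) {..a}) = 0" for a
  proof -
    \<comment> \<open>Equal to 1 up to a and falling to 0 with slope m beyond it, so these functions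
      tend to the indicator of the half line.\<close>
    define f where "f m t = max 0 (min 1 (1 - real m * (t - a)))" for m t
    have f: "continuous_on UNIV (f m)" "\<bar>f m t\<bar> \<le> 1" for m t
      unfolding f_def by (auto intro!: continuous_intros)
    have fm [measurable]: "f m \<in> borel_measurable borel" for m using f(1) by (rule borel_measurable_continuous_onI)
    have lim: "(\<lambda>m. f m t) \<longlonglongrightarrow> indicator {..a} t" for t
    proof (cases "t \<le> a")
      case True
      then have "f m t = 1" for m by (simp add: f_def mult_le_0_iff)
      then show ?thesis using True by simp
    next
      case False
      obtain M where M: "1 / (t - a) < real M" using reals_Archimedean2 by blast
      have "f m t = 0" if "m \<ge> M" for m
      proof -
        have "1 / (t - a) < real m" using M that by linarith
        then have "1 \<le> real m * (t - a)" using False by (simp add: field_simps)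
        then show ?thesis by (simp add: f_def)
      qed
      then have "eventually (\<lambda>m. f m t = 0) sequentially" using eventually_sequentially by blast
      then show ?thesis using False by (simp add: tendsto_eventually)
    qed
    have "(\<lambda>m. \<integral>t. f m t \<partial>N i) \<longlonglongrightarrow> measure (N i) {..a}" if "i \<in> J" for i
    proof -
      interpret unit_interval_measure "N i" using N[OF that] .
      have "(\<lambda>m. \<integral>t. f m t \<partial>N i) \<longlonglongrightarrow> (\<integral>t. indicator {..a} t \<partial>N i)"
        by (rule integral_dominated_convergence[where w = "\<lambda>_. 1"]) (use f(2) lim in auto)
      then show ?thesis by simp
    qed
    then have "(\<lambda>m. \<Sum>i\<in>J. c i * (\<integral>t. f m t \<partial>N i)) \<longlonglongrightarrow> (\<Sum>i\<in>J. c i * measure (N i) {..a})"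
      by (intro tendsto_sum tendsto_mult_left)
    then show ?thesis unfolding cont[OF f(1)] by (simp add: LIMSEQ_const_iff)
  qed
  have tot: "(\<Sum>i\<in>J. c i * measure (N i) UNIV) = 0"
  proof -
    have "(\<integral>t. t ^ 0 \<partial>N i) = measure (N i) UNIV" if "i \<in> J" for i
    proof -
      interpret unit_interval_measure "N i" using N[OF that] .
      show ?thesis by simp
    qed
    then show ?thesis using mom[of 0] by simp
  qed
  have gen: "sets (borel :: real measure) = sigma_sets UNIV (range atMost)"
    by (simp add: borel_eq_atMost)
  have "Int_stable (range (atMost :: real \<Rightarrow> _))" "range (atMost :: real \<Rightarrow> _) \<subseteq> Pow UNIV"
    by (auto simp: Int_stable_def)
  moreover from B have "B \<in> sigma_sets UNIV (range atMost)" by (simp only: gen)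
  ultimately show ?thesis
  proof (induction rule: sigma_sets_induct_disjoint)
    case (basic A)
    then show ?case using half by blast
  next
    case (compl A)
    then have A: "A \<in> sets borel" by (simp only: gen)
    have "measure (N i) (UNIV - A) = measure (N i) UNIV - measure (N i) A" if "i \<in> J" for i
    proof -
      interpret unit_interval_measure "N i" using N[OF that] .
      show ?thesis using finite_measure_compl[of A] A by (simp add: sets_N)
    qed
    then have "(\<Sum>i\<in>J. c i * measure (N i) (UNIV - A)) = (\<Sum>i\<in>J. c i * measure (N i) UNIV) - (\<Sum>i\<in>J. c i * measure (N i) A)"
      unfolding sum_subtractf[symmetric] by (intro sum.cong) (simp_all add: right_diff_distrib)
    then show ?case using compl tot by simp
  next
    case (union A)
    then have A: "range A \<subseteq> sets borel" by (simp only: gen)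
    have "(\<lambda>n. measure (N i) (A n)) sums measure (N i) (\<Union>n. A n)" if "i \<in> J" for i
    proof -
      interpret unit_interval_measure "N i" using N[OF that] .
      show ?thesis using A union(1) by (intro finite_measure_UNION) (auto simp: sets_N)
    qed
    then have "(\<lambda>n. \<Sum>i\<in>J. c i * measure (N i) (A n)) sums (\<Sum>i\<in>J. c i * measure (N i) (\<Union>n. A n))"
      by (intro sums_sum sums_mult)
    then show ?case using union by (simp add: sums_iff)
  qed simp
qed

lemma moments_determine_measure4:
  assumes "unit_interval_measure N1" "unit_interval_measure N2" "unit_interval_measure N3" "unit_interval_measure N4"
    and mom: "\<And>k. (\<integral>t. t ^ k \<partial>N1) - (\<integral>t. t ^ k \<partial>N2) = (\<integral>t. t ^ k \<partial>N3) - (\<integral>t. t ^ k \<partial>N4)"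
    and "B \<in> sets borel"
  shows "measure N1 B - measure N2 B = measure N3 B - measure N4 B"
proof -
  let ?N = "\<lambda>i::nat. if i = 0 then N1 else if i = 1 then N2 else if i = 2 then N3 else N4"
  let ?c = "\<lambda>i::nat. if i = 0 then 1 else if i = 1 then -1 else if i = 2 then -1 else 1"
  have J: "{..<4} = {0, 1, 2, 3::nat}" by auto
  have "(\<Sum>i<4. ?c i * measure (?N i) B) = 0"
  proof (rule moments_determine_measure)
    show "(\<Sum>i<4. ?c i * (\<integral>t. t ^ k \<partial>?N i)) = 0" for k using mom[of k] by (simp add: J)
  qed (use assms in auto)
  then show ?thesis by (simp add: J)
qed

lemma moments_determine_measure2:
  assumes N: "unit_interval_measure N1" "unit_interval_measure N2"
    and mom: "\<And>k. (\<integral>t. t ^ k \<partial>N1) = (\<integral>t. t ^ k \<partial>N2)"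
  shows "N1 = N2"
proof (rule measure_eqI)
  interpret N1: unit_interval_measure N1 by fact
  interpret N2: unit_interval_measure N2 by fact
  show "sets N1 = sets N2" by (simp add: N1.sets_N N2.sets_N)
  fix A assume "A \<in> sets N1"
  then have "measure N1 A - measure N1 A = measure N2 A - measure N1 A"
    by (intro moments_determine_measure4 N) (auto simp: mom N1.sets_N)
  then show "emeasure N1 A = emeasure N2 A"
    by (simp add: N1.emeasure_eq_measure N2.emeasure_eq_measure)
qed

section \<open>Spectral projections by polarization\<close>

context positive_contraction
begin

lemma \<nu>_unit: "unit_interval_measure (\<nu> x)"
  using \<nu>[of x] by (simp add: is_moment_measure_def unit_interval_measure_def unit_interval_measure_axioms_def)

lemma \<nu>_moment: "(\<integral>t. t ^ k \<partial>\<nu> x) = inner x ((T ^^ k) x)"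
  using \<nu>[of x] by (simp add: is_moment_measure_def)

lemma sets_\<nu> [simp, measurable_cong]: "sets (\<nu> x) = sets borel"
  using unit_interval_measure.sets_N[OF \<nu>_unit] .

lemma \<nu>_eqI:
  assumes "unit_interval_measure N" "\<And>k. (\<integral>t. t ^ k \<partial>N) = inner x ((T ^^ k) x)"
  shows "\<nu> x = N"
  by (rule moments_determine_measure2[OF \<nu>_unit assms(1)]) (simp add: assms(2) \<nu>_moment)

lemma measure_\<nu>_UNIV: "measure (\<nu> x) UNIV = (norm x)\<^sup>2"
proof -
  interpret unit_interval_measure "\<nu> x" by (rule \<nu>_unit)
  show ?thesis using \<nu>_moment[of x 0] by (simp add: dot_square_norm)
qed

lemma measure_\<nu>_le: "measure (\<nu> x) B \<le> (norm x)\<^sup>2"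
proof -
  interpret unit_interval_measure "\<nu> x" by (rule \<nu>_unit)
  show ?thesis using bounded_measure[of B] by (simp add: measure_\<nu>_UNIV)
qed

text \<open>Polarization of the scalar measures; this number becomes
  \<open>inner x (P B y)\<close>.\<close>

definition \<beta> :: "real set \<Rightarrow> 'a \<Rightarrow> 'a \<Rightarrow> real" where
  "\<beta> B x y = (measure (\<nu> (x + y)) B - measure (\<nu> (x - y)) B) / 4"

lemma moment_polar:
  "inner (x + y) ((T ^^ k) (x + y)) - inner (x - y) ((T ^^ k) (x - y)) = 4 * inner x ((T ^^ k) y)"
  using T_pow_sym[of k y x]
  by (simp add: linear_add[OF T_pow_linear] linear_diff[OF T_pow_linear] inner_simps inner_commute algebra_simps)

text \<open>Linear relations between the numbers \<open>inner x ((T ^^ k) y)\<close> carry over to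
  \<beta>. Bilinearity, symmetry and commutation of the projections all follow this way, without
  handling measures again.\<close>

lemma \<beta>_cong:
  assumes J: "finite J" and mom: "\<And>k. (\<Sum>i\<in>J. c i * inner (x i) ((T ^^ k) (y i))) = 0" and B: "B \<in> sets borel"
  shows "(\<Sum>i\<in>J. c i * \<beta> B (x i) (y i)) = 0"
proof -
  \<comment> \<open>The Boolean component tells the term with x + y from the one with x - y, so that
    a single signed combination of measures is formed.\<close>
  have eq: "(\<Sum>p\<in>J \<times> UNIV. (if snd p then c (fst p) else - c (fst p)) *
      f (if snd p then x (fst p) + y (fst p) else x (fst p) - y (fst p))) =
      (\<Sum>i\<in>J. c i * (f (x i + y i) - f (x i - y i)))" for f :: "'a \<Rightarrow> real"
    unfolding sum.cartesian_product[symmetric, of "\<lambda>i b. (if b then c i else - c i) * f (if b then x i + y i else x i - y i)", unfolded split_def]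
    by (simp add: UNIV_bool right_diff_distrib)
  have "(\<Sum>p\<in>J \<times> UNIV. (if snd p then c (fst p) else - c (fst p)) *
      measure (\<nu> (if snd p then x (fst p) + y (fst p) else x (fst p) - y (fst p))) B) = 0"
  proof (rule moments_determine_measure[OF _ \<nu>_unit _ B])
    fix k
    show "(\<Sum>p\<in>J \<times> UNIV. (if snd p then c (fst p) else - c (fst p)) *
      (\<integral>t. t ^ k \<partial>\<nu> (if snd p then x (fst p) + y (fst p) else x (fst p) - y (fst p)))) = 0"
      unfolding \<nu>_moment eq[of "\<lambda>z. inner z ((T ^^ k) z)"] moment_polar using mom[of k]
      by (simp add: mult.left_commute[of _ 4] sum_distrib_left[symmetric])
  qed (use J in simp)
  then show ?thesis
    unfolding eq[of "\<lambda>z. measure (\<nu> z) B"] \<beta>_def by (simp add: sum_divide_distrib[symmetric])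
qed

lemma \<beta>_cong2:
  assumes "\<And>k. inner x ((T ^^ k) y) = inner x' ((T ^^ k) y')" "B \<in> sets borel"
  shows "\<beta> B x y = \<beta> B x' y'"
  using \<beta>_cong[of "{0, 1::nat}" "\<lambda>i. if i = 0 then 1 else -1" "\<lambda>i. if i = 0 then x else x'"
      "\<lambda>i. if i = 0 then y else y'" B] assms by simp

lemma \<beta>_cong3:
  assumes "\<And>k. inner x ((T ^^ k) y) = a * inner x' ((T ^^ k) y') + b * inner x'' ((T ^^ k) y'')" "B \<in> sets borel"
  shows "\<beta> B x y = a * \<beta> B x' y' + b * \<beta> B x'' y''"
  using \<beta>_cong[of "{0, 1, 2::nat}" "\<lambda>i. if i = 0 then 1 else if i = 1 then -a else -b"
      "\<lambda>i. if i = 0 then x else if i = 1 then x' else x''"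
      "\<lambda>i. if i = 0 then y else if i = 1 then y' else y''" B] assms by simp

lemma \<beta>_sym: "B \<in> sets borel \<Longrightarrow> \<beta> B x y = \<beta> B y x"
  by (rule \<beta>_cong2) (metis T_pow_sym inner_commute)

lemma \<beta>_lin: "B \<in> sets borel \<Longrightarrow> \<beta> B x (a *\<^sub>R y + b *\<^sub>R z) = a * \<beta> B x y + b * \<beta> B x z"
  by (rule \<beta>_cong3)
    (simp_all add: linear_add[OF T_pow_linear] linear_scale[OF T_pow_linear] inner_simps)

lemma \<beta>_self:
  assumes "B \<in> sets borel"
  shows "\<beta> B x x = measure (\<nu> x) B"
proof -
  \<comment> \<open>The moments of x + x, 0 and x are in the ratio 4 : 0 : 1, which explains the
    coefficients 1, -1, -4.\<close>
  let ?x = "\<lambda>i::nat. if i = 0 then x + x else if i = 1 then 0 else x"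
  let ?c = "\<lambda>i::nat. if i = 0 then 1 else if i = 1 then -1 else -4"
  have J: "{..<3} = {0, 1, 2::nat}" by auto
  have "(\<Sum>i<3. ?c i * measure (\<nu> (?x i)) B) = 0"
  proof (rule moments_determine_measure[OF _ \<nu>_unit _ assms])
    show "(\<Sum>i<3. ?c i * (\<integral>t. t ^ k \<partial>\<nu> (?x i))) = 0" for k
      by (simp add: J \<nu>_moment linear_add[OF T_pow_linear] inner_simps)
  qed simp
  then show ?thesis by (simp add: J \<beta>_def)
qed

text \<open>Not yet of Cauchy-Schwarz form; \<open>bounded_linear_\<beta>\<close> applies it to a
  normalized second argument and rescales.\<close>

lemma \<beta>_bound: "\<bar>\<beta> B x y\<bar> \<le> ((norm x)\<^sup>2 + (norm y)\<^sup>2) / 2"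
proof -
  have "(norm (x + y))\<^sup>2 + (norm (x - y))\<^sup>2 = 2 * (norm x)\<^sup>2 + 2 * (norm y)\<^sup>2"
    by (simp add: power2_norm_eq_inner inner_simps inner_commute)
  moreover have "\<bar>(a - b) / 4\<bar> \<le> (r + s) / 2"
    if "p + q = 2 * r + 2 * s" "0 \<le> a" "0 \<le> b" "a \<le> p" "b \<le> q" for a b p q r s :: real
    using that by (simp add: abs_le_iff)
  ultimately show ?thesis
    unfolding \<beta>_def using measure_\<nu>_le[of "x + y" B] measure_\<nu>_le[of "x - y" B] measure_nonneg by blast
qed

lemma bounded_linear_\<beta>:
  assumes B: "B \<in> sets borel"
  shows "bounded_linear (\<beta> B x)"
proof (rule bounded_linear_intro[of _ "((norm x)\<^sup>2 + 1) / 2"])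
  show "\<beta> B x (y + z) = \<beta> B x y + \<beta> B x z" for y z using \<beta>_lin[OF B, of x 1 y 1 z] by simp
  show s: "\<beta> B x (a *\<^sub>R y) = a *\<^sub>R \<beta> B x y" for a y using \<beta>_lin[OF B, of x a y 0 y] by simp
  show "norm (\<beta> B x y) \<le> norm y * (((norm x)\<^sup>2 + 1) / 2)" for y
  proof (cases "y = 0")
    case True
    then show ?thesis using s[of 0 0] by simp
  next
    case False
    define u where "u = (1 / norm y) *\<^sub>R y"
    have u: "norm u = 1" "y = norm y *\<^sub>R u" using False by (simp_all add: u_def)
    have "\<beta> B x y = norm y * \<beta> B x u" using s[of "norm y" u] u(2) by simp
    then have "norm (\<beta> B x y) = norm y * \<bar>\<beta> B x u\<bar>" by (simp add: abs_mult)
    also have "\<dots> \<le> norm y * (((norm x)\<^sup>2 + 1) / 2)"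
      using \<beta>_bound[of B x u] u(1) by (intro mult_left_mono) auto
    finally show ?thesis .
  qed
qed

definition P :: "real set \<Rightarrow> 'a \<Rightarrow> 'a" where
  "P B x = (SOME v. \<forall>y. \<beta> B x y = inner v y)"

lemma inner_P:
  assumes "B \<in> sets borel"
  shows "inner (P B x) y = \<beta> B x y"
proof -
  have "\<exists>v. \<forall>y. \<beta> B x y = inner v y"
    by (rule riesz_representation[OF bounded_linear_\<beta>[OF assms, of x]]) blast
  then have "\<beta> B x y = inner (SOME v. \<forall>y. \<beta> B x y = inner v y) y" by (rule someI_ex[THEN spec])
  then show ?thesis unfolding P_def by (rule sym)
qed

lemma P_sym: "B \<in> sets borel \<Longrightarrow> inner (P B x) y = inner x (P B y)"
  using \<beta>_sym[of B x y] by (simp add: inner_P inner_commute[of x])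

lemma inner_P_self: "B \<in> sets borel \<Longrightarrow> inner x (P B x) = measure (\<nu> x) B"
  by (simp add: inner_commute[of x] inner_P \<beta>_self)

text \<open>If S commutes with T, so does its adjoint, and the moments of the pairs (S x, y) and (x,
  S' y) coincide. The cases of use are T itself, complex scalars, and restriction to I.\<close>

lemma P_commute:
  assumes B: "B \<in> sets borel" and S: "\<And>x. S (T x) = T (S x)" "\<And>x y. inner (S x) y = inner x (S' y)"
  shows "P B (S x) = S (P B x)"
proof -
  have "S' (T y) = T (S' y)" for y
  proof -
    have "inner x (S' (T y)) = inner x (T (S' y))" for x
      by (simp add: S(2)[symmetric] T_sym[symmetric] S(1))
    then show ?thesis by (rule vector_eq_ldot[THEN iffD1, OF allI])
  qed
  then have S': "S' ((T ^^ k) y) = (T ^^ k) (S' y)" for k y by (induction k) simp_all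
  have "inner (P B (S x)) y = inner (S (P B x)) y" for y
    unfolding inner_P[OF B] S(2) by (rule \<beta>_cong2[OF _ B]) (simp add: S(2) S')
  then show ?thesis by (rule vector_eq_rdot[THEN iffD1, OF allI])
qed

lemma P_T: "B \<in> sets borel \<Longrightarrow> P B (T x) = T (P B x)"
  by (rule P_commute[where S' = T]) (simp_all add: T_sym)

lemma P_linear: assumes B: "B \<in> sets borel" shows "linear (P B)"
proof (rule linearI)
  show "P B (x + y) = P B x + P B y" for x y
  proof -
    have "inner (P B (x + y)) z = inner (P B x + P B y) z" for z
      using \<beta>_lin[OF B, of z 1 x 1 y] by (simp add: inner_add_left inner_P[OF B] \<beta>_sym[OF B, of _ z])
    then show ?thesis by (rule vector_eq_rdot[THEN iffD1, OF allI])
  qed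
  show "P B (c *\<^sub>R x) = c *\<^sub>R P B x" for c x
  proof -
    have "inner (P B (c *\<^sub>R x)) z = inner (c *\<^sub>R P B x) z" for z
      using \<beta>_lin[OF B, of z c x 0 x] by (simp add: inner_P[OF B] \<beta>_sym[OF B, of _ z])
    then show ?thesis by (rule vector_eq_rdot[THEN iffD1, OF allI])
  qed
qed

text \<open>Applying T^k to y and multiplying the measures by t^k both shift the moments by k, so
  the two signed measures agree on C.\<close>

lemma \<beta>_indicator_power:
  assumes C: "C \<in> sets borel"
  shows "\<beta> C x ((T ^^ k) y) =
    ((\<integral>t. t ^ k * indicator C t \<partial>\<nu> (x + y)) - (\<integral>t. t ^ k * indicator C t \<partial>\<nu> (x - y))) / 4"
proof -
  have k: "0 \<le> t ^ k \<and> t ^ k \<le> 1" if "0 \<le> t" "t \<le> 1" for t :: real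
    using that by (simp add: power_le_one)
  note d = unit_interval_measure.unit_interval_density[OF \<nu>_unit, of "\<lambda>t. t ^ k", OF _ k]
  have "measure (density (\<nu> (x + y)) (\<lambda>t. ennreal (t ^ k))) C - measure (density (\<nu> (x - y)) (\<lambda>t. ennreal (t ^ k))) C
      = measure (\<nu> (x + (T ^^ k) y)) C - measure (\<nu> (x - (T ^^ k) y)) C"
  proof (rule moments_determine_measure4[OF d(1) d(1) \<nu>_unit \<nu>_unit _ C])
    fix j
    show "(\<integral>t. t ^ j \<partial>density (\<nu> (x + y)) (\<lambda>t. ennreal (t ^ k))) - (\<integral>t. t ^ j \<partial>density (\<nu> (x - y)) (\<lambda>t. ennreal (t ^ k)))
        = (\<integral>t. t ^ j \<partial>\<nu> (x + (T ^^ k) y)) - (\<integral>t. t ^ j \<partial>\<nu> (x - (T ^^ k) y))"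
    proof -
      have pw: "(T ^^ j) ((T ^^ k) y) = (T ^^ (k + j)) y" by (simp add: add.commute[of k j] funpow_add)
      show ?thesis
        by (subst (1 2) d(2)) (simp_all add: power_add[symmetric] \<nu>_moment moment_polar pw)
    qed
  qed auto
  then show ?thesis using d(3)[OF _ _ _ C] by (simp add: \<beta>_def)
qed

text \<open>By \<open>\<beta>_indicator_power\<close>, the polarized measure of P C x and y has the
  moments of the one of x and y cut down to C. Evaluating both on B gives multiplicativity.\<close>

lemma P_Int:
  assumes B: "B \<in> sets borel" and C: "C \<in> sets borel"
  shows "P B (P C x) = P (B \<inter> C) x"
proof -
  have ind: "(0::real) \<le> indicator C t \<and> indicator C t \<le> (1::real)" for t by (simp add: indicator_def)
  have Cm: "(indicator C :: real \<Rightarrow> real) \<in> borel_measurable borel" using C by simp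
  note d = unit_interval_measure.unit_interval_density[OF \<nu>_unit Cm ind]
  have "inner (P B (P C x)) y = inner (P (B \<inter> C) x) y" for y
  proof -
    have "measure (\<nu> (P C x + y)) B - measure (\<nu> (P C x - y)) B =
        measure (density (\<nu> (x + y)) (\<lambda>t. ennreal (indicator C t))) B - measure (density (\<nu> (x - y)) (\<lambda>t. ennreal (indicator C t))) B"
    proof (rule moments_determine_measure4[OF \<nu>_unit \<nu>_unit d(1) d(1) _ B])
      show "(\<integral>t. t ^ k \<partial>\<nu> (P C x + y)) - (\<integral>t. t ^ k \<partial>\<nu> (P C x - y)) =
          (\<integral>t. t ^ k \<partial>density (\<nu> (x + y)) (\<lambda>t. ennreal (indicator C t))) - (\<integral>t. t ^ k \<partial>density (\<nu> (x - y)) (\<lambda>t. ennreal (indicator C t)))" for k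
        using \<beta>_indicator_power[OF C, of x k y]
        by (subst (1 2) d(2)) (simp_all add: \<nu>_moment moment_polar inner_P[OF C] mult.commute)
    qed
    moreover have "(\<integral>t. indicator C t * indicator B t \<partial>N) = measure N (B \<inter> C)"
      if "unit_interval_measure N" for N :: "real measure"
    proof -
      interpret unit_interval_measure N by fact
      show ?thesis by (simp add: indicator_inter_arith[symmetric] Int_commute)
    qed
    ultimately show ?thesis
      using B C by (simp add: inner_P \<beta>_def d(3)[OF B] \<nu>_unit)
  qed
  then show ?thesis by (rule vector_eq_rdot[THEN iffD1, OF allI])
qed

lemma P_idem: "B \<in> sets borel \<Longrightarrow> P B (P B x) = P B x"
  by (simp add: P_Int)

lemma norm_P: "B \<in> sets borel \<Longrightarrow> (norm (P B x))\<^sup>2 = measure (\<nu> x) B"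
  by (simp add: power2_norm_eq_inner P_sym P_idem inner_P_self)

lemma P_UNIV: "P UNIV x = x"
proof -
  have "inner (P UNIV x) y = inner x y" for y
    using moment_polar[of x y 0] by (simp add: inner_P \<beta>_def measure_\<nu>_UNIV power2_norm_eq_inner)
  then show ?thesis by (rule vector_eq_rdot[THEN iffD1, OF allI])
qed

lemma bounded_linear_P:
  assumes B: "B \<in> sets borel"
  shows "bounded_linear (P B)"
proof (rule bounded_linear_intro[of _ 1])
  show "norm (P B x) \<le> norm x * 1" for x
    using norm_P[OF B, of x] measure_\<nu>_le[of x B] by (simp add: power2_le_imp_le)
qed (simp_all add: linear_add[OF P_linear[OF B]] linear_scale[OF P_linear[OF B]])

lemma measure_\<nu>_P:
  "B \<in> sets borel \<Longrightarrow> C \<in> sets borel \<Longrightarrow> measure (\<nu> (P C x)) B = measure (\<nu> x) (B \<inter> C)"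
  by (simp add: norm_P[symmetric] P_Int)

text \<open>A fragment of functional calculus: passing from x to f(T) x multiplies the scalar
  measure by f^2. Here f(t) = t; \<open>\<nu>_D\<close> is the case f(t) = 1 - t.\<close>

lemma \<nu>_T: "\<nu> (T x) = density (\<nu> x) (\<lambda>t. ennreal (t\<^sup>2))"
proof (rule \<nu>_eqI)
  have k: "0 \<le> t\<^sup>2 \<and> t\<^sup>2 \<le> 1" if "0 \<le> t" "t \<le> 1" for t :: real
    using that by (simp add: power_le_one)
  note d = unit_interval_measure.unit_interval_density[OF \<nu>_unit, of "\<lambda>t. t\<^sup>2", OF _ k]
  show "unit_interval_measure (density (\<nu> x) (\<lambda>t. ennreal (t\<^sup>2)))" by (rule d(1)) auto
  show "(\<integral>t. t ^ k \<partial>density (\<nu> x) (\<lambda>t. ennreal (t\<^sup>2))) = inner (T x) ((T ^^ k) (T x))" for k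
  proof -
    have "(\<integral>t. t ^ k \<partial>density (\<nu> x) (\<lambda>t. ennreal (t\<^sup>2))) = (\<integral>t. t ^ Suc (Suc k) \<partial>\<nu> x)"
      by (subst d(2)) (simp_all add: power2_eq_square mult.assoc)
    then show ?thesis by (simp add: \<nu>_moment T_sym funpow_swap1 del: power_Suc)
  qed
qed

lemma \<nu>_D: "\<nu> (D x) = density (\<nu> x) (\<lambda>t. ennreal ((1 - t)\<^sup>2))"
proof (rule \<nu>_eqI)
  have k: "0 \<le> (1 - t)\<^sup>2 \<and> (1 - t)\<^sup>2 \<le> 1" if "0 \<le> t" "t \<le> 1" for t :: real
    using that by (simp add: power_le_one)
  note d = unit_interval_measure.unit_interval_density[OF \<nu>_unit, of "\<lambda>t. (1 - t)\<^sup>2", OF _ k]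
  show "unit_interval_measure (density (\<nu> x) (\<lambda>t. ennreal ((1 - t)\<^sup>2)))" by (rule d(1)) auto
  fix k
  interpret unit_interval_measure "\<nu> x" by (rule \<nu>_unit)
  have "(\<integral>t. t ^ k \<partial>density (\<nu> x) (\<lambda>t. ennreal ((1 - t)\<^sup>2))) = (\<integral>t. (1 - t)\<^sup>2 * t ^ k \<partial>\<nu> x)"
    by (subst d(2)) auto
  also have "\<dots> = (\<integral>t. t ^ k - 2 * t ^ Suc k + t ^ Suc (Suc k) \<partial>\<nu> x)"
    by (rule arg_cong[where f = "integral\<^sup>L (\<nu> x)"]) (simp add: fun_eq_iff power2_eq_square algebra_simps)
  also have "\<dots> = inner x ((T ^^ k) x) - 2 * inner x ((T ^^ Suc k) x) + inner x ((T ^^ Suc (Suc k)) x)"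
    using integrable_power[of k] integrable_power[of "Suc k"] integrable_power[of "Suc (Suc k)"]
    by (simp add: \<nu>_moment[symmetric] del: funpow.simps power_Suc)
  also have "\<dots> = inner (D x) ((T ^^ k) (D x))"
    by (simp add: D_def linear_diff[OF T_pow_linear] inner_simps T_sym T.diff funpow_swap1)
  finally show "(\<integral>t. t ^ k \<partial>density (\<nu> x) (\<lambda>t. ennreal ((1 - t)\<^sup>2))) = inner (D x) ((T ^^ k) (D x))" .
qed

text \<open>The scalar measure of \<open>P {0} x\<close> is carried by {0}, so its second moment,
  the squared norm of the image under T, vanishes.\<close>

lemma T_P_0: "T (P {0} x) = 0"
proof -
  have "(norm (T (P {0} x)))\<^sup>2 = measure (\<nu> (T (P {0} x))) UNIV" by (simp add: measure_\<nu>_UNIV)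
  also have "\<dots> = (\<integral>t. t\<^sup>2 \<partial>\<nu> (P {0} x))"
  proof -
    have "(T ^^ 2) z = T (T z)" for z by (simp add: numeral_2_eq_2)
    then show ?thesis
      using \<nu>_moment[of "P {0} x" 2] by (simp add: measure_\<nu>_UNIV power2_norm_eq_inner T_sym)
  qed
  also have "\<dots> = 0"
  proof (rule integral_eq_zero_AE, rule AE_I[of _ _ "- {0}"])
    interpret unit_interval_measure "\<nu> (P {0} x)" by (rule \<nu>_unit)
    show "emeasure (\<nu> (P {0} x)) (- {0}) = 0"
      by (simp add: emeasure_eq_measure measure_\<nu>_P)
  qed auto
  finally show ?thesis by simp
qed

end

section \<open>The spectral resolution of a positive operator\<close>

definition l2_on :: "'g set \<Rightarrow> 'g l2 set" where
  "l2_on I = {\<xi>. \<forall>i. i \<notin> I \<longrightarrow> coord \<xi> i = 0}"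

lemma coord_in_ell2: "coord \<xi> \<in> ell2 I \<longleftrightarrow> \<xi> \<in> l2_on I"
  by (auto simp: ell2_def l2_on_def coord_summable)

lemma ell2_coordE:
  assumes "f \<in> ell2 I"
  obtains \<xi> where "f = coord \<xi>" "\<xi> \<in> l2_on I"
proof
  have "f \<in> {f. (\<lambda>i. (cmod (f i))\<^sup>2) summable_on UNIV}" using assms by (simp add: ell2_def)
  then show "f = coord (Abs_l2 f)" by (simp add: Abs_l2_inverse)
  then show "Abs_l2 f \<in> l2_on I" using assms coord_in_ell2 by metis
qed

text \<open>The orthogonal projection onto \<open>l2_on I\<close>. It lets operators given only on
  \<open>l2_on I\<close> be treated on the whole type, where \<open>positive_contraction\<close>
  lives.\<close>

lift_definition restr :: "'g set \<Rightarrow> 'g l2 \<Rightarrow> 'g l2" is "\<lambda>I f i. if i \<in> I then f i else 0"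
proof -
  fix I :: "'g set" and f :: "'g \<Rightarrow> complex"
  assume "(\<lambda>i. (cmod (f i))\<^sup>2) summable_on UNIV"
  then show "(\<lambda>i. (cmod (if i \<in> I then f i else 0))\<^sup>2) summable_on UNIV"
    by (rule summable_on_comparison_test) auto
qed

lemma restr_l2_on: "restr I \<xi> \<in> l2_on I"
  by (simp add: l2_on_def restr.rep_eq)

lemma restr_id: "\<xi> \<in> l2_on I \<Longrightarrow> restr I \<xi> = \<xi>"
  by (rule l2_eqI) (auto simp: l2_on_def restr.rep_eq)

lemma restr_sym: "inner (restr I \<xi>) \<eta> = inner \<xi> (restr I \<eta>)"
  unfolding inner_l2_infsum by (rule infsum_cong) (simp add: restr.rep_eq)

lemma restr_scaleC: "restr I (scaleC c \<xi>) = scaleC c (restr I \<xi>)"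
  by (rule l2_eqI) (simp add: restr.rep_eq scaleC.rep_eq)

lemma bounded_linear_restr: "bounded_linear (restr I)"
proof (rule bounded_linear_intro[of _ 1])
  fix \<xi> \<eta> :: "'a l2" and r :: real
  show "restr I (\<xi> + \<eta>) = restr I \<xi> + restr I \<eta>"
    by (rule l2_eqI) (simp add: restr.rep_eq plus_l2.rep_eq)
  show "restr I (r *\<^sub>R \<xi>) = r *\<^sub>R restr I \<xi>"
    by (rule l2_eqI) (simp add: restr.rep_eq scaleR_l2.rep_eq)
  have "(norm (restr I \<xi>))\<^sup>2 \<le> (norm \<xi>)\<^sup>2"
    unfolding norm_l2_power2 by (rule infsum_mono[OF coord_summable coord_summable]) (simp add: restr.rep_eq)
  from power2_le_imp_le[OF this norm_ge_zero] show "norm (restr I \<xi>) \<le> norm \<xi> * 1" by simp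
qed

lemma subspace_l2_on: "subspace (l2_on I)"
  by (auto simp: subspace_def l2_on_def zero_l2.rep_eq plus_l2.rep_eq scaleR_l2.rep_eq)

lemma l2_on_scaleC: "\<xi> \<in> l2_on I \<Longrightarrow> scaleC c \<xi> \<in> l2_on I"
  by (simp add: l2_on_def scaleC.rep_eq)

lemma closed_l2_on: "closed (l2_on I)"
proof -
  have "l2_on I = {\<xi>. restr I \<xi> = \<xi>}" 
  proof (intro equalityI subsetI)
    fix \<xi> assume "\<xi> \<in> {\<xi>. restr I \<xi> = \<xi>}"
    then have "restr I \<xi> = \<xi>" by simp
    then show "\<xi> \<in> l2_on I" using restr_l2_on[of I \<xi>] by simp
  qed (simp add: restr_id)
  moreover have "closed {\<xi>. restr I \<xi> = \<xi>}"
    by (rule closed_Collect_eq[OF linear_continuous_on[OF bounded_linear_restr] continuous_on_id])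
  ultimately show ?thesis by simp
qed

lemma scaleC_of_real: "scaleC (complex_of_real r) \<xi> = r *\<^sub>R \<xi>"
  by (rule l2_eqI) (simp add: scaleC.rep_eq scaleR_l2.rep_eq)

lemma coord_plus: "coord (\<xi> + \<eta>) = (\<lambda>i. coord \<xi> i + coord \<eta> i)"
  by (simp add: plus_l2.rep_eq)

lemma coord_scaleC: "coord (scaleC c \<xi>) = (\<lambda>i. c * coord \<xi> i)"
  by (simp add: scaleC.rep_eq)

section \<open>The resolvent of a positive operator\<close>

locale positive_operator =
  fixes I :: "'g set" and x :: "'g lop"
  assumes pos: "positive_op I x"
begin

definition X :: "'g l2 \<Rightarrow> 'g l2 \<Rightarrow> bool" where
  "X \<xi> \<eta> \<longleftrightarrow> (coord \<xi>, coord \<eta>) \<in> x"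

lemma linear: "linear_op I x" and adj: "adjoint_op I x = x"
  using pos by (auto simp: positive_op_def self_adjoint_op_def)

lemma xE:
  assumes "(f, g) \<in> x"
  obtains \<xi> \<eta> where "f = coord \<xi>" "g = coord \<eta>" "X \<xi> \<eta>"
proof -
  have "f \<in> ell2 I" "g \<in> ell2 I" using linear assms by (auto simp: linear_op_def)
  then show thesis using that assms by (metis X_def ell2_coordE)
qed

lemma X_on: "X \<xi> \<eta> \<Longrightarrow> \<xi> \<in> l2_on I" "X \<xi> \<eta> \<Longrightarrow> \<eta> \<in> l2_on I"
  using linear by (auto simp: X_def linear_op_def coord_in_ell2[symmetric])

lemma X_0: "X 0 0"
  using linear by (simp add: X_def linear_op_def zero_l2.rep_eq)

lemma X_add: "X \<xi> \<eta> \<Longrightarrow> X \<xi>' \<eta>' \<Longrightarrow> X (\<xi> + \<xi>') (\<eta> + \<eta>')"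
  using linear unfolding X_def linear_op_def coord_plus by blast

lemma X_scaleC: "X \<xi> \<eta> \<Longrightarrow> X (scaleC c \<xi>) (scaleC c \<eta>)"
  using linear unfolding X_def linear_op_def coord_scaleC by blast

lemma X_scaleR: "X \<xi> \<eta> \<Longrightarrow> X (r *\<^sub>R \<xi>) (r *\<^sub>R \<eta>)"
  using X_scaleC[of \<xi> \<eta> "complex_of_real r"] by (simp add: scaleC_of_real)

lemma X_diff: "X \<xi> \<eta> \<Longrightarrow> X \<xi>' \<eta>' \<Longrightarrow> X (\<xi> - \<xi>') (\<eta> - \<eta>')"
  using X_add[of \<xi> \<eta> "-1 *\<^sub>R \<xi>'" "-1 *\<^sub>R \<eta>'"] X_scaleR[of \<xi>' \<eta>' "-1"] by simp

lemma X_unique: "X \<xi> \<eta> \<Longrightarrow> X \<xi> \<eta>' \<Longrightarrow> \<eta> = \<eta>'"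
  using linear unfolding X_def linear_op_def single_valued_def by (metis coord_inject)

lemma X_cip: "X \<xi> \<eta> \<Longrightarrow> X \<xi>' \<eta>' \<Longrightarrow> cip (coord \<xi>) (coord \<eta>') = cip (coord \<eta>) (coord \<xi>')"
  using adj unfolding X_def adjoint_op_def by blast

lemma X_sym: "X \<xi> \<eta> \<Longrightarrow> X \<xi>' \<eta>' \<Longrightarrow> inner \<xi> \<eta>' = inner \<eta> \<xi>'"
  using X_cip by (simp add: cip_eq_inner)

lemma X_nonneg: "X \<xi> \<eta> \<Longrightarrow> 0 \<le> inner \<xi> \<eta>"
  using pos by (auto simp: X_def positive_op_def inner_l2_def)

text \<open>Self-adjointness read as maximality of the graph. Real pairings suffice, since the test
  pairs are closed under multiplication by \<i>.\<close>

lemma X_maximal: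
  assumes on: "\<xi> \<in> l2_on I" "\<eta> \<in> l2_on I" and eq: "\<And>\<zeta> \<theta>. X \<zeta> \<theta> \<Longrightarrow> inner \<xi> \<theta> = inner \<eta> \<zeta>"
  shows "X \<xi> \<eta>"
proof -
  have "cip (coord \<xi>) g = cip (coord \<eta>) f" if fg: "(f, g) \<in> x" for f g
  proof -
    obtain \<zeta> \<theta> where z: "f = coord \<zeta>" "g = coord \<theta>" "X \<zeta> \<theta>" using xE[OF fg] .
    have "inner (scaleC \<i> \<xi>) \<theta> = inner (scaleC \<i> \<eta>) \<zeta>"
      unfolding inner_scaleC by (rule eq[OF X_scaleC[OF z(3)]])
    then show ?thesis by (simp add: z cip_eq_inner eq[OF z(3)])
  qed
  then have "(coord \<xi>, coord \<eta>) \<in> adjoint_op I x"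
    using on by (auto simp: adjoint_op_def coord_in_ell2)
  then show ?thesis by (simp add: adj X_def)
qed

lemma X_closed:
  assumes X: "\<And>n. X (\<xi>s n) (\<eta>s n)" and lim: "\<xi>s \<longlonglongrightarrow> \<xi>" "\<eta>s \<longlonglongrightarrow> \<eta>"
  shows "X \<xi> \<eta>"
proof (rule X_maximal)
  show "\<xi> \<in> l2_on I" by (rule closed_sequentially[OF closed_l2_on X_on(1)[OF X] lim(1)])
  show "\<eta> \<in> l2_on I" by (rule closed_sequentially[OF closed_l2_on X_on(2)[OF X] lim(2)])
  fix \<zeta> \<theta> assume "X \<zeta> \<theta>"
  then have "inner (\<xi>s n) \<theta> = inner (\<eta>s n) \<zeta>" for n using X_sym[OF X] by blast
  moreover have "(\<lambda>n. inner (\<xi>s n) \<theta>) \<longlonglongrightarrow> inner \<xi> \<theta>" by (intro tendsto_intros lim)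
  moreover have "(\<lambda>n. inner (\<eta>s n) \<zeta>) \<longlonglongrightarrow> inner \<eta> \<zeta>" by (intro tendsto_intros lim)
  ultimately show "inner \<xi> \<theta> = inner \<eta> \<zeta>" using LIMSEQ_unique by simp
qed

lemma resolvent_bound:
  assumes "X \<xi> \<eta>"
  shows "(norm \<xi>)\<^sup>2 \<le> inner \<xi> (\<xi> + \<eta>)" "norm \<xi> \<le> norm (\<xi> + \<eta>)"
proof -
  show 1: "(norm \<xi>)\<^sup>2 \<le> inner \<xi> (\<xi> + \<eta>)"
    using X_nonneg[OF assms] by (simp add: inner_add_right power2_norm_eq_inner)
  show "norm \<xi> \<le> norm (\<xi> + \<eta>)"
  proof (cases "\<xi> = 0")
    case False
    have "norm \<xi> * norm \<xi> \<le> norm \<xi> * norm (\<xi> + \<eta>)"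
      using order_trans[OF 1 norm_cauchy_schwarz] by (simp only: power2_eq_square)
    then show ?thesis using False by simp
  qed simp
qed

text \<open>By \<open>resolvent_bound\<close> and closedness of the graph, S is closed. A vector v
  orthogonal to S satisfies x v = - v by maximality, and positivity leaves only v = 0.\<close>

lemma resolvent_exists: "\<exists>\<xi> \<eta>. X \<xi> \<eta> \<and> restr I \<zeta> = \<xi> + \<eta>"
proof -
  interpret R: bounded_linear "restr I" by (rule bounded_linear_restr)
  define S where "S = {\<zeta>. \<exists>\<xi> \<eta>. X \<xi> \<eta> \<and> restr I \<zeta> = \<xi> + \<eta>}"
  have "subspace S"
    unfolding subspace_def
  proof (intro conjI ballI allI)
    show "0 \<in> S" unfolding S_def using X_0 by (auto simp: R.zero intro!: exI[of _ 0])
    fix \<zeta> \<zeta>' and c :: real assume "\<zeta> \<in> S"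
    then obtain \<xi> \<eta> where 1: "X \<xi> \<eta>" "restr I \<zeta> = \<xi> + \<eta>" by (auto simp: S_def)
    show "c *\<^sub>R \<zeta> \<in> S"
      unfolding S_def using X_scaleR[OF 1(1), of c] 1(2) by (auto simp: R.scale scaleR_add_right)
    assume "\<zeta>' \<in> S"
    then obtain \<xi>' \<eta>' where 2: "X \<xi>' \<eta>'" "restr I \<zeta>' = \<xi>' + \<eta>'" by (auto simp: S_def)
    have "restr I (\<zeta> + \<zeta>') = (\<xi> + \<xi>') + (\<eta> + \<eta>')" by (simp add: R.add 1 2)
    then show "\<zeta> + \<zeta>' \<in> S" unfolding S_def using X_add[OF 1(1) 2(1)] by blast
  qed
  moreover have "closed S"
  proof (rule closed_sequential_limits[THEN iffD2], intro allI impI, elim conjE)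
    fix z l assume z: "\<forall>n. z n \<in> S" and l: "z \<longlonglongrightarrow> l"
    have "\<forall>n. \<exists>\<xi> \<eta>. X \<xi> \<eta> \<and> restr I (z n) = \<xi> + \<eta>" using z by (simp add: S_def)
    then obtain \<xi> \<eta> where X: "\<And>n. X (\<xi> n) (\<eta> n)" and eq: "\<And>n. restr I (z n) = \<xi> n + \<eta> n" by metis
    have lim: "(\<lambda>n. restr I (z n)) \<longlonglongrightarrow> restr I l" by (rule R.tendsto[OF l])
    have "Cauchy \<xi>"
    proof (rule metric_CauchyI)
      fix e :: real assume "0 < e"
      then obtain N where N: "\<And>m n. m \<ge> N \<Longrightarrow> n \<ge> N \<Longrightarrow> dist (restr I (z m)) (restr I (z n)) < e"
        using metric_CauchyD[OF LIMSEQ_imp_Cauchy[OF lim], of e] by auto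
      have "dist (\<xi> m) (\<xi> n) < e" if "m \<ge> N" "n \<ge> N" for m n
      proof -
        have "norm (\<xi> m - \<xi> n) \<le> norm ((\<xi> m - \<xi> n) + (\<eta> m - \<eta> n))"
          by (rule resolvent_bound[OF X_diff[OF X X]])
        also have "(\<xi> m - \<xi> n) + (\<eta> m - \<eta> n) = restr I (z m) - restr I (z n)" by (simp add: eq)
        finally show ?thesis using N[OF that] by (simp add: dist_norm)
      qed
      then show "\<exists>M. \<forall>m\<ge>M. \<forall>n\<ge>M. dist (\<xi> m) (\<xi> n) < e" by blast
    qed
    then obtain \<xi>' where \<xi>': "\<xi> \<longlonglongrightarrow> \<xi>'" using Cauchy_convergent convergent_def by blast
    have "(\<lambda>n. restr I (z n) - \<xi> n) \<longlonglongrightarrow> restr I l - \<xi>'" by (intro tendsto_diff lim \<xi>')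
    then have "\<eta> \<longlonglongrightarrow> restr I l - \<xi>'" by (simp add: eq)
    from X_closed[OF X \<xi>' this] have "X \<xi>' (restr I l - \<xi>')" .
    then show "l \<in> S" unfolding S_def by (intro CollectI exI[of _ \<xi>'] exI[of _ "restr I l - \<xi>'"]) simp
  qed
  moreover have "v = 0" if v: "\<And>y. y \<in> S \<Longrightarrow> inner v y = 0" for v
  proof -
    \<comment> \<open>S contains everything supported off I, so v itself is supported on I.\<close>
    have "restr I (v - restr I v) = 0" by (simp add: R.diff restr_id[OF restr_l2_on])
    then have "v - restr I v \<in> S" unfolding S_def using X_0 by (auto intro!: exI[of _ 0])
    from v[OF this] have "inner v (v - restr I v) = 0" .
    moreover have "inner (restr I v) (v - restr I v) = 0"
      by (simp add: restr_sym \<open>restr I (v - restr I v) = 0\<close>)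
    ultimately have "inner (v - restr I v) (v - restr I v) = 0" by (simp add: inner_diff_left)
    then have "v = restr I v" by simp
    then have on: "v \<in> l2_on I" using restr_l2_on[of I v] by simp
    have "X v (- v)"
    proof (rule X_maximal)
      show "v \<in> l2_on I" "- v \<in> l2_on I" using on subspace_neg[OF subspace_l2_on] by auto
      fix \<zeta> \<theta> assume X: "X \<zeta> \<theta>"
      have "restr I (\<zeta> + \<theta>) = \<zeta> + \<theta>" by (simp add: R.add restr_id X_on[OF X])
      then have "\<zeta> + \<theta> \<in> S" unfolding S_def using X by blast
      from v[OF this] show "inner v \<theta> = inner (- v) \<zeta>" by (simp add: inner_add_right)
    qed
    from X_nonneg[OF this] have "inner v v \<le> 0" by simp
    then show "v = 0" by (metis inner_eq_zero_iff inner_ge_zero order_antisym)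
  qed
  ultimately have "S = UNIV" by (intro closed_subspace_eq_UNIV) auto
  then show ?thesis unfolding S_def by blast
qed

text \<open>\<open>T\<close> is \<open>(1 + x)\<^sup>-\<^sup>1\<close> on the vectors supported on \<open>I\<close>, and \<open>0\<close> on their orthogonal complement.\<close>

definition T :: "'g l2 \<Rightarrow> 'g l2" where
  "T \<zeta> = (SOME \<xi>. \<exists>\<eta>. X \<xi> \<eta> \<and> restr I \<zeta> = \<xi> + \<eta>)"

lemma X_T: "X (T \<zeta>) (restr I \<zeta> - T \<zeta>)"
proof -
  have "\<exists>\<eta>. X (T \<zeta>) \<eta> \<and> restr I \<zeta> = T \<zeta> + \<eta>"
    unfolding T_def by (rule someI_ex[OF resolvent_exists])
  then show ?thesis by auto
qed

lemma T_eqI: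
  assumes "X \<xi> \<eta>" "restr I \<zeta> = \<xi> + \<eta>"
  shows "T \<zeta> = \<xi>"
proof -
  have "norm (T \<zeta> - \<xi>) \<le> norm ((T \<zeta> - \<xi>) + ((restr I \<zeta> - T \<zeta>) - \<eta>))"
    by (rule resolvent_bound(2)[OF X_diff[OF X_T assms(1)]])
  then show ?thesis by (simp add: assms(2))
qed

lemma T_restr: "T (restr I \<zeta>) = T \<zeta>"
  by (rule T_eqI[OF X_T]) (simp add: restr_id[OF restr_l2_on])

lemma T_on: "T \<zeta> \<in> l2_on I"
  by (rule X_on(1)[OF X_T])

sublocale PC: positive_contraction T
proof (rule positive_contraction.intro)
  interpret R: bounded_linear "restr I" by (rule bounded_linear_restr)
  have rb: "(norm (T \<zeta>))\<^sup>2 \<le> inner (T \<zeta>) (restr I \<zeta>)" for \<zeta> using resolvent_bound(1)[OF X_T] by simp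
  have rT: "inner (T \<zeta>) (restr I \<theta>) = inner (T \<zeta>) \<theta>" for \<zeta> \<theta>
    by (simp add: restr_sym[symmetric] restr_id[OF T_on])
  show "inner (T \<zeta>) \<theta> = inner \<zeta> (T \<theta>)" for \<zeta> \<theta>
  proof -
    have "inner (T \<zeta>) (restr I \<theta> - T \<theta>) = inner (restr I \<zeta> - T \<zeta>) (T \<theta>)" by (rule X_sym[OF X_T X_T])
    then show ?thesis by (simp add: inner_diff_left inner_diff_right rT inner_commute[of "restr I \<zeta>"] inner_commute[of \<zeta>])
  qed
  show nonneg: "0 \<le> inner \<zeta> (T \<zeta>)" for \<zeta>
    using rb[of \<zeta>] zero_le_power2[of "norm (T \<zeta>)"] unfolding rT inner_commute[of \<zeta>] by linarith
  have nT: "norm (T \<zeta>) \<le> norm \<zeta>" for \<zeta>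
  proof (cases "T \<zeta> = 0")
    case False
    have "norm (T \<zeta>) * norm (T \<zeta>) \<le> norm (T \<zeta>) * norm \<zeta>"
      using order_trans[OF rb[unfolded rT] norm_cauchy_schwarz] by (simp only: power2_eq_square)
    then show ?thesis using False by simp
  qed simp
  show "inner \<zeta> (T \<zeta>) \<le> inner \<zeta> \<zeta>" for \<zeta>
    using order_trans[OF norm_cauchy_schwarz mult_left_mono[OF nT norm_ge_zero], of \<zeta> \<zeta>]
    by (simp add: dot_square_norm power2_eq_square)
  show "bounded_linear T"
  proof (rule bounded_linear_intro[of _ 1])
    show "T (\<zeta> + \<theta>) = T \<zeta> + T \<theta>" for \<zeta> \<theta>
      by (rule T_eqI[OF X_add[OF X_T X_T]]) (simp add: R.add)
    show "T (r *\<^sub>R \<zeta>) = r *\<^sub>R T \<zeta>" for r \<zeta>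
      by (rule T_eqI[OF X_scaleR[OF X_T]]) (simp add: R.scale scaleR_diff_right)
  qed (simp add: nT)
qed

text \<open>A parametrization of the graph by two bounded maps, x = (1 - T) T^-1. Integrals for x
  are computed at the parameter \<zeta>.\<close>

lemma X_iff: "X \<xi> \<eta> \<longleftrightarrow> (\<exists>\<zeta>\<in>l2_on I. \<xi> = T \<zeta> \<and> \<eta> = PC.D \<zeta>)"
proof
  assume X: "X \<xi> \<eta>"
  interpret R: bounded_linear "restr I" by (rule bounded_linear_restr)
  have on: "\<xi> + \<eta> \<in> l2_on I" using X_on[OF X] subspace_add[OF subspace_l2_on] by blast
  have "T (\<xi> + \<eta>) = \<xi>" by (rule T_eqI[OF X restr_id[OF on]])
  with on show "\<exists>\<zeta>\<in>l2_on I. \<xi> = T \<zeta> \<and> \<eta> = PC.D \<zeta>"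
    by (intro bexI[of _ "\<xi> + \<eta>"]) (simp_all add: PC.D_def)
next
  assume "\<exists>\<zeta>\<in>l2_on I. \<xi> = T \<zeta> \<and> \<eta> = PC.D \<zeta>"
  then obtain \<zeta> where "\<zeta> \<in> l2_on I" "\<xi> = T \<zeta>" "\<eta> = PC.D \<zeta>" by blast
  then show "X \<xi> \<eta>" using X_T[of \<zeta>] by (simp add: PC.D_def restr_id)
qed

lemma T_scaleC: "T (scaleC c \<zeta>) = scaleC c (T \<zeta>)"
proof (rule T_eqI[OF X_scaleC[OF X_T]])
  interpret S: bounded_linear "scaleC c :: 'g l2 \<Rightarrow> 'g l2" by (rule bounded_linear_scaleC)
  show "restr I (scaleC c \<zeta>) = scaleC c (T \<zeta>) + scaleC c (restr I \<zeta> - T \<zeta>)"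
    by (simp add: restr_scaleC S.add[symmetric])
qed

lemma P_scaleC: "B \<in> sets borel \<Longrightarrow> PC.P B (scaleC c \<zeta>) = scaleC c (PC.P B \<zeta>)"
  by (rule PC.P_commute[of _ _ "scaleC (cnj c)"]) (simp_all add: T_scaleC inner_scaleC)

lemma P_restr: "B \<in> sets borel \<Longrightarrow> PC.P B (restr I \<zeta>) = restr I (PC.P B \<zeta>)"
  by (rule PC.P_commute[of _ _ "restr I"]) (simp_all add: T_restr restr_id[OF T_on] restr_sym)

lemma P_on: "B \<in> sets borel \<Longrightarrow> \<zeta> \<in> l2_on I \<Longrightarrow> PC.P B \<zeta> \<in> l2_on I"
  using P_restr[of B \<zeta>] restr_l2_on[of I "PC.P B \<zeta>"] by (simp add: restr_id)

text \<open>T kills this vector, so x would send 0 to it; x is single valued.\<close>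

lemma P_0:
  assumes "\<zeta> \<in> l2_on I"
  shows "PC.P {0} \<zeta> = 0"
proof -
  have "X 0 (PC.P {0} \<zeta>)"
    using X_T[of "PC.P {0} \<zeta>"] P_on[OF _ assms, of "{0}"] by (simp add: PC.T_P_0 restr_id)
  from X_unique[OF this X_0] show ?thesis .
qed

lemma AE_\<nu>_pos:
  assumes "\<zeta> \<in> l2_on I"
  shows "AE t in PC.\<nu> \<zeta>. 0 < t \<and> t \<le> 1"
proof -
  interpret N: unit_interval_measure "PC.\<nu> \<zeta>" by (rule PC.\<nu>_unit)
  have "emeasure (PC.\<nu> \<zeta>) {0} = 0"
    using PC.norm_P[of "{0}" \<zeta>] by (simp add: N.emeasure_eq_measure P_0[OF assms])
  then have "AE t in PC.\<nu> \<zeta>. t \<noteq> 0" by (intro AE_I[of _ _ "{0}"]) auto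
  with N.AE_N show ?thesis by eventually_elim auto
qed

end

text \<open>
  The spectral measure of \<open>x\<close> is the image of that of its resolvent \<open>(1 + x)\<^sup>-\<^sup>1\<close> under
  \<open>t \<mapsto> 1 / t - 1\<close>.  The junk value at \<open>t = 0\<close> does not matter, as \<open>{0}\<close> is a null set.
\<close>

definition resolvent_inv :: "real \<Rightarrow> real" where
  "resolvent_inv t = 1 / t - 1"

lemma resolvent_inv_measurable [measurable]: "resolvent_inv \<in> borel_measurable borel"
  unfolding resolvent_inv_def[abs_def] by measurable

lemma borel_vimage:
  assumes "f \<in> borel_measurable (borel :: real measure)" "B \<in> sets borel"
  shows "f -` B \<in> sets (borel :: real measure)"
  using measurable_sets[OF assms] by simp

context positive_contraction
begin

lemma P_Diff:
  assumes A: "A \<in> sets borel" and B: "B \<in> sets borel" and sub: "A \<subseteq> B"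
  shows "P B x - P A x = P (B - A) x"
proof (rule vector_eq_rdot[THEN iffD1, OF allI])
  fix y
  have "measure (\<nu> z) (B - A) = measure (\<nu> z) B - measure (\<nu> z) A" for z
  proof -
    interpret unit_interval_measure "\<nu> z" by (rule \<nu>_unit)
    show ?thesis by (rule finite_measure_Diff) (use A B sub in auto)
  qed
  then show "inner (P B x - P A x) y = inner (P (B - A) x) y"
    using A B by (simp add: inner_diff_left inner_P \<beta>_def diff_divide_distrib)
qed

end

section \<open>Spectral measure and domain of the unbounded operator\<close>

context positive_operator
begin

definition M :: "'g l2 \<Rightarrow> real measure" where
  "M \<xi> = distr (PC.\<nu> \<xi>) borel resolvent_inv"

definition Q :: "real set \<Rightarrow> 'g l2 \<Rightarrow> 'g l2" where
  "Q B = PC.P (resolvent_inv -` B)"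

lemma sets_M [simp, measurable_cong]: "sets (M \<xi>) = sets borel" and space_M [simp]: "space (M \<xi>) = UNIV"
  by (simp_all add: M_def)

lemma finite_measure_M: "finite_measure (M \<xi>)"
proof -
  interpret N: unit_interval_measure "PC.\<nu> \<xi>" by (rule PC.\<nu>_unit)
  show ?thesis unfolding M_def by (rule N.finite_measure_distr) simp
qed

lemma nn_integral_M:
  "f \<in> borel_measurable borel \<Longrightarrow> (\<integral>\<^sup>+u. f u \<partial>M \<xi>) = (\<integral>\<^sup>+t. f (resolvent_inv t) \<partial>PC.\<nu> \<xi>)"
  unfolding M_def by (rule nn_integral_distr) simp_all

lemma norm_Q:
  assumes "B \<in> sets borel"
  shows "(norm (Q B \<xi>))\<^sup>2 = measure (M \<xi>) B"
proof -
  interpret N: unit_interval_measure "PC.\<nu> \<xi>" by (rule PC.\<nu>_unit)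
  show ?thesis
    using assms by (simp add: Q_def M_def PC.norm_P borel_vimage measure_distr)
qed

lemma bounded_linear_Q: "B \<in> sets borel \<Longrightarrow> bounded_linear (Q B)"
  unfolding Q_def by (intro PC.bounded_linear_P borel_vimage) simp_all

lemma Q_sym: "B \<in> sets borel \<Longrightarrow> inner (Q B \<xi>) \<eta> = inner \<xi> (Q B \<eta>)"
  unfolding Q_def by (intro PC.P_sym borel_vimage) simp_all

lemma Q_Int: "B \<in> sets borel \<Longrightarrow> C \<in> sets borel \<Longrightarrow> Q B (Q C \<xi>) = Q (B \<inter> C) \<xi>"
  unfolding Q_def by (simp add: PC.P_Int borel_vimage)

lemma Q_UNIV: "Q UNIV \<xi> = \<xi>"
  by (simp add: Q_def PC.P_UNIV)

lemma Q_scaleC: "B \<in> sets borel \<Longrightarrow> Q B (scaleC c \<xi>) = scaleC c (Q B \<xi>)"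
  unfolding Q_def by (simp add: P_scaleC borel_vimage)

lemma Q_on: "B \<in> sets borel \<Longrightarrow> \<xi> \<in> l2_on I \<Longrightarrow> Q B \<xi> \<in> l2_on I"
  unfolding Q_def by (simp add: P_on borel_vimage)

lemma measure_M_UNIV: "measure (M \<xi>) UNIV = (norm \<xi>)\<^sup>2"
  using norm_Q[of UNIV \<xi>] by (simp add: Q_UNIV)

lemma inner_Q_self: "B \<in> sets borel \<Longrightarrow> inner \<xi> (Q B \<xi>) = measure (M \<xi>) B"
  using norm_Q[of B \<xi>] Q_sym[of B \<xi> "Q B \<xi>"] by (simp add: Q_Int power2_norm_eq_inner)

lemma AE_M_nonneg:
  assumes "\<xi> \<in> l2_on I"
  shows "AE u in M \<xi>. 0 \<le> u"
  unfolding M_def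
proof (subst AE_distr_iff)
  show "AE t in PC.\<nu> \<xi>. 0 \<le> resolvent_inv t"
    using AE_\<nu>_pos[OF assms] by eventually_elim (simp add: resolvent_inv_def)
qed auto

text \<open>With \<xi> = T \<zeta> and \<eta> = D \<zeta>, the two measures have densities t^2 and
  (1 - t)^2 over the one of \<zeta>, and u = (1 - t) / t is the variable of
  \<open>M\<close>.\<close>

lemma X_nn_integral:
  assumes X: "X \<xi> \<eta>" and [measurable]: "f \<in> borel_measurable borel"
  shows "(\<integral>\<^sup>+u. f u \<partial>M \<eta>) = (\<integral>\<^sup>+u. ennreal (u\<^sup>2) * f u \<partial>M \<xi>)"
proof -
  obtain \<zeta> where \<zeta>: "\<zeta> \<in> l2_on I" "\<xi> = T \<zeta>" "\<eta> = PC.D \<zeta>" using X by (auto simp: X_iff)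
  have "(\<integral>\<^sup>+u. f u \<partial>M \<eta>) = (\<integral>\<^sup>+t. ennreal ((1 - t)\<^sup>2) * f (resolvent_inv t) \<partial>PC.\<nu> \<zeta>)"
    by (subst nn_integral_M, simp, unfold \<zeta> PC.\<nu>_D, subst nn_integral_density) simp_all
  also have "\<dots> = (\<integral>\<^sup>+t. ennreal (t\<^sup>2) * (ennreal ((resolvent_inv t)\<^sup>2) * f (resolvent_inv t)) \<partial>PC.\<nu> \<zeta>)"
  proof (rule nn_integral_cong_AE)
    show "AE t in PC.\<nu> \<zeta>. ennreal ((1 - t)\<^sup>2) * f (resolvent_inv t) = ennreal (t\<^sup>2) * (ennreal ((resolvent_inv t)\<^sup>2) * f (resolvent_inv t))"
      using AE_\<nu>_pos[OF \<zeta>(1)]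
    proof eventually_elim
      case (elim t)
      have "t * resolvent_inv t = 1 - t" using elim by (simp add: resolvent_inv_def field_simps)
      then have "(1 - t)\<^sup>2 = t\<^sup>2 * (resolvent_inv t)\<^sup>2" by (metis power_mult_distrib)
      then show ?case by (simp add: ennreal_mult mult.assoc)
    qed
  qed
  also have "\<dots> = (\<integral>\<^sup>+u. ennreal (u\<^sup>2) * f u \<partial>M \<xi>)"
    by (subst nn_integral_M, simp, unfold \<zeta> PC.\<nu>_T, subst nn_integral_density) simp_all
  finally show ?thesis .
qed

lemma X_norm:
  assumes "X \<xi> \<eta>"
  shows "ennreal ((norm \<eta>)\<^sup>2) = (\<integral>\<^sup>+u. ennreal (u\<^sup>2) \<partial>M \<xi>)"
proof -
  interpret finite_measure "M \<eta>" by (rule finite_measure_M)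
  have "ennreal ((norm \<eta>)\<^sup>2) = (\<integral>\<^sup>+u. 1 \<partial>M \<eta>)"
    by (simp add: emeasure_eq_measure measure_M_UNIV)
  also have "\<dots> = (\<integral>\<^sup>+u. ennreal (u\<^sup>2) \<partial>M \<xi>)" by (subst X_nn_integral[OF assms]) simp_all
  finally show ?thesis .
qed

lemma X_inner:
  assumes "X \<xi> \<eta>"
  shows "integrable (M \<xi>) (\<lambda>u. u)" "inner \<xi> \<eta> = (\<integral>u. u \<partial>M \<xi>)"
proof -
  obtain \<zeta> where \<zeta>: "\<zeta> \<in> l2_on I" "\<xi> = T \<zeta>" "\<eta> = PC.D \<zeta>" using assms by (auto simp: X_iff)
  interpret N: unit_interval_measure "PC.\<nu> \<zeta>" by (rule PC.\<nu>_unit)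
  \<comment> \<open>The weight t^2 cancels the pole of 1 / t - 1, hence integrability. At t = 0 the
    conventional value -1 is multiplied by 0.\<close>
  have g: "t\<^sup>2 * resolvent_inv t = t ^ 1 - t ^ 2" for t
    by (cases "t = 0") (simp_all add: resolvent_inv_def power2_eq_square field_simps)
  have int: "integrable (PC.\<nu> \<zeta>) (\<lambda>t. t\<^sup>2 * resolvent_inv t)"
    unfolding g by (intro Bochner_Integration.integrable_diff N.integrable_power)
  show "integrable (M \<xi>) (\<lambda>u. u)"
    unfolding M_def \<zeta> PC.\<nu>_T using int by (simp add: integrable_distr_eq integrable_density)
  have "(\<integral>u. u \<partial>M \<xi>) = (\<integral>t. t\<^sup>2 * resolvent_inv t \<partial>PC.\<nu> \<zeta>)"
    unfolding M_def \<zeta> PC.\<nu>_T by (simp add: integral_distr integral_density)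
  also have "\<dots> = inner \<zeta> ((T ^^ 1) \<zeta>) - inner \<zeta> ((T ^^ 2) \<zeta>)"
    unfolding g by (subst Bochner_Integration.integral_diff) (simp_all only: N.integrable_power PC.\<nu>_moment)
  also have "\<dots> = inner \<xi> \<eta>"
    by (simp add: \<zeta> PC.D_def numeral_2_eq_2 inner_diff_right PC.T_sym inner_commute)
  finally show "inner \<xi> \<eta> = (\<integral>u. u \<partial>M \<xi>)" by simp
qed

lemma \<nu>_P: "C \<in> sets borel \<Longrightarrow> PC.\<nu> (PC.P C \<xi>) = density (PC.\<nu> \<xi>) (indicator C)"
  using PC.\<nu>_unit unfolding unit_interval_measure_def
  by (intro density_indicator_eqI) (simp_all add: PC.measure_\<nu>_P)

text \<open>T is at least c on the range of \<open>PC.P {c..}\<close>. Adding the complementary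
  projection makes it coercive everywhere, hence surjective, and projecting the solution removes the
  added term.\<close>

lemma T_range:
  assumes c: "0 < c" "c \<le> 1"
  shows "\<exists>\<zeta>. T \<zeta> = PC.P {c..} \<xi>"
proof -
  interpret P: bounded_linear "PC.P {c..}" by (rule PC.bounded_linear_P) simp
  define A where "A z = T z + (z - PC.P {c..} z)" for z
  have "surj A"
  proof (rule coercive_surj[OF _ _ c(1)])
    show "bounded_linear A"
      unfolding A_def by (intro bounded_linear_add bounded_linear_sub bounded_linear_ident
          PC.bounded_linear_T P.bounded_linear_axioms)
    show "inner (A z) y = inner z (A y)" for z y
      by (simp add: A_def inner_add_left inner_add_right inner_diff_left inner_diff_right PC.T_sym PC.P_sym)
    fix z
    interpret N: unit_interval_measure "PC.\<nu> z" by (rule PC.\<nu>_unit)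
    have "c * measure (PC.\<nu> z) {c..} = (\<integral>t. c * indicator {c..} t \<partial>PC.\<nu> z)" by simp
    also have "\<dots> \<le> (\<integral>t. t ^ 1 \<partial>PC.\<nu> z)"
    proof (rule integral_mono_AE)
      show "AE t in PC.\<nu> z. c * indicator {c..} t \<le> t ^ 1"
        using N.AE_N by eventually_elim (auto simp: indicator_def)
      show "integrable (PC.\<nu> z) (\<lambda>t. c * indicator {c..} t)"
        by (rule N.integrable_bounded[of _ c]) (use c in \<open>auto simp: indicator_def\<close>)
    qed (rule N.integrable_power)
    also have "\<dots> = inner z (T z)" by (subst PC.\<nu>_moment) simp
    finally have 1: "c * (norm (PC.P {c..} z))\<^sup>2 \<le> inner z (T z)" by (simp add: PC.norm_P)
    have le: "(norm (PC.P {c..} z))\<^sup>2 \<le> (norm z)\<^sup>2" by (simp add: PC.norm_P PC.measure_\<nu>_le)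
    have "inner z (A z) = inner z (T z) + ((norm z)\<^sup>2 - (norm (PC.P {c..} z))\<^sup>2)"
      by (simp add: A_def inner_add_right inner_diff_right dot_square_norm PC.norm_P PC.inner_P_self)
    moreover have "(1 - c) * (norm (PC.P {c..} z))\<^sup>2 \<le> (1 - c) * (norm z)\<^sup>2"
      using le c by (intro mult_left_mono) auto
    ultimately show "c * (norm z)\<^sup>2 \<le> inner z (A z)" using 1 by (simp add: algebra_simps)
  qed
  then obtain \<theta> where "A \<theta> = PC.P {c..} \<xi>" by (metis surjD)
  then have "PC.P {c..} (A \<theta>) = PC.P {c..} (PC.P {c..} \<xi>)" by simp
  then have "T (PC.P {c..} \<theta>) = PC.P {c..} \<xi>"
    by (simp add: A_def P.add P.diff PC.P_idem PC.P_T)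
  then show ?thesis by blast
qed

text \<open>The cuts of \<xi> to t \<ge> 1 / (n + 1) lie in the range of T, that is, in the domain
  of x. Finiteness of the second moment makes their images a Cauchy sequence, and the graph is
  closed.\<close>

lemma X_domain:
  assumes on: "\<xi> \<in> l2_on I" and fin: "(\<integral>\<^sup>+u. ennreal (u\<^sup>2) \<partial>M \<xi>) < \<infinity>"
  shows "\<exists>\<eta>. X \<xi> \<eta>"
proof -
  interpret N: unit_interval_measure "PC.\<nu> \<xi>" by (rule PC.\<nu>_unit)
  define C where "C n = {1 / real (Suc n)..}" for n
  have Cm [measurable, simp]: "C n \<in> sets borel" for n by (simp add: C_def)
  define s where "s n = PC.P (C n) \<xi>" for n
  have "\<exists>\<eta>. X (s n) \<eta>" for n
    using T_range[of "1 / real (Suc n)" \<xi>] X_T by (auto simp: s_def C_def) metis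
  then obtain \<eta> where X: "\<And>n. X (s n) (\<eta> n)" by metis
  have mono: "C m \<subseteq> C n" if "m \<le> n" for m n
    using that by (auto simp: C_def intro: order_trans[rotated] divide_left_mono)
  have lim_ind: "(\<lambda>n. indicator (C n) t :: real) \<longlonglongrightarrow> 1" if "0 < t" for t
  proof -
    obtain N where "1 / t < real N" using reals_Archimedean2 by blast
    then have "t \<in> C n" if "n \<ge> N" for n
      using \<open>0 < t\<close> that by (simp add: C_def field_simps) (smt (verit) mult_left_mono of_nat_mono)
    then have "eventually (\<lambda>n. indicator (C n) t = (1::real)) sequentially"
      by (intro eventually_sequentiallyI[of N]) simp
    then show ?thesis by (rule tendsto_eventually)
  qed
  \<comment> \<open>In effect the squared norm of \<open>\<eta> n\<close>; its convergence will make
    \<open>\<eta>\<close> a Cauchy sequence.\<close>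
  define a where "a n = (\<integral>t. (resolvent_inv t)\<^sup>2 * indicator (C n) t \<partial>PC.\<nu> \<xi>)" for n
  have int: "integrable (PC.\<nu> \<xi>) (\<lambda>t. (resolvent_inv t)\<^sup>2)"
    using fin by (simp add: nn_integral_M integrable_iff_bounded)
  have intC: "integrable (PC.\<nu> \<xi>) (\<lambda>t. (resolvent_inv t)\<^sup>2 * indicator B t)" if "B \<in> sets borel" for B
    using that by (intro Bochner_Integration.integrable_bound[OF int]) (auto simp: indicator_def)
  have "a \<longlonglongrightarrow> (\<integral>t. (resolvent_inv t)\<^sup>2 \<partial>PC.\<nu> \<xi>)"
    unfolding a_def
  proof (rule integral_dominated_convergence[where w = "\<lambda>t. (resolvent_inv t)\<^sup>2"])
    show "AE t in PC.\<nu> \<xi>. (\<lambda>n. (resolvent_inv t)\<^sup>2 * indicator (C n) t) \<longlonglongrightarrow> (resolvent_inv t)\<^sup>2"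
      using AE_\<nu>_pos[OF on]
    proof eventually_elim
      case (elim t)
      then have "(\<lambda>n. (resolvent_inv t)\<^sup>2 * indicator (C n) t) \<longlonglongrightarrow> (resolvent_inv t)\<^sup>2 * 1"
        by (intro tendsto_mult_left lim_ind) simp
      then show ?case by simp
    qed
  qed (use int in \<open>auto simp: indicator_def\<close>)
  then have Ca: "Cauchy a" by (rule LIMSEQ_imp_Cauchy)
  have diff: "(norm (\<eta> n - \<eta> m))\<^sup>2 = a n - a m" if "m \<le> n" for m n
  proof -
    have sd: "s n - s m = PC.P (C n - C m) \<xi>"
      unfolding s_def by (rule PC.P_Diff[OF _ _ mono[OF that]]) simp_all
    have "ennreal ((norm (\<eta> n - \<eta> m))\<^sup>2) = (\<integral>\<^sup>+u. ennreal (u\<^sup>2) \<partial>M (PC.P (C n - C m) \<xi>))"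
      unfolding sd[symmetric] by (rule X_norm[OF X_diff[OF X X]])
    also have "\<dots> = (\<integral>\<^sup>+t. ennreal ((resolvent_inv t)\<^sup>2 * indicator (C n - C m) t) \<partial>PC.\<nu> \<xi>)"
      by (subst nn_integral_M, simp, subst \<nu>_P, simp, subst nn_integral_density)
        (auto intro!: nn_integral_cong simp: indicator_def)
    also have "\<dots> = ennreal (\<integral>t. (resolvent_inv t)\<^sup>2 * indicator (C n - C m) t \<partial>PC.\<nu> \<xi>)"
      by (rule nn_integral_eq_integral[OF intC]) auto
    also have "(\<integral>t. (resolvent_inv t)\<^sup>2 * indicator (C n - C m) t \<partial>PC.\<nu> \<xi>) = a n - a m"
      unfolding a_def Bochner_Integration.integral_diff[OF intC[OF Cm] intC[OF Cm], symmetric]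
      by (rule Bochner_Integration.integral_cong) (use mono[OF that] in \<open>auto simp: indicator_def\<close>)
    finally have "ennreal ((norm (\<eta> n - \<eta> m))\<^sup>2) = ennreal (a n - a m)" .
    moreover have "a m \<le> a n" unfolding a_def
      by (rule integral_mono[OF intC[OF Cm] intC[OF Cm]]) (use mono[OF that] in \<open>auto simp: indicator_def\<close>)
    ultimately show ?thesis by simp
  qed
  have "Cauchy \<eta>"
  proof (rule metric_CauchyI)
    fix e :: real assume e: "0 < e"
    then obtain N where N: "\<And>m n. m \<ge> N \<Longrightarrow> n \<ge> N \<Longrightarrow> dist (a m) (a n) < e\<^sup>2"
      using metric_CauchyD[OF Ca, of "e\<^sup>2"] by auto
    have *: "dist (\<eta> m) (\<eta> n) < e" if "m \<ge> n" "n \<ge> N" for m n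
    proof -
      have "(norm (\<eta> m - \<eta> n))\<^sup>2 < e\<^sup>2"
        using diff[OF that(1)] N[of m n] that by (simp add: dist_real_def)
      then show ?thesis using e by (simp add: dist_norm power2_less_imp_less)
    qed
    have "dist (\<eta> m) (\<eta> n) < e" if "m \<ge> N" "n \<ge> N" for m n
      using *[of m n] *[of n m] that by (cases "m \<ge> n") (auto simp: dist_commute)
    then show "\<exists>M. \<forall>m\<ge>M. \<forall>n\<ge>M. dist (\<eta> m) (\<eta> n) < e" by blast
  qed
  then obtain \<eta>' where \<eta>': "\<eta> \<longlonglongrightarrow> \<eta>'" using Cauchy_convergent convergent_def by blast
  have "s \<longlonglongrightarrow> \<xi>"
  proof -
    have "(\<lambda>n. \<integral>t. indicator (C n) t \<partial>PC.\<nu> \<xi>) \<longlonglongrightarrow> (\<integral>t. 1 \<partial>PC.\<nu> \<xi> :: real)"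
    proof (rule integral_dominated_convergence[where w = "\<lambda>t. 1"])
      show "AE t in PC.\<nu> \<xi>. (\<lambda>n. indicator (C n) t :: real) \<longlonglongrightarrow> 1"
        using AE_\<nu>_pos[OF on] by eventually_elim (simp add: lim_ind)
    qed auto
    then have "(\<lambda>n. (norm \<xi>)\<^sup>2 - measure (PC.\<nu> \<xi>) (C n)) \<longlonglongrightarrow> (norm \<xi>)\<^sup>2 - (norm \<xi>)\<^sup>2"
      by (intro tendsto_diff tendsto_const) (simp add: PC.measure_\<nu>_UNIV)
    moreover have "(norm (\<xi> - s n))\<^sup>2 = (norm \<xi>)\<^sup>2 - measure (PC.\<nu> \<xi>) (C n)" for n
      by (simp add: s_def power2_norm_eq_inner inner_diff_left inner_diff_right PC.inner_P_self
          inner_commute[of "PC.P (C n) \<xi>" \<xi>] PC.norm_P[unfolded power2_norm_eq_inner])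
    ultimately have "(\<lambda>n. (norm (\<xi> - s n))\<^sup>2) \<longlonglongrightarrow> 0" by simp
    then have "(\<lambda>n. sqrt ((norm (\<xi> - s n))\<^sup>2)) \<longlonglongrightarrow> sqrt 0" by (rule tendsto_real_sqrt)
    then have "(\<lambda>n. norm (s n - \<xi>)) \<longlonglongrightarrow> 0" by (simp add: norm_minus_commute)
    then show ?thesis by (rule Lim_null[THEN iffD2, OF tendsto_norm_zero_cancel])
  qed
  from X_closed[OF X this \<eta>'] show ?thesis by blast
qed

end

section \<open>From maps on vectors to operator graphs\<close>

definition l2_op :: "'g set \<Rightarrow> ('g l2 \<Rightarrow> 'g l2) \<Rightarrow> 'g lop" where
  "l2_op I F = {(coord \<xi>, coord (F \<xi>)) | \<xi>. \<xi> \<in> l2_on I}"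

lemma l2_op_iff: "(coord \<xi>, coord \<eta>) \<in> l2_op I F \<longleftrightarrow> \<xi> \<in> l2_on I \<and> \<eta> = F \<xi>"
  by (auto simp: l2_op_def coord_inject)

lemma op_app_l2_op: "\<xi> \<in> l2_on I \<Longrightarrow> op_app (l2_op I F) (coord \<xi>) = coord (F \<xi>)"
  unfolding op_app_def by (rule the_equality) (auto simp: l2_op_def coord_inject)

lemma Domain_l2_op: "Domain (l2_op I F) = ell2 I"
  by (auto simp: l2_op_def coord_in_ell2 elim!: ell2_coordE)

lemma l2_op_comp:
  assumes "\<And>\<xi>. \<xi> \<in> l2_on I \<Longrightarrow> F' \<xi> \<in> l2_on I"
  shows "l2_op I F \<circ>\<^sub>o l2_op I F' = l2_op I (\<lambda>\<xi>. F (F' \<xi>))"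
  using assms by (auto simp: op_comp_def l2_op_def coord_inject relcomp_unfold)

lemma l2_op_id: "l2_op I (\<lambda>\<xi>. \<xi>) = Id_on (ell2 I)"
  by (auto simp: l2_op_def coord_in_ell2 elim!: ell2_coordE)

lemma l2_op_cong:
  assumes "\<And>\<xi>. \<xi> \<in> l2_on I \<Longrightarrow> F \<xi> = F' \<xi>"
  shows "l2_op I F = l2_op I F'"
  using assms by (auto simp: l2_op_def)

lemma l2_op_bounded:
  assumes F: "bounded_linear F" and C: "\<And>c \<xi>. F (scaleC c \<xi>) = scaleC c (F \<xi>)"
    and on: "\<And>\<xi>. \<xi> \<in> l2_on I \<Longrightarrow> F \<xi> \<in> l2_on I"
  shows "l2_op I F \<in> bounded_ops I"
proof -
  interpret F: bounded_linear F by fact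
  have "linear_op I (l2_op I F)"
    unfolding linear_op_def
  proof (intro conjI ballI allI)
    show "l2_op I F \<subseteq> ell2 I \<times> ell2 I" by (auto simp: l2_op_def coord_in_ell2 on)
    show "single_valued (l2_op I F)" by (auto simp: l2_op_def single_valued_def coord_inject)
    have "(coord 0, coord 0) \<in> l2_op I F"
      by (simp add: l2_op_iff F.zero subspace_0[OF subspace_l2_on])
    then show "(\<lambda>i. 0, \<lambda>i. 0) \<in> l2_op I F" by (simp add: zero_l2.rep_eq)
    fix p assume "p \<in> l2_op I F"
    then obtain \<xi> where p: "p = (coord \<xi>, coord (F \<xi>))" "\<xi> \<in> l2_on I" by (auto simp: l2_op_def)
    fix c
    have "(coord (scaleC c \<xi>), coord (scaleC c (F \<xi>))) \<in> l2_op I F"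
      by (simp add: l2_op_iff C l2_on_scaleC p)
    then show "case p of (\<xi>, \<eta>) \<Rightarrow> (\<lambda>i. c * \<xi> i, \<lambda>i. c * \<eta> i) \<in> l2_op I F"
      by (simp add: p coord_scaleC)
  next
    fix p assume "p \<in> l2_op I F"
    then obtain \<xi> where p: "p = (coord \<xi>, coord (F \<xi>))" "\<xi> \<in> l2_on I" by (auto simp: l2_op_def)
    have "(coord (\<xi> + \<xi>'), coord (F \<xi> + F \<xi>')) \<in> l2_op I F" if "\<xi>' \<in> l2_on I" for \<xi>'
      using that p by (simp add: l2_op_iff F.add subspace_add[OF subspace_l2_on])
    then show "case p of (\<xi>, \<eta>) \<Rightarrow> \<forall>(\<xi>', \<eta>')\<in>l2_op I F. (\<lambda>i. \<xi> i + \<xi>' i, \<lambda>i. \<eta> i + \<eta>' i) \<in> l2_op I F"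
      by (auto simp: p coord_plus l2_op_def[of I F])
  qed
  moreover have "\<forall>(f, g)\<in>l2_op I F. ell2_norm g \<le> onorm F * ell2_norm f"
    using onorm[OF F] by (auto simp: l2_op_def ell2_norm_coord)
  ultimately show ?thesis by (auto simp: bounded_ops_def Domain_l2_op)
qed

lemma l2_op_adjoint:
  assumes C: "\<And>c \<xi>. F' (scaleC c \<xi>) = scaleC c (F' \<xi>)"
    and on: "\<And>\<xi>. \<xi> \<in> l2_on I \<Longrightarrow> F' \<xi> \<in> l2_on I"
    and adj: "\<And>\<xi> \<eta>. inner (F' \<xi>) \<eta> = inner \<xi> (F \<eta>)"
  shows "adjoint_op I (l2_op I F) = l2_op I F'"
proof (intro equalityI subsetI)
  fix p assume "p \<in> adjoint_op I (l2_op I F)"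
  then obtain f g where p: "p = (f, g)" "f \<in> ell2 I" "g \<in> ell2 I"
    and eq': "\<forall>(\<zeta>, \<theta>)\<in>l2_op I F. cip f \<theta> = cip g \<zeta>"
    by (auto simp: adjoint_op_def)
  have eq: "cip f (coord (F \<zeta>)) = cip g (coord \<zeta>)" if "\<zeta> \<in> l2_on I" for \<zeta>
    using eq' l2_op_iff[of \<zeta> "F \<zeta>" I F] that by blast
  obtain \<xi> where \<xi>: "f = coord \<xi>" "\<xi> \<in> l2_on I" using ell2_coordE[OF p(2)] .
  obtain \<eta> where \<eta>: "g = coord \<eta>" "\<eta> \<in> l2_on I" using ell2_coordE[OF p(3)] .
  have "inner (F' \<xi> - \<eta>) \<zeta> = 0" if "\<zeta> \<in> l2_on I" for \<zeta>
    using eq[OF that] by (simp add: \<xi> \<eta> cip_eq_inner adj inner_diff_left)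
  from this[of "F' \<xi> - \<eta>"] have "F' \<xi> = \<eta>"
    using subspace_diff[OF subspace_l2_on on[OF \<xi>(2)] \<eta>(2)] by simp
  then show "p \<in> l2_op I F'" using \<xi> \<eta> p by (auto simp: l2_op_def)
next
  fix p assume "p \<in> l2_op I F'"
  then obtain \<xi> where p: "p = (coord \<xi>, coord (F' \<xi>))" "\<xi> \<in> l2_on I" by (auto simp: l2_op_def)
  have "cip (coord \<xi>) (coord (F \<zeta>)) = cip (coord (F' \<xi>)) (coord \<zeta>)" for \<zeta>
    by (simp add: cip_eq_inner adj[symmetric] C)
  then show "p \<in> adjoint_op I (l2_op I F)"
    using p by (auto simp: adjoint_op_def l2_op_def coord_in_ell2 on)
qed

text \<open>\<open>vector_measure\<close> is built by \<open>measure_of\<close> from a set function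
  that is controlled only on Borel sets; this identifies the result with a given measure.\<close>

lemma measure_of_emeasure:
  assumes N: "sets N = sets (borel :: real measure)" and f: "\<And>B. B \<in> sets borel \<Longrightarrow> f B = emeasure N B"
  shows "measure_space UNIV (sets borel) f" and "measure_of UNIV (sets borel) f = N"
proof -
  have sp: "space N = UNIV" using sets_eq_imp_space_eq[OF N] by simp
  have ms: "measure_space UNIV (sets borel) (emeasure N)" using measure_space[of N] by (simp add: N sp)
  show "measure_space UNIV (sets borel) f"
    using ms f unfolding measure_space_def
    by (auto simp: positive_def countably_additive_def subset_eq)
  have "measure_of UNIV (sets borel) f = measure_of UNIV (sets borel) (emeasure N)"
    by (rule measure_of_eq) (auto simp: f sets.sigma_sets_eq[of borel, simplified])
  also have "\<dots> = N" using measure_of_of_measure[of N] by (simp add: N sp)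
  finally show "measure_of UNIV (sets borel) f = N" .
qed

lemma resolution_of_identity:
  fixes R :: "real set \<Rightarrow> 'g l2 \<Rightarrow> 'g l2" and N :: "'g l2 \<Rightarrow> real measure"
  assumes R: "\<And>B. B \<in> sets borel \<Longrightarrow> bounded_linear (R B)"
      "\<And>B c \<xi>. B \<in> sets borel \<Longrightarrow> R B (scaleC c \<xi>) = scaleC c (R B \<xi>)"
      "\<And>B \<xi>. B \<in> sets borel \<Longrightarrow> \<xi> \<in> l2_on I \<Longrightarrow> R B \<xi> \<in> l2_on I"
      "\<And>B \<xi> \<eta>. B \<in> sets borel \<Longrightarrow> inner (R B \<xi>) \<eta> = inner \<xi> (R B \<eta>)"
      "\<And>B C \<xi>. B \<in> sets borel \<Longrightarrow> C \<in> sets borel \<Longrightarrow> R B (R C \<xi>) = R (B \<inter> C) \<xi>"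
      "\<And>\<xi>. R UNIV \<xi> = \<xi>"
    and N: "\<And>\<xi>. finite_measure (N \<xi>)" "\<And>\<xi>. sets (N \<xi>) = sets borel"
      "\<And>B \<xi>. B \<in> sets borel \<Longrightarrow> inner \<xi> (R B \<xi>) = measure (N \<xi>) B"
  shows "projection_valued_measure I (\<lambda>B. l2_op I (R B))"
    and "\<xi> \<in> l2_on I \<Longrightarrow> vector_measure (\<lambda>B. l2_op I (R B)) (coord \<xi>) = N \<xi>"
proof -
  have val: "ennreal (Re (cip (coord \<xi>) (op_app (l2_op I (R B)) (coord \<xi>)))) = emeasure (N \<xi>) B"
    if "B \<in> sets borel" "\<xi> \<in> l2_on I" for B \<xi>
  proof -
    interpret finite_measure "N \<xi>" by (rule N)
    show ?thesis using that by (simp add: op_app_l2_op cip_eq_inner N(3) emeasure_eq_measure)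
  qed
  note ms = measure_of_emeasure[OF N(2) val]
  show "\<xi> \<in> l2_on I \<Longrightarrow> vector_measure (\<lambda>B. l2_op I (R B)) (coord \<xi>) = N \<xi>"
    unfolding vector_measure_def by (rule ms(2))
  show "projection_valued_measure I (\<lambda>B. l2_op I (R B))"
    unfolding projection_valued_measure_def
  proof (intro conjI ballI)
    show "l2_op I (R UNIV) = Id_on (ell2 I)" by (simp add: R(6)[THEN ext] l2_op_id)
    fix B :: "real set" assume B: "B \<in> sets borel"
    show "l2_op I (R B) \<in> bounded_ops I" using B R by (intro l2_op_bounded) auto
    show "adjoint_op I (l2_op I (R B)) = l2_op I (R B)" using B R by (intro l2_op_adjoint) auto
    show "l2_op I (R B) \<circ>\<^sub>o l2_op I (R B) = l2_op I (R B)"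
      using B R by (subst l2_op_comp) auto
    fix C :: "real set" assume C: "C \<in> sets borel"
    show "l2_op I (R (B \<inter> C)) = l2_op I (R B) \<circ>\<^sub>o l2_op I (R C)"
      using B C R by (subst l2_op_comp) auto
  next
    fix f assume "f \<in> ell2 I"
    then obtain \<xi> where "f = coord \<xi>" "\<xi> \<in> l2_on I" by (rule ell2_coordE)
    then show "measure_space UNIV (sets borel) (\<lambda>B. ennreal (Re (cip f (op_app (l2_op I (R B)) f))))"
      using ms(1) by blast
  qed
qed

lemma cip_self: "cip (coord \<xi>) (coord \<xi>) = complex_of_real ((norm \<xi>)\<^sup>2)"
proof -
  have "inner (scaleC \<i> \<xi>) \<xi> = - inner (scaleC \<i> \<xi>) \<xi>"
  proof -
    have "inner (scaleC \<i> \<xi>) \<xi> = inner \<xi> (scaleC (-1 * \<i>) \<xi>)" by (simp add: inner_scaleC)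
    also have "scaleC (-1 * \<i>) \<xi> = - scaleC \<i> \<xi>"
      by (rule l2_eqI) (simp add: scaleC.rep_eq uminus_l2.rep_eq)
    finally show ?thesis by (simp add: inner_commute)
  qed
  then show ?thesis by (simp add: cip_eq_inner complex_eq_iff dot_square_norm)
qed

section \<open>Spectral resolution of the square\<close>

context positive_operator
begin

definition sq_measure :: "'g l2 \<Rightarrow> real measure" where
  "sq_measure \<xi> = distr (M \<xi>) borel (\<lambda>u. u\<^sup>2)"

definition sq_resolution :: "real set \<Rightarrow> 'g lop" where
  "sq_resolution B = l2_op I (Q ((\<lambda>u. u\<^sup>2) -` B))"

lemma sq_vimage: "B \<in> sets borel \<Longrightarrow> (\<lambda>u. u\<^sup>2) -` B \<in> sets (borel :: real measure)"
  by (rule borel_vimage) simp_all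

lemma nn_integral_sq:
  "f \<in> borel_measurable borel \<Longrightarrow> (\<integral>\<^sup>+t. f t \<partial>sq_measure \<xi>) = (\<integral>\<^sup>+u. f (u\<^sup>2) \<partial>M \<xi>)"
  unfolding sq_measure_def by (rule nn_integral_distr) simp_all

lemma sq_resolution:
  shows "projection_valued_measure I sq_resolution"
    and "\<xi> \<in> l2_on I \<Longrightarrow> vector_measure sq_resolution (coord \<xi>) = sq_measure \<xi>"
proof -
  have fin: "finite_measure (sq_measure \<xi>)" for \<xi>
  proof -
    interpret finite_measure "M \<xi>" by (rule finite_measure_M)
    show ?thesis unfolding sq_measure_def by (rule finite_measure_distr) simp
  qed
  have val: "inner \<xi> (Q ((\<lambda>u. u\<^sup>2) -` B) \<xi>) = measure (sq_measure \<xi>) B" if "B \<in> sets borel" for B \<xi>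
    using that by (simp add: inner_Q_self sq_vimage sq_measure_def measure_distr)
  have int: "Q ((\<lambda>u. u\<^sup>2) -` B) (Q ((\<lambda>u. u\<^sup>2) -` C) \<xi>) = Q ((\<lambda>u. u\<^sup>2) -` (B \<inter> C)) \<xi>"
    if "B \<in> sets borel" "C \<in> sets borel" for B C \<xi>
    using that by (simp add: Q_Int sq_vimage vimage_Int)
  note res = resolution_of_identity[of "\<lambda>B. Q ((\<lambda>u. u\<^sup>2) -` B)" I sq_measure,
      OF bounded_linear_Q[OF sq_vimage] Q_scaleC[OF sq_vimage] Q_on[OF sq_vimage] Q_sym[OF sq_vimage] int _ fin _ val]
  show "projection_valued_measure I sq_resolution"
    unfolding sq_resolution_def[abs_def] by (rule res(1)) (simp_all add: Q_UNIV sq_measure_def)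
  show "\<xi> \<in> l2_on I \<Longrightarrow> vector_measure sq_resolution (coord \<xi>) = sq_measure \<xi>"
    unfolding sq_resolution_def[abs_def] by (rule res(2)) (simp_all add: Q_UNIV sq_measure_def)
qed

text \<open>The second moment at \<eta> = x \<xi> is the fourth moment at \<xi>. Conversely u^2
  \<le> 1 + u^4, so a finite fourth moment puts first \<xi> and then x \<xi> into the domain of
  x.\<close>

lemma X_X_iff:
  assumes on: "\<xi> \<in> l2_on I"
  shows "(\<exists>\<eta> \<theta>. X \<xi> \<eta> \<and> X \<eta> \<theta>) \<longleftrightarrow> (\<integral>\<^sup>+t. ennreal (t\<^sup>2) \<partial>sq_measure \<xi>) < \<infinity>"
proof -
  have eq: "(\<integral>\<^sup>+u. ennreal (u\<^sup>2) \<partial>M \<eta>) = (\<integral>\<^sup>+t. ennreal (t\<^sup>2) \<partial>sq_measure \<xi>)" if "X \<xi> \<eta>" for \<eta>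
    by (subst X_nn_integral[OF that], simp, subst nn_integral_sq)
      (simp_all add: ennreal_mult[symmetric] power2_eq_square)
  show ?thesis
  proof (intro iffI; (elim exE conjE)?)
    fix \<eta> \<theta> assume X: "X \<xi> \<eta>" "X \<eta> \<theta>"
    show "(\<integral>\<^sup>+t. ennreal (t\<^sup>2) \<partial>sq_measure \<xi>) < \<infinity>"
      unfolding eq[OF X(1), symmetric] X_norm[OF X(2), symmetric] by simp
  next
    assume fin: "(\<integral>\<^sup>+t. ennreal (t\<^sup>2) \<partial>sq_measure \<xi>) < \<infinity>"
    interpret finite_measure "M \<xi>" by (rule finite_measure_M)
    have "(\<integral>\<^sup>+u. ennreal (u\<^sup>2) \<partial>M \<xi>) \<le> (\<integral>\<^sup>+u. 1 + ennreal ((u\<^sup>2)\<^sup>2) \<partial>M \<xi>)"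
    proof (rule nn_integral_mono)
      fix u :: real
      have "u\<^sup>2 \<le> 1 + (u\<^sup>2)\<^sup>2"
      proof -
        have "(u\<^sup>2 - 1)\<^sup>2 = (u\<^sup>2)\<^sup>2 - 2 * u\<^sup>2 + 1" by (simp add: power2_diff)
        then show ?thesis
          using zero_le_power2[of "u\<^sup>2 - 1"] zero_le_power2[of u] by linarith
      qed
      then have "ennreal (u\<^sup>2) \<le> ennreal (1 + (u\<^sup>2)\<^sup>2)" by (rule ennreal_leI)
      then show "ennreal (u\<^sup>2) \<le> 1 + ennreal ((u\<^sup>2)\<^sup>2)" by (simp add: ennreal_plus)
    qed
    also have "\<dots> = emeasure (M \<xi>) UNIV + (\<integral>\<^sup>+t. ennreal (t\<^sup>2) \<partial>sq_measure \<xi>)"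
      by (subst nn_integral_add, simp, simp, subst nn_integral_sq) simp_all
    also have "\<dots> < \<infinity>" using fin by (simp add: emeasure_eq_measure)
    finally obtain \<eta> where X: "X \<xi> \<eta>" using X_domain[OF on] by blast
    have "(\<integral>\<^sup>+u. ennreal (u\<^sup>2) \<partial>M \<eta>) < \<infinity>" using fin by (simp only: eq[OF X])
    from X_domain[OF X_on(2)[OF X] this] X show "\<exists>\<eta> \<theta>. X \<xi> \<eta> \<and> X \<eta> \<theta>" by blast
  qed
qed

lemma sq_iff: "(coord \<xi>, coord \<theta>) \<in> x \<circ>\<^sub>o x \<longleftrightarrow> (\<exists>\<eta>. X \<xi> \<eta> \<and> X \<eta> \<theta>)"
  unfolding op_comp_def X_def by (auto elim: xE)

text \<open>The natural domain of the product has to match the spectral integral exactly, which is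
  \<open>X_X_iff\<close>. On it \<langle>\<xi>, x x \<xi>\<rangle> is the squared norm of x \<xi>,
  the second moment of \<open>M \<xi>\<close>.\<close>

theorem sq_spectral: "is_spectral_measure I (x \<circ>\<^sub>o x) sq_resolution"
  unfolding is_spectral_measure_def
proof (intro conjI)
  show "projection_valued_measure I sq_resolution" by (rule sq_resolution)
  have sub: "x \<circ>\<^sub>o x \<subseteq> ell2 I \<times> ell2 I"
    using linear by (auto simp: op_comp_def linear_op_def)
  show "Domain (x \<circ>\<^sub>o x) = {\<xi> \<in> ell2 I. (\<integral>\<^sup>+t. ennreal (t\<^sup>2) \<partial>vector_measure sq_resolution \<xi>) < \<infinity>}"
  proof (intro equalityI subsetI)
    fix f assume "f \<in> Domain (x \<circ>\<^sub>o x)"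
    then obtain h where fh: "(f, h) \<in> x \<circ>\<^sub>o x" by blast
    then have "f \<in> ell2 I" "h \<in> ell2 I" using sub by auto
    then obtain \<xi> \<theta> where \<xi>: "f = coord \<xi>" "\<xi> \<in> l2_on I" "h = coord \<theta>" by (metis ell2_coordE)
    with fh have "\<exists>\<eta> \<theta>. X \<xi> \<eta> \<and> X \<eta> \<theta>" by (auto simp: sq_iff)
    with X_X_iff[OF \<xi>(2)] have "(\<integral>\<^sup>+t. ennreal (t\<^sup>2) \<partial>sq_measure \<xi>) < \<infinity>" by blast
    then show "f \<in> {\<xi> \<in> ell2 I. (\<integral>\<^sup>+t. ennreal (t\<^sup>2) \<partial>vector_measure sq_resolution \<xi>) < \<infinity>}"
      using \<xi> by (simp add: sq_resolution coord_in_ell2)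
  next
    fix f assume f: "f \<in> {\<xi> \<in> ell2 I. (\<integral>\<^sup>+t. ennreal (t\<^sup>2) \<partial>vector_measure sq_resolution \<xi>) < \<infinity>}"
    then obtain \<xi> where \<xi>: "f = coord \<xi>" "\<xi> \<in> l2_on I" by (auto elim: ell2_coordE)
    with f have "(\<integral>\<^sup>+t. ennreal (t\<^sup>2) \<partial>sq_measure \<xi>) < \<infinity>" by (simp add: sq_resolution)
    then have "\<exists>\<eta> \<theta>. X \<xi> \<eta> \<and> X \<eta> \<theta>" using X_X_iff[OF \<xi>(2)] by blast
    then show "f \<in> Domain (x \<circ>\<^sub>o x)" unfolding \<xi> using sq_iff by blast
  qed
  have "cip (coord \<xi>) (coord \<theta>) = complex_of_real (\<integral>t. t \<partial>vector_measure sq_resolution (coord \<xi>))"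
    if XX: "X \<xi> \<eta>" "X \<eta> \<theta>" for \<xi> \<eta> \<theta>
  proof -
    have "cip (coord \<xi>) (coord \<theta>) = complex_of_real ((norm \<eta>)\<^sup>2)"
      by (simp add: X_cip[OF XX] cip_self)
    also have "(norm \<eta>)\<^sup>2 = enn2real (\<integral>\<^sup>+u. ennreal (u\<^sup>2) \<partial>M \<xi>)"
      by (simp add: X_norm[OF XX(1), symmetric])
    also have "\<dots> = (\<integral>u. u\<^sup>2 \<partial>M \<xi>)" by (subst integral_eq_nn_integral) auto
    also have "\<dots> = (\<integral>t. t \<partial>sq_measure \<xi>)" by (simp add: sq_measure_def integral_distr)
    finally show ?thesis by (simp add: sq_resolution X_on[OF XX(1)])
  qed
  moreover have "\<exists>\<xi> \<eta> \<theta>. f = coord \<xi> \<and> h = coord \<theta> \<and> X \<xi> \<eta> \<and> X \<eta> \<theta>" if "(f, h) \<in> x \<circ>\<^sub>o x" for f h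
  proof -
    have "f \<in> ell2 I" "h \<in> ell2 I" using sub that by auto
    then obtain \<xi> \<theta> where "f = coord \<xi>" "h = coord \<theta>" by (metis ell2_coordE)
    with that sq_iff show ?thesis by blast
  qed
  ultimately show "\<forall>(\<xi>, \<eta>)\<in>x \<circ>\<^sub>o x. cip \<xi> \<eta> = complex_of_real (\<integral>t. t \<partial>vector_measure sq_resolution \<xi>)"
    by blast
qed

end

section \<open>Uniqueness of the spectral measure of a positive operator\<close>

text \<open>Posed for symmetric nonnegative operators, so that it applies directly to
  \<open>x \<circ>\<^sub>o x\<close>. The exact domain in \<open>is_spectral_measure\<close> takes
  the place of maximality.\<close>

locale nonneg_spectral =
  fixes I :: "'g set" and a :: "'g lop" and E :: "real set \<Rightarrow> 'g lop"
  assumes spec: "is_spectral_measure I a E"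
    and lin: "linear_op I a"
    and sym: "\<And>f g f' g'. (f, g) \<in> a \<Longrightarrow> (f', g') \<in> a \<Longrightarrow> cip f g' = cip g f'"
    and nonneg: "\<And>f g. (f, g) \<in> a \<Longrightarrow> 0 \<le> Re (cip f g)"
begin

definition A :: "'g l2 \<Rightarrow> 'g l2 \<Rightarrow> bool" where
  "A \<xi> \<eta> \<longleftrightarrow> (coord \<xi>, coord \<eta>) \<in> a"

lemma A_on: "A \<xi> \<eta> \<Longrightarrow> \<xi> \<in> l2_on I" "A \<xi> \<eta> \<Longrightarrow> \<eta> \<in> l2_on I"
  using lin by (auto simp: A_def linear_op_def coord_in_ell2[symmetric])

lemma A_add: "A \<xi> \<eta> \<Longrightarrow> A \<xi>' \<eta>' \<Longrightarrow> A (\<xi> + \<xi>') (\<eta> + \<eta>')"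
  using lin unfolding A_def linear_op_def coord_plus by blast

lemma A_scaleR: "A \<xi> \<eta> \<Longrightarrow> A (r *\<^sub>R \<xi>) (r *\<^sub>R \<eta>)"
  using lin unfolding A_def linear_op_def scaleC_of_real[symmetric] coord_scaleC by blast

lemma A_unique: "A \<xi> \<eta> \<Longrightarrow> A \<xi> \<eta>' \<Longrightarrow> \<eta> = \<eta>'"
  using lin unfolding A_def linear_op_def single_valued_def by (metis coord_inject)

lemma A_sym: "A \<xi> \<eta> \<Longrightarrow> A \<xi>' \<eta>' \<Longrightarrow> inner \<xi> \<eta>' = inner \<eta> \<xi>'"
  using sym[of "coord \<xi>" "coord \<eta>" "coord \<xi>'" "coord \<eta>'"] by (simp add: A_def cip_eq_inner)

lemma A_nonneg: "A \<xi> \<eta> \<Longrightarrow> 0 \<le> inner \<xi> \<eta>"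
  using nonneg[of "coord \<xi>" "coord \<eta>"] by (simp add: A_def cip_eq_inner)

lemma pvm: "projection_valued_measure I E"
  using spec by (simp add: is_spectral_measure_def)

definition e :: "real set \<Rightarrow> 'g l2 \<Rightarrow> 'g l2" where
  "e B \<xi> = (SOME \<eta>. (coord \<xi>, coord \<eta>) \<in> E B)"

lemma E_bounded: "B \<in> sets borel \<Longrightarrow> E B \<in> bounded_ops I"
  using pvm by (simp add: projection_valued_measure_def)

lemma e_iff:
  assumes B: "B \<in> sets borel"
  shows "(coord \<xi>, coord \<eta>) \<in> E B \<longleftrightarrow> \<xi> \<in> l2_on I \<and> \<eta> = e B \<xi>"
proof -
  have E: "linear_op I (E B)" "Domain (E B) = ell2 I" using E_bounded[OF B] by (auto simp: bounded_ops_def)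
  have 1: "(coord \<xi>, coord (e B \<xi>)) \<in> E B" if on: "\<xi> \<in> l2_on I"
  proof -
    have "coord \<xi> \<in> Domain (E B)" using on E(2) by (simp add: coord_in_ell2)
    then obtain g where g: "(coord \<xi>, g) \<in> E B" by blast
    then have "g \<in> ell2 I" using E(1) by (auto simp: linear_op_def)
    then obtain \<eta> where "g = coord \<eta>" by (metis ell2_coordE)
    with g show ?thesis unfolding e_def by (intro someI_ex[of "\<lambda>\<eta>. (coord \<xi>, coord \<eta>) \<in> E B"]) blast
  qed
  have 2: "\<xi> \<in> l2_on I" if "(coord \<xi>, coord \<eta>) \<in> E B"
    using that E(2) coord_in_ell2 by blast
  have 3: "single_valued (E B)" using E(1) by (simp add: linear_op_def)
  show ?thesis using 1 2 3 by (metis single_valuedD coord_inject)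
qed

lemma e_graph: "B \<in> sets borel \<Longrightarrow> \<xi> \<in> l2_on I \<Longrightarrow> (coord \<xi>, coord (e B \<xi>)) \<in> E B"
  by (simp add: e_iff)

lemma e_on:
  assumes B: "B \<in> sets borel" and on: "\<xi> \<in> l2_on I"
  shows "e B \<xi> \<in> l2_on I"
proof -
  have "E B \<subseteq> ell2 I \<times> ell2 I" using E_bounded[OF B] by (simp add: bounded_ops_def linear_op_def)
  with e_graph[OF B on] show ?thesis by (auto simp: coord_in_ell2)
qed

lemma e_add:
  assumes B: "B \<in> sets borel" and on: "\<xi> \<in> l2_on I" "\<eta> \<in> l2_on I"
  shows "e B (\<xi> + \<eta>) = e B \<xi> + e B \<eta>"
proof -
  have "linear_op I (E B)" using E_bounded[OF B] by (simp add: bounded_ops_def)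
  then have "(coord (\<xi> + \<eta>), coord (e B \<xi> + e B \<eta>)) \<in> E B"
    using e_graph[OF B on(1)] e_graph[OF B on(2)] unfolding linear_op_def coord_plus by blast
  then show ?thesis by (simp add: e_iff[OF B])
qed

lemma e_sym:
  assumes B: "B \<in> sets borel" and on: "\<xi> \<in> l2_on I" "\<eta> \<in> l2_on I"
  shows "inner (e B \<xi>) \<eta> = inner \<xi> (e B \<eta>)"
proof -
  have "adjoint_op I (E B) = E B" using pvm B by (simp add: projection_valued_measure_def)
  then have "(coord \<xi>, coord (e B \<xi>)) \<in> adjoint_op I (E B)" using e_graph[OF B on(1)] by simp
  then have "cip (coord \<xi>) (coord (e B \<eta>)) = cip (coord (e B \<xi>)) (coord \<eta>)"
    using e_graph[OF B on(2)] unfolding adjoint_op_def by blast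
  then show ?thesis by (simp add: cip_eq_inner)
qed

lemma e_Int:
  assumes B: "B \<in> sets borel" and C: "C \<in> sets borel" and on: "\<xi> \<in> l2_on I"
  shows "e B (e C \<xi>) = e (B \<inter> C) \<xi>"
proof -
  have "E (B \<inter> C) = E B \<circ>\<^sub>o E C" using pvm B C unfolding projection_valued_measure_def by blast
  moreover have "(coord \<xi>, coord (e B (e C \<xi>))) \<in> E B \<circ>\<^sub>o E C"
    unfolding op_comp_def using e_graph[OF C on] e_graph[OF B e_on[OF C on]] by blast
  ultimately show ?thesis using e_iff[of "B \<inter> C" \<xi> "e B (e C \<xi>)"] B C by auto
qed

lemma e_UNIV: "\<xi> \<in> l2_on I \<Longrightarrow> e UNIV \<xi> = \<xi>"
proof -
  assume on: "\<xi> \<in> l2_on I"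
  have "E UNIV = Id_on (ell2 I)" using pvm by (simp add: projection_valued_measure_def)
  then have "(coord \<xi>, coord \<xi>) \<in> E UNIV" using on by (simp add: Id_on_iff coord_in_ell2)
  then show ?thesis by (simp add: e_iff)
qed

definition m :: "'g l2 \<Rightarrow> real measure" where
  "m \<xi> = vector_measure E (coord \<xi>)"

lemma sets_m [simp, measurable_cong]: "sets (m \<xi>) = sets borel"
  by (simp add: m_def vector_measure_def sets.sigma_sets_eq[of borel, simplified] sets.space_closed[of borel, simplified])

lemma space_m [simp]: "space (m \<xi>) = UNIV"
  using sets_eq_imp_space_eq[OF sets_m] by simp

lemma inner_e_self: "B \<in> sets borel \<Longrightarrow> \<xi> \<in> l2_on I \<Longrightarrow> inner \<xi> (e B \<xi>) = (norm (e B \<xi>))\<^sup>2"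
  using e_sym[of B \<xi> "e B \<xi>"] by (simp add: e_on e_Int power2_norm_eq_inner)

lemma emeasure_m:
  assumes B: "B \<in> sets borel" and on: "\<xi> \<in> l2_on I"
  shows "emeasure (m \<xi>) B = ennreal ((norm (e B \<xi>))\<^sup>2)"
proof -
  have ms: "measure_space UNIV (sets borel) (\<lambda>B. ennreal (Re (cip (coord \<xi>) (op_app (E B) (coord \<xi>)))))"
    using pvm on by (simp add: projection_valued_measure_def coord_in_ell2)
  have "op_app (E B) (coord \<xi>) = coord (e B \<xi>)"
    unfolding op_app_def
  proof (rule the_equality)
    show "(coord \<xi>, coord (e B \<xi>)) \<in> E B" by (rule e_graph[OF B on])
    fix g assume g: "(coord \<xi>, g) \<in> E B"
    then have "single_valued (E B)" using E_bounded[OF B] by (simp add: bounded_ops_def linear_op_def)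
    then show "g = coord (e B \<xi>)" using g e_graph[OF B on] by (metis single_valuedD)
  qed
  moreover have "emeasure (m \<xi>) B = ennreal (Re (cip (coord \<xi>) (op_app (E B) (coord \<xi>))))"
    unfolding m_def vector_measure_def
    by (rule emeasure_measure_of_sigma) (use ms B in \<open>auto simp: measure_space_def\<close>)
  ultimately show ?thesis by (simp add: cip_eq_inner inner_e_self[OF B on])
qed

lemma finite_measure_m: "\<xi> \<in> l2_on I \<Longrightarrow> finite_measure (m \<xi>)"
  by (rule finite_measureI) (simp add: emeasure_m)

lemma measure_m: "B \<in> sets borel \<Longrightarrow> \<xi> \<in> l2_on I \<Longrightarrow> measure (m \<xi>) B = (norm (e B \<xi>))\<^sup>2"
  by (simp add: measure_def emeasure_m)

lemma m_e:
  assumes "C \<in> sets borel" "\<xi> \<in> l2_on I"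
  shows "m (e C \<xi>) = density (m \<xi>) (indicator C)"
  using assms by (intro density_indicator_eqI) (simp_all add: finite_measure_m measure_m e_on e_Int)

lemma A_domain: "(\<exists>\<eta>. A \<xi> \<eta>) \<longleftrightarrow> \<xi> \<in> l2_on I \<and> (\<integral>\<^sup>+t. ennreal (t\<^sup>2) \<partial>m \<xi>) < \<infinity>"
proof -
  have D: "Domain a = {\<xi> \<in> ell2 I. (\<integral>\<^sup>+t. ennreal (t\<^sup>2) \<partial>vector_measure E \<xi>) < \<infinity>}"
    using spec by (simp add: is_spectral_measure_def)
  have "(\<exists>\<eta>. A \<xi> \<eta>) \<longleftrightarrow> coord \<xi> \<in> Domain a"
  proof
    assume "coord \<xi> \<in> Domain a"
    then obtain g where g: "(coord \<xi>, g) \<in> a" by blast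
    then have "g \<in> ell2 I" using lin by (auto simp: linear_op_def)
    then obtain \<eta> where "g = coord \<eta>" by (metis ell2_coordE)
    with g show "\<exists>\<eta>. A \<xi> \<eta>" by (auto simp: A_def)
  qed (auto simp: A_def)
  then show ?thesis unfolding D by (simp add: coord_in_ell2 m_def)
qed

lemma A_inner: "A \<xi> \<eta> \<Longrightarrow> inner \<xi> \<eta> = (\<integral>t. t \<partial>m \<xi>)"
proof -
  assume "A \<xi> \<eta>"
  then have "cip (coord \<xi>) (coord \<eta>) = complex_of_real (\<integral>t. t \<partial>m \<xi>)"
    using spec by (auto simp: A_def m_def is_spectral_measure_def)
  from arg_cong[OF this, of Re] show ?thesis by (simp add: cip_eq_inner)
qed

lemma integrable_m:
  assumes "A \<xi> \<eta>"
  shows "integrable (m \<xi>) (\<lambda>t. t)"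
proof -
  have on: "\<xi> \<in> l2_on I" and fin: "(\<integral>\<^sup>+t. ennreal (t\<^sup>2) \<partial>m \<xi>) < \<infinity>" using A_domain assms by blast+
  interpret finite_measure "m \<xi>" by (rule finite_measure_m[OF on])
  have "integrable (m \<xi>) (\<lambda>t. t\<^sup>2)" using fin by (simp add: integrable_iff_bounded)
  then have "integrable (m \<xi>) (\<lambda>t. 1 + t\<^sup>2)" by simp
  then show ?thesis
  proof (rule Bochner_Integration.integrable_bound)
    have "\<bar>t\<bar> \<le> 1 + t\<^sup>2" for t :: real
    proof -
      have "(\<bar>t\<bar> - 1)\<^sup>2 = t\<^sup>2 - 2 * \<bar>t\<bar> + 1" by (simp add: power2_diff)
      then show ?thesis using zero_le_power2[of "\<bar>t\<bar> - 1"] zero_le_power2[of t] by linarith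
    qed
    then show "AE t in m \<xi>. norm t \<le> norm (1 + t\<^sup>2)" by simp
  qed simp
qed

lemma A_cut_exists:
  assumes A: "A \<xi> \<eta>" and C: "C \<in> sets borel"
  shows "\<exists>\<eta>'. A (e C \<xi>) \<eta>'"
proof -
  have on: "\<xi> \<in> l2_on I" and fin: "(\<integral>\<^sup>+t. ennreal (t\<^sup>2) \<partial>m \<xi>) < \<infinity>" using A_domain A by blast+
  have "(\<integral>\<^sup>+t. ennreal (t\<^sup>2) \<partial>m (e C \<xi>)) = (\<integral>\<^sup>+t. indicator C t * ennreal (t\<^sup>2) \<partial>m \<xi>)"
    unfolding m_e[OF C on] by (rule nn_integral_density) (use C in auto)
  also have "\<dots> \<le> (\<integral>\<^sup>+t. ennreal (t\<^sup>2) \<partial>m \<xi>)"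
    by (rule nn_integral_mono) (simp add: indicator_def)
  finally show ?thesis using fin by (simp add: A_domain e_on[OF C on])
qed

lemma A_cell_exists:
  assumes C: "C \<in> sets borel" "C \<subseteq> {c..d}" and on: "\<xi> \<in> l2_on I"
  shows "\<exists>\<eta>. A (e C \<xi>) \<eta>"
proof -
  interpret finite_measure "m \<xi>" by (rule finite_measure_m[OF on])
  have "(\<integral>\<^sup>+t. ennreal (t\<^sup>2) \<partial>m (e C \<xi>)) = (\<integral>\<^sup>+t. indicator C t * ennreal (t\<^sup>2) \<partial>m \<xi>)"
    unfolding m_e[OF C(1) on] by (rule nn_integral_density) (use C in auto)
  also have "\<dots> \<le> (\<integral>\<^sup>+t. ennreal ((\<bar>c\<bar> + \<bar>d\<bar>)\<^sup>2) \<partial>m \<xi>)"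
  proof (rule nn_integral_mono)
    fix t
    have "t\<^sup>2 \<le> (\<bar>c\<bar> + \<bar>d\<bar>)\<^sup>2" if "t \<in> C"
    proof -
      have "c \<le> t" "t \<le> d" using that C(2) by auto
      then have "\<bar>t\<bar> \<le> \<bar>c\<bar> + \<bar>d\<bar>" by arith
      then show ?thesis by (simp add: abs_le_square_iff[symmetric])
    qed
    then show "indicator C t * ennreal (t\<^sup>2) \<le> ennreal ((\<bar>c\<bar> + \<bar>d\<bar>)\<^sup>2)"
      by (auto simp: indicator_def intro: ennreal_leI)
  qed
  also have "\<dots> < \<infinity>" by (simp add: emeasure_eq_measure ennreal_mult_less_top)
  finally show ?thesis by (simp add: A_domain e_on[OF C(1) on])
qed

lemma A_cell_bounds:
  assumes C: "C \<in> sets borel" "C \<subseteq> {c..d}" and on: "\<xi> \<in> l2_on I" and A: "A (e C \<xi>) \<eta>"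
  shows "c * (norm (e C \<xi>))\<^sup>2 \<le> inner (e C \<xi>) \<eta>" "inner (e C \<xi>) \<eta> \<le> d * (norm (e C \<xi>))\<^sup>2"
proof -
  interpret finite_measure "m (e C \<xi>)" by (rule finite_measure_m[OF e_on[OF C(1) on]])
  have AE: "AE t in m (e C \<xi>). t \<in> C"
    unfolding m_e[OF C(1) on] by (subst AE_density) (use C in \<open>auto simp: indicator_def\<close>)
  have tot: "measure (m (e C \<xi>)) UNIV = (norm (e C \<xi>))\<^sup>2"
    using C(1) on by (simp add: measure_m e_on e_UNIV)
  have "(\<integral>t. c \<partial>m (e C \<xi>)) \<le> (\<integral>t. t \<partial>m (e C \<xi>))"
  proof (rule integral_mono_AE[OF _ integrable_m[OF A]])
    show "AE t in m (e C \<xi>). c \<le> t" using AE by eventually_elim (use C(2) in auto)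
  qed simp
  then show "c * (norm (e C \<xi>))\<^sup>2 \<le> inner (e C \<xi>) \<eta>" by (simp add: A_inner[OF A] tot mult.commute)
  have "(\<integral>t. t \<partial>m (e C \<xi>)) \<le> (\<integral>t. d \<partial>m (e C \<xi>))"
  proof (rule integral_mono_AE[OF integrable_m[OF A]])
    show "AE t in m (e C \<xi>). t \<le> d" using AE by eventually_elim (use C(2) in auto)
  qed simp
  then show "inner (e C \<xi>) \<eta> \<le> d * (norm (e C \<xi>))\<^sup>2" by (simp add: A_inner[OF A] tot mult.commute)
qed

text \<open>A \<open>projection_valued_measure\<close> is additive by definition only in its scalar
  measures. Additivity of the projections follows by computing the squared norm of the
  difference.\<close>

lemma e_split: "C \<in> sets borel \<Longrightarrow> \<xi> \<in> l2_on I \<Longrightarrow> \<xi> = e C \<xi> + e (- C) \<xi>"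
proof -
  assume C: "C \<in> sets borel" and on: "\<xi> \<in> l2_on I"
  let ?d = "\<xi> - (e C \<xi> + e (- C) \<xi>)"
  interpret finite_measure "m \<xi>" by (rule finite_measure_m[OF on])
  have comp: "measure (m \<xi>) (- C) = measure (m \<xi>) UNIV - measure (m \<xi>) C"
    using finite_measure_compl[of C] C by (simp add: Compl_eq_Diff_UNIV)
  have "e {} \<xi> = 0" using measure_m[of "{}", OF _ on] by simp
  then have orth: "inner (e C \<xi>) (e (- C) \<xi>) = 0"
    using e_sym[of C \<xi> "e (- C) \<xi>"] C on by (simp add: e_on e_Int)
  have "inner ?d ?d = 0"
    unfolding inner_diff_left inner_diff_right inner_add_left inner_add_right
    using comp C on orth
    by (simp add: inner_commute[of "e C \<xi>" \<xi>] inner_commute[of "e (- C) \<xi>" \<xi>] inner_commute[of "e (- C) \<xi>" "e C \<xi>"]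
        inner_e_self dot_square_norm measure_m e_UNIV)
  then show ?thesis by simp
qed

text \<open>The spectral cut of v to [-n, n] lies in the domain; being orthogonal to v, it is zero,
  and the intervals exhaust the line.\<close>

lemma A_dense:
  assumes on: "v \<in> l2_on I" and orth: "\<And>\<zeta> \<theta>. A \<zeta> \<theta> \<Longrightarrow> inner v \<zeta> = 0"
  shows "v = 0"
proof -
  interpret finite_measure "m v" by (rule finite_measure_m[OF on])
  have "measure (m v) {- real n..real n} = 0" for n
  proof -
    obtain \<theta> where "A (e {- real n..real n} v) \<theta>" using A_cell_exists[OF _ order_refl on] by auto
    from orth[OF this] show ?thesis by (simp add: measure_m on inner_e_self[symmetric])
  qed
  moreover have "(\<lambda>n. measure (m v) {- real n..real n}) \<longlonglongrightarrow> measure (m v) (\<Union>n. {- real n..real n})"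
    by (rule finite_Lim_measure_incseq) (auto simp: incseq_def)
  moreover have "(\<Union>n. {- real n..real n}) = UNIV"
  proof -
    have "\<exists>n. t \<in> {- real n..real n}" for t :: real
    proof -
      obtain n where "\<bar>t\<bar> \<le> real n" using real_arch_simple by blast
      then show ?thesis by (intro exI[of _ n]) auto
    qed
    then show ?thesis by blast
  qed
  ultimately have "measure (m v) UNIV = 0" by (simp add: LIMSEQ_const_iff)
  then show ?thesis by (simp add: measure_m on e_UNIV)
qed

text \<open>The key to commutation. E gives the operator only through its quadratic form. At p + q
  the spectral integral splits over C and its complement, so the cross terms cancel; by symmetry
  they are equal, hence zero.\<close>

lemma cut_orthogonal:
  assumes C: "C \<in> sets borel" and 1: "A (e C \<xi>) \<eta>" and 2: "A (e (- C) \<zeta>) \<theta>"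
    and on: "\<xi> \<in> l2_on I" "\<zeta> \<in> l2_on I"
  shows "inner (e (- C) \<zeta>) \<eta> = 0"
proof -
  define p q where "p = e C \<xi>" and "q = e (- C) \<zeta>"
  have onp: "p \<in> l2_on I" "q \<in> l2_on I" using C on by (auto simp: p_def q_def e_on)
  have e0: "e {} z = 0" if "z \<in> l2_on I" for z using measure_m[of "{}", OF _ that] by simp
  have pq: "e C (p + q) = p" "e (- C) (p + q) = q"
    using C on by (simp_all add: p_def q_def e_add e_on e_Int e0)
  have onpq: "p + q \<in> l2_on I" using onp subspace_add[OF subspace_l2_on] by blast
  have A: "A (p + q) (\<eta> + \<theta>)" unfolding p_def q_def by (rule A_add[OF 1 2])
  have cut: "(\<integral>t. t \<partial>m (e B (p + q))) = (\<integral>t. indicator B t * t \<partial>m (p + q))" if B: "B \<in> sets borel" for B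
  proof -
    have "m (e B (p + q)) = density (m (p + q)) (\<lambda>t. ennreal (indicator B t))"
      unfolding m_e[OF B onpq] by (simp add: ennreal_indicator)
    then show ?thesis using B by (simp add: integral_density)
  qed
  have int: "integrable (m (p + q)) (\<lambda>t. indicator B t * t)" if "B \<in> sets borel" for B
    by (rule Bochner_Integration.integrable_bound[OF integrable_m[OF A]]) (use that in \<open>auto simp: indicator_def\<close>)
  have "inner (p + q) (\<eta> + \<theta>) = (\<integral>t. indicator C t * t + indicator (- C) t * t \<partial>m (p + q))"
    unfolding A_inner[OF A] by (rule Bochner_Integration.integral_cong) (auto simp: indicator_def)
  also have "\<dots> = (\<integral>t. indicator C t * t \<partial>m (p + q)) + (\<integral>t. indicator (- C) t * t \<partial>m (p + q))"
    by (rule Bochner_Integration.integral_add[OF int int]) (use C in auto)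
  also have "\<dots> = inner p \<eta> + inner q \<theta>"
    using cut[of C] cut[of "- C"] C pq A_inner[OF 1] A_inner[OF 2] by (simp add: p_def q_def)
  finally have "inner p \<theta> + inner q \<eta> = 0" by (simp add: inner_add_left inner_add_right)
  moreover have "inner p \<theta> = inner \<eta> q" unfolding p_def q_def by (rule A_sym[OF 1 2])
  ultimately have "inner q \<eta> = 0" by (simp add: inner_commute)
  then show ?thesis by (simp add: q_def)
qed

text \<open>By \<open>cut_orthogonal\<close>, the part of a (e D \<xi>) outside D is orthogonal to
  the domain, which is dense. Thus a maps the range of each projection into itself; this is applied
  to C and its complement.\<close>

lemma A_cut:
  assumes A: "A \<xi> \<eta>" and C: "C \<in> sets borel"
  shows "A (e C \<xi>) (e C \<eta>)"
proof -
  have on: "\<xi> \<in> l2_on I" "\<eta> \<in> l2_on I" using A_on[OF A] .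
  have C': "- C \<in> sets borel" using C by auto
  have zero: "e (- D) \<theta> = 0" if D: "D \<in> sets borel" and \<theta>: "A (e D \<xi>) \<theta>" for D \<theta>
  proof (rule A_dense)
    have D': "- D \<in> sets borel" using D by auto
    show "e (- D) \<theta> \<in> l2_on I" by (rule e_on[OF D' A_on(2)[OF \<theta>]])
    fix \<zeta> \<theta>' assume A': "A \<zeta> \<theta>'"
    obtain \<kappa> where "A (e (- D) \<zeta>) \<kappa>" using A_cut_exists[OF A' D'] by blast
    from cut_orthogonal[OF D \<theta> this on(1) A_on(1)[OF A']]
    show "inner (e (- D) \<theta>) \<zeta> = 0"
      using e_sym[OF D' A_on(1)[OF A'] A_on(2)[OF \<theta>]] by (simp add: inner_commute)
  qed
  obtain \<eta>1 where 1: "A (e C \<xi>) \<eta>1" using A_cut_exists[OF A C] by blast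
  obtain \<eta>2 where 2: "A (e (- C) \<xi>) \<eta>2" using A_cut_exists[OF A C'] by blast
  have "A \<xi> (\<eta>1 + \<eta>2)" using A_add[OF 1 2] e_split[OF C on(1)] by simp
  then have eq: "\<eta> = \<eta>1 + \<eta>2" using A_unique A by blast
  have "e C \<eta> = e C \<eta>1 + e C \<eta>2" unfolding eq by (rule e_add[OF C A_on(2)[OF 1] A_on(2)[OF 2]])
  also have "e C \<eta>2 = 0" using zero[OF C' 2] by simp
  also have "e C \<eta>1 = \<eta>1" using e_split[OF C A_on(2)[OF 1]] zero[OF C 1] by simp
  finally show ?thesis using 1 by simp
qed

text \<open>On the range of E [-(n + 1), -1 / (n + 1)] the quadratic form would be negative
  definite, against nonnegativity; these intervals exhaust the negative axis.\<close>

lemma measure_m_neg: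
  assumes on: "\<xi> \<in> l2_on I"
  shows "measure (m \<xi>) {..<0} = 0"
proof -
  interpret finite_measure "m \<xi>" by (rule finite_measure_m[OF on])
  define C where "C n = {- real (Suc n)..- (1 / real (Suc n))}" for n
  have "measure (m \<xi>) (C n) = 0" for n
  proof -
    have Cm: "C n \<in> sets borel" by (simp add: C_def)
    obtain \<eta> where A: "A (e (C n) \<xi>) \<eta>" using A_cell_exists[OF Cm _ on] by (auto simp: C_def)
    have "0 \<le> inner (e (C n) \<xi>) \<eta>" by (rule A_nonneg[OF A])
    also have "\<dots> \<le> - (1 / real (Suc n)) * (norm (e (C n) \<xi>))\<^sup>2"
      by (rule A_cell_bounds(2)[OF Cm _ on A, of "- real (Suc n)"]) (simp add: C_def)
    finally have "(1 / real (Suc n)) * (norm (e (C n) \<xi>))\<^sup>2 \<le> 0" by linarith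
    then have "(norm (e (C n) \<xi>))\<^sup>2 = 0"
      by (simp add: divide_le_eq)
    then show ?thesis by (simp add: measure_m[OF Cm on])
  qed
  moreover have "(\<lambda>n. measure (m \<xi>) (C n)) \<longlonglongrightarrow> measure (m \<xi>) (\<Union>n. C n)"
  proof (rule finite_Lim_measure_incseq)
    show "incseq C" unfolding incseq_def C_def
      by (auto intro: order_trans[rotated] simp: frac_le divide_simps)
  qed (auto simp: C_def)
  moreover have "(\<Union>n. C n) = {..<0}"
  proof (intro equalityI subsetI)
    fix t :: real assume "t \<in> {..<0}"
    then have t: "t < 0" by simp
    obtain n1 where n1: "- t \<le> real n1" using real_arch_simple by blast
    obtain n2 where n2: "1 / - t \<le> real n2" using real_arch_simple by blast
    let ?n = "n1 + n2"
    have "- real (Suc ?n) \<le> t" using n1 by simp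
    moreover have "1 / real (Suc ?n) \<le> - t"
    proof -
      have "1 / - t \<le> real (Suc ?n)" using n2 by simp
      then show ?thesis using t by (simp add: field_simps)
    qed
    ultimately have "t \<in> C ?n" by (simp add: C_def)
    then show "t \<in> (\<Union>n. C n)" by blast
  next
    fix t assume "t \<in> (\<Union>n. C n)"
    then obtain n where "t \<le> - (1 / real (Suc n))" by (auto simp: C_def)
    moreover have "0 < 1 / real (Suc n)" by simp
    ultimately have "t < 0" by linarith
    then show "t \<in> {..<0}" by simp
  qed
  ultimately show ?thesis by (simp add: LIMSEQ_const_iff)
qed

lemma A_upper:
  assumes r: "0 < r" and \<xi>: "\<xi> \<in> l2_on I" "e {0..r} \<xi> = \<xi>"
  shows "\<exists>\<eta>. A \<xi> \<eta> \<and> e {0..r} \<eta> = \<eta> \<and> norm \<eta> \<le> r * norm \<xi>"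
proof -
  obtain \<eta> where 1: "A \<xi> \<eta>" using A_cell_exists[of "{0..r}" 0 r \<xi>] \<xi> by auto
  have \<eta>: "e {0..r} \<eta> = \<eta>" using A_unique[OF A_cut[OF 1, of "{0..r}"]] 1 \<xi>(2) by simp
  obtain \<theta> where 2: "A \<eta> \<theta>" using A_cell_exists[of "{0..r}" 0 r \<eta>] \<eta> A_on(2)[OF 1] by auto
  have b1: "inner \<xi> \<eta> \<le> r * (norm \<xi>)\<^sup>2" using A_cell_bounds(2)[of "{0..r}" 0 r \<xi> \<eta>] 1 \<xi> by simp
  have b2: "inner \<eta> \<theta> \<le> r * (norm \<eta>)\<^sup>2" using A_cell_bounds(2)[of "{0..r}" 0 r \<eta> \<theta>] 2 \<eta> A_on(2)[OF 1] by simp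
  \<comment> \<open>\<open>is_spectral_measure\<close> gives quadratic forms, not norms of images.
    Nonnegativity at \<xi> - (1 / r) a \<xi>, with the forms at \<xi> and at a \<xi> bounded through
    r, yields the norm bound.\<close>
  have "A (\<xi> + (- (1 / r)) *\<^sub>R \<eta>) (\<eta> + (- (1 / r)) *\<^sub>R \<theta>)" by (rule A_add[OF 1 A_scaleR[OF 2]])
  from A_nonneg[OF this]
  have "0 \<le> inner \<xi> \<eta> - (1 / r) * inner \<xi> \<theta> - (1 / r) * inner \<eta> \<eta> + (1 / r)\<^sup>2 * inner \<eta> \<theta>"
    by (simp add: inner_add_left inner_add_right power2_eq_square algebra_simps)
  also have "inner \<xi> \<theta> = inner \<eta> \<eta>" by (rule A_sym[OF 1 2])
  also have "inner \<eta> \<eta> = (norm \<eta>)\<^sup>2" by (rule dot_square_norm)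
  finally have "2 * (1 / r) * (norm \<eta>)\<^sup>2 \<le> inner \<xi> \<eta> + (1 / r)\<^sup>2 * inner \<eta> \<theta>" by simp
  also have "\<dots> \<le> r * (norm \<xi>)\<^sup>2 + (1 / r)\<^sup>2 * (r * (norm \<eta>)\<^sup>2)"
    by (intro add_mono b1 mult_left_mono b2) simp
  also have "(1 / r)\<^sup>2 * (r * (norm \<eta>)\<^sup>2) = (1 / r) * (norm \<eta>)\<^sup>2" using r by (simp add: power2_eq_square)
  finally have "(1 / r) * (norm \<eta>)\<^sup>2 \<le> r * (norm \<xi>)\<^sup>2" by simp
  then have "(norm \<eta>)\<^sup>2 \<le> (r * norm \<xi>)\<^sup>2" using r by (simp add: field_simps power2_eq_square)
  then have "norm \<eta> \<le> r * norm \<xi>" by (rule power2_le_imp_le) (use r in simp)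
  with 1 \<eta> show ?thesis by blast
qed

lemma A_iterates:
  assumes r: "0 < r" and \<xi>: "\<xi> \<in> l2_on I" "e {0..r} \<xi> = \<xi>"
  shows "\<exists>s. s 0 = \<xi> \<and> (\<forall>k. A (s k) (s (Suc k)) \<and> norm (s k) \<le> r ^ k * norm \<xi>)"
proof -
  have "\<exists>s. \<forall>k. (e {0..r} (s k) = s k \<and> s k \<in> l2_on I \<and> (k = 0 \<longrightarrow> s k = \<xi>)) \<and>
      (A (s k) (s (Suc k)) \<and> norm (s (Suc k)) \<le> r * norm (s k))"
  proof (rule dependent_nat_choice)
    fix z and k :: nat assume "e {0..r} z = z \<and> z \<in> l2_on I \<and> (k = 0 \<longrightarrow> z = \<xi>)"
    then obtain \<eta> where "A z \<eta>" "e {0..r} \<eta> = \<eta>" "norm \<eta> \<le> r * norm z" using A_upper[OF r, of z] by blast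
    then show "\<exists>y. (e {0..r} y = y \<and> y \<in> l2_on I \<and> (Suc k = 0 \<longrightarrow> y = \<xi>)) \<and> (A z y \<and> norm y \<le> r * norm z)"
      using A_on(2) by blast
  qed (use \<xi> in auto)
  then obtain s where s: "s 0 = \<xi>" "\<And>k. A (s k) (s (Suc k))" "\<And>k. norm (s (Suc k)) \<le> r * norm (s k)"
    by metis
  have "norm (s k) \<le> r ^ k * norm \<xi>" for k
  proof (induction k)
    case (Suc k)
    have "norm (s (Suc k)) \<le> r * norm (s k)" by (rule s(3))
    also have "\<dots> \<le> r * (r ^ k * norm \<xi>)" using r Suc by simp
    finally show ?case by (simp add: mult.assoc)
  qed (simp add: s)
  with s show ?thesis by blast
qed

end

section \<open>Comparison of two spectral measures\<close>

context nonneg_spectral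
begin

lemma norm_e_le: "B \<in> sets borel \<Longrightarrow> \<xi> \<in> l2_on I \<Longrightarrow> norm (e B \<xi>) \<le> norm \<xi>"
proof -
  assume B: "B \<in> sets borel" and on: "\<xi> \<in> l2_on I"
  interpret finite_measure "m \<xi>" by (rule finite_measure_m[OF on])
  have "(norm (e B \<xi>))\<^sup>2 \<le> (norm \<xi>)\<^sup>2"
    using bounded_measure[of B] B on measure_m[of UNIV \<xi>] by (simp add: measure_m e_UNIV)
  then show ?thesis by (rule power2_le_imp_le) simp
qed

text \<open>
  Two spectral measures \<open>E\<close>, \<open>G\<close> of \<open>a\<close> are compared through the growth of \<open>\<parallel>a\<^sup>k v\<parallel>\<close>: it is at most
  of order \<open>\<rho>\<^sup>k\<close> if \<open>v\<close> is in the range of \<open>G [0, \<rho>]\<close>, and at least of order \<open>c\<^sup>k\<close> if \<open>v\<close> is in the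
  range of \<open>E [c, d]\<close>.
\<close>

lemma growth_cell:
  assumes s: "\<And>k. A (s k) (s (Suc k))" "\<And>k. norm (s k) \<le> \<rho> ^ k * K" and \<rho>: "0 < \<rho>" "\<rho> < c"
  shows "e {c..d} (s 0) = 0"
proof -
  define z where "z k = e {c..d} (s k)" for k
  have on: "s k \<in> l2_on I" for k using A_on(1)[OF s(1)] .
  have "c * norm (z k) \<le> norm (z (Suc k))" for k
  proof (cases "z k = 0")
    case False
    have "A (z k) (z (Suc k))" unfolding z_def by (rule A_cut[OF s(1)]) simp
    then have "c * (norm (z k))\<^sup>2 \<le> inner (z k) (z (Suc k))"
      unfolding z_def by (intro A_cell_bounds(1)[OF _ order_refl on]) simp_all
    also have "\<dots> \<le> norm (z k) * norm (z (Suc k))" by (rule norm_cauchy_schwarz)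
    finally have "norm (z k) * (c * norm (z k)) \<le> norm (z k) * norm (z (Suc k))"
      by (simp add: power2_eq_square mult.left_commute)
    then show ?thesis using False by simp
  qed simp
  then have "c ^ k * norm (z 0) \<le> norm (z k)" for k
  proof (induction k)
    case (Suc k)
    have "c ^ Suc k * norm (z 0) = c * (c ^ k * norm (z 0))" by simp
    also have "\<dots> \<le> c * norm (z k)" using Suc \<rho> by (intro mult_left_mono) auto
    also have "\<dots> \<le> norm (z (Suc k))" by (rule Suc(2))
    finally show ?case .
  qed simp
  moreover have "norm (z k) \<le> \<rho> ^ k * K" for k
    using norm_e_le[OF _ on, of "{c..d}" k] s(2)[of k] by (simp add: z_def)
  ultimately have bound: "norm (z 0) \<le> (\<rho> / c) ^ k * K" for k
  proof -
    have "c ^ k * norm (z 0) \<le> \<rho> ^ k * K"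
      using \<open>\<And>k. c ^ k * norm (z 0) \<le> norm (z k)\<close> \<open>\<And>k. norm (z k) \<le> \<rho> ^ k * K\<close> order_trans by blast
    moreover have "0 < c ^ k" using \<rho> by simp
    ultimately show ?thesis by (simp add: power_divide field_simps)
  qed
  have "(\<lambda>k. (\<rho> / c) ^ k * K) \<longlonglongrightarrow> 0 * K"
    using \<rho> by (intro tendsto_mult_right LIMSEQ_power_zero) auto
  then have "norm (z 0) \<le> 0 * K"
    by (rule tendsto_lowerbound) (use bound in auto)
  then show ?thesis by (simp add: z_def)
qed

text \<open>By \<open>growth_cell\<close> such a vector has no E-mass above r, and by
  \<open>measure_m_neg\<close> none below 0.\<close>

lemma range_subset:
  assumes G: "nonneg_spectral I a G" and r: "0 \<le> r" and \<xi>: "\<xi> \<in> l2_on I" "nonneg_spectral.e G {0..r} \<xi> = \<xi>"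
  shows "e {0..r} \<xi> = \<xi>"
proof -
  interpret G: nonneg_spectral I a G by fact
  have cell: "emeasure (m \<xi>) {c..d} = 0" if c: "r < c" for c d
  proof -
    \<comment> \<open>Strictly below c for the growth comparison, and strictly positive even for r =
      0, as \<open>A_iterates\<close> requires.\<close>
    define \<rho> where "\<rho> = (r + c) / 2"
    have \<rho>: "0 < \<rho>" "\<rho> < c" "r \<le> \<rho>" using r c by (auto simp: \<rho>_def)
    have "G.e {0..\<rho>} (G.e {0..r} \<xi>) = G.e {0..r} \<xi>"
    proof -
      have "{0..\<rho>} \<inter> {0..r} = {0..r}" using \<rho>(3) by auto
      then show ?thesis using G.e_Int[of "{0..\<rho>}" "{0..r}" \<xi>] \<xi>(1) by (simp del: Int_atLeastAtMost)
    qed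
    then have "G.e {0..\<rho>} \<xi> = \<xi>" by (simp add: \<xi>(2))
    from G.A_iterates[OF \<rho>(1) \<xi>(1) this] obtain s
      where s: "s 0 = \<xi>" "\<And>k. A (s k) (s (Suc k))" "\<And>k. norm (s k) \<le> \<rho> ^ k * norm \<xi>" by blast
    have "e {c..d} \<xi> = 0" using growth_cell[OF s(2,3) \<rho>(1,2)] by (simp add: s(1))
    then show ?thesis by (simp add: emeasure_m \<xi>(1))
  qed
  have "emeasure (m \<xi>) (\<Union>n. {r + 1 / real (Suc n)..r + 1 + real n}) = 0"
    by (rule emeasure_UN_eq_0) (auto intro!: cell)
  moreover have "(\<Union>n. {r + 1 / real (Suc n)..r + 1 + real n}) = {r<..}"
  proof (intro equalityI subsetI)
    fix t assume "t \<in> {r<..}"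
    then have t: "r < t" by simp
    obtain n1 where n1: "t - r \<le> real n1" using real_arch_simple by blast
    obtain n2 where n2: "1 / (t - r) \<le> real n2" using real_arch_simple by blast
    have "1 / real (Suc (n1 + n2)) \<le> t - r"
    proof -
      have "1 / (t - r) \<le> real (Suc (n1 + n2))" using n2 by simp
      then show ?thesis using t by (simp add: field_simps)
    qed
    then have "t \<in> {r + 1 / real (Suc (n1 + n2))..r + 1 + real (n1 + n2)}" using n1 by simp
    then show "t \<in> (\<Union>n. {r + 1 / real (Suc n)..r + 1 + real n})" by blast
  next
    fix t assume "t \<in> (\<Union>n. {r + 1 / real (Suc n)..r + 1 + real n})"
    then obtain n where "r + 1 / real (Suc n) \<le> t" by auto
    moreover have "0 < 1 / real (Suc n)" by simp
    ultimately have "r < t" by linarith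
    then show "t \<in> {r<..}" by simp
  qed
  ultimately have 1: "emeasure (m \<xi>) {r<..} = 0" by simp
  interpret M: finite_measure "m \<xi>" by (rule finite_measure_m[OF \<xi>(1)])
  have 2: "emeasure (m \<xi>) {..<0} = 0" using measure_m_neg[OF \<xi>(1)] by (simp add: M.emeasure_eq_measure)
  have "- {0..r} = {..<0} \<union> {r<..}" using r by auto
  then have "emeasure (m \<xi>) (- {0..r}) \<le> emeasure (m \<xi>) {..<0} + emeasure (m \<xi>) {r<..}"
    by (simp add: emeasure_subadditive)
  then have "emeasure (m \<xi>) (- {0..r}) = 0" by (simp add: 1 2)
  then have "e (- {0..r}) \<xi> = 0" using \<xi>(1) by (simp add: emeasure_m)
  then show ?thesis using e_split[of "{0..r}" \<xi>] \<xi>(1) by simp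
qed

text \<open>Orthogonal projections with the same range are equal; the two inclusions are
  \<open>range_subset\<close> with the roles of E and G exchanged.\<close>

lemma e_eq:
  assumes G: "nonneg_spectral I a G" and r: "0 \<le> r" and on: "\<xi> \<in> l2_on I"
  shows "nonneg_spectral.e G {0..r} \<xi> = e {0..r} \<xi>"
proof (rule vector_eq_rdot[THEN iffD1, OF allI])
  interpret G: nonneg_spectral I a G by fact
  have E: "nonneg_spectral I a E" by (rule nonneg_spectral_axioms)
  have 1: "e {0..r} (G.e {0..r} \<zeta>) = G.e {0..r} \<zeta>" if "\<zeta> \<in> l2_on I" for \<zeta>
    by (rule range_subset[OF G r]) (simp_all add: that G.e_on G.e_Int)
  have 2: "G.e {0..r} (e {0..r} \<zeta>) = e {0..r} \<zeta>" if "\<zeta> \<in> l2_on I" for \<zeta>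
    by (rule G.range_subset[OF E r]) (simp_all add: that e_on e_Int)
  have eq: "inner (G.e {0..r} \<xi>) \<zeta> = inner (e {0..r} \<xi>) \<zeta>" if "\<zeta> \<in> l2_on I" for \<zeta>
  proof -
    have "inner (G.e {0..r} \<xi>) \<zeta> = inner (e {0..r} (G.e {0..r} \<xi>)) \<zeta>" by (simp add: 1 on)
    also have "\<dots> = inner \<xi> (G.e {0..r} (e {0..r} \<zeta>))"
      using on that by (simp add: e_sym G.e_sym e_on G.e_on)
    also have "\<dots> = inner (e {0..r} \<xi>) \<zeta>" using on that by (simp add: 2 e_sym)
    finally show ?thesis .
  qed
  fix \<zeta>
  have "inner z \<zeta> = inner z (restr I \<zeta>)" if "z \<in> l2_on I" for z
    using restr_sym[of I z \<zeta>] by (simp add: restr_id[OF that])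
  then show "inner (G.e {0..r} \<xi>) \<zeta> = inner (e {0..r} \<xi>) \<zeta>"
    using eq[OF restr_l2_on] on by (simp add: e_on G.e_on)
qed

text \<open>The masses of [0, r] together with the vanishing on the negative axis give the
  distribution function, and this determines the measure.\<close>

theorem unique:
  assumes G: "nonneg_spectral I a G" and on: "\<xi> \<in> l2_on I"
  shows "vector_measure G (coord \<xi>) = vector_measure E (coord \<xi>)"
proof -
  interpret G: nonneg_spectral I a G by fact
  interpret M: finite_measure "m \<xi>" by (rule finite_measure_m[OF on])
  interpret N: finite_measure "G.m \<xi>" by (rule G.finite_measure_m[OF on])
  have split: "{..r} = {..<0} \<union> {0..r}" if "0 \<le> r" for r :: real using that by auto
  have "measure (G.m \<xi>) {..r} = measure (m \<xi>) {..r}" for r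
  proof (cases "0 \<le> r")
    case True
    have "measure (G.m \<xi>) {..r} = measure (G.m \<xi>) {..<0} + measure (G.m \<xi>) {0..r}"
      unfolding split[OF True] by (rule N.finite_measure_Union) auto
    moreover have "measure (m \<xi>) {..r} = measure (m \<xi>) {..<0} + measure (m \<xi>) {0..r}"
      unfolding split[OF True] by (rule M.finite_measure_Union) auto
    ultimately show ?thesis
      using on measure_m_neg[OF on] G.measure_m_neg[OF on] measure_m[of "{0..r}" \<xi>] G.measure_m[of "{0..r}" \<xi>]
      by (simp add: e_eq[OF G True])
  next
    case False
    then have sub: "{..r} \<subseteq> {..<0}" by auto
    have "measure (m \<xi>) {..r} = 0"
      using M.finite_measure_mono[OF sub] measure_m_neg[OF on] by (simp add: antisym)
    moreover have "measure (G.m \<xi>) {..r} = 0"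
      using N.finite_measure_mono[OF sub] G.measure_m_neg[OF on] by (simp add: antisym)
    ultimately show ?thesis by simp
  qed
  then have "cdf (G.m \<xi>) = cdf (m \<xi>)" by (simp add: cdf_def fun_eq_iff)
  moreover have "finite_borel_measure (m \<xi>)" "finite_borel_measure (G.m \<xi>)"
    by (simp_all add: finite_borel_measure_def finite_borel_measure_axioms_def M.finite_measure_axioms N.finite_measure_axioms)
  ultimately have "G.m \<xi> = m \<xi>" by (intro cdf_unique') auto
  then show ?thesis by (simp add: m_def G.m_def)
qed

end

context positive_operator
begin

lemma nonneg_spectral_sq:
  assumes "is_spectral_measure I (x \<circ>\<^sub>o x) E"
  shows "nonneg_spectral I (x \<circ>\<^sub>o x) E"
proof
  show "is_spectral_measure I (x \<circ>\<^sub>o x) E" by fact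
  have sub: "x \<subseteq> ell2 I \<times> ell2 I" and sv: "single_valued x" and z: "(\<lambda>i. 0, \<lambda>i. 0) \<in> x"
    and add: "\<And>f g f' g'. (f, g) \<in> x \<Longrightarrow> (f', g') \<in> x \<Longrightarrow> (\<lambda>i. f i + f' i, \<lambda>i. g i + g' i) \<in> x"
    and scale: "\<And>c f g. (f, g) \<in> x \<Longrightarrow> (\<lambda>i. c * f i, \<lambda>i. c * g i) \<in> x"
    using linear unfolding linear_op_def by blast+
  show "linear_op I (x \<circ>\<^sub>o x)"
    unfolding linear_op_def op_comp_def
  proof (intro conjI ballI allI)
    show "x O x \<subseteq> ell2 I \<times> ell2 I" using sub by blast
    show "single_valued (x O x)" using sv sv by (rule single_valued_relcomp)
    show "(\<lambda>i. 0, \<lambda>i. 0) \<in> x O x" using z by blast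
  next
    fix p assume p: "p \<in> x O x"
    then show "case p of (\<xi>, \<eta>) \<Rightarrow> \<forall>(\<xi>', \<eta>')\<in>x O x. (\<lambda>i. \<xi> i + \<xi>' i, \<lambda>i. \<eta> i + \<eta>' i) \<in> x O x"
      using add by blast
    fix c
    from p show "case p of (\<xi>, \<eta>) \<Rightarrow> (\<lambda>i. c * \<xi> i, \<lambda>i. c * \<eta> i) \<in> x O x"
      using scale by blast
  qed
  have cs: "cip f g' = cip g f'" if "(f, g) \<in> x" "(f', g') \<in> x" for f g f' g'
    using that adj unfolding adjoint_op_def by blast
  show "cip f h' = cip h f'" if "(f, h) \<in> x \<circ>\<^sub>o x" "(f', h') \<in> x \<circ>\<^sub>o x" for f h f' h'
  proof -
    obtain g where g: "(f, g) \<in> x" "(g, h) \<in> x" using \<open>(f, h) \<in> x \<circ>\<^sub>o x\<close> unfolding op_comp_def by blast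
    obtain g' where g': "(f', g') \<in> x" "(g', h') \<in> x" using \<open>(f', h') \<in> x \<circ>\<^sub>o x\<close> unfolding op_comp_def by blast
    show ?thesis using cs[OF g(1) g'(2)] cs[OF g(2) g'(1)] by simp
  qed
  show "0 \<le> Re (cip f h)" if "(f, h) \<in> x \<circ>\<^sub>o x" for f h
  proof -
    obtain g where g: "(f, g) \<in> x" "(g, h) \<in> x" using \<open>(f, h) \<in> x \<circ>\<^sub>o x\<close> unfolding op_comp_def by blast
    obtain \<xi> \<eta> where "f = coord \<xi>" "g = coord \<eta>" using xE[OF g(1)] .
    then show ?thesis using cs[OF g(1) g(2)] by (simp add: cip_eq_inner)
  qed
qed

text \<open>Existence and uniqueness together evaluate the choice operator in \<^const>\<open>spectral_measure\<close>.\<close>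

theorem vector_measure_sq:
  assumes "\<xi> \<in> l2_on I"
  shows "vector_measure (spectral_measure I (x \<circ>\<^sub>o x)) (coord \<xi>) = sq_measure \<xi>"
proof -
  have "is_spectral_measure I (x \<circ>\<^sub>o x) (spectral_measure I (x \<circ>\<^sub>o x))"
    unfolding spectral_measure_def by (rule someI[of _ sq_resolution]) (rule sq_spectral)
  then have 1: "nonneg_spectral I (x \<circ>\<^sub>o x) (spectral_measure I (x \<circ>\<^sub>o x))" by (rule nonneg_spectral_sq)
  interpret S: nonneg_spectral I "x \<circ>\<^sub>o x" sq_resolution by (rule nonneg_spectral_sq[OF sq_spectral])
  show ?thesis using S.unique[OF 1 assms] by (simp add: sq_resolution assms)
qed

end

section \<open>Tripods in the free group\<close>

definition word_inv :: "letter list \<Rightarrow> letter list" where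
  "word_inv w = rev (map inv_letter w)"

lemma word_inv_Nil [simp]: "word_inv [] = []" and word_inv_Cons: "word_inv (b # w) = word_inv w @ [inv_letter b]"
  by (simp_all add: word_inv_def)

lemma word_inv_eq_Nil [simp]: "word_inv w = [] \<longleftrightarrow> w = []"
  by (simp add: word_inv_def)

lemma inv_letter_inject: "inv_letter p = inv_letter q \<longleftrightarrow> p = q"
  by (metis inv_letter_inv_letter)

lemma inj_word_inv: "word_inv v = word_inv w \<Longrightarrow> v = w"
  unfolding word_inv_def
  by (metis inv_letter_inv_letter inj_map_eq_map injI rev_rev_ident)

lemma reduced_append:
  "reduced (u @ w) \<longleftrightarrow> reduced u \<and> reduced w \<and> (u = [] \<or> w = [] \<or> hd w \<noteq> inv_letter (last u))"
  by (induction u) (auto simp: reduced_Cons reduced_Nil hd_append)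

lemma reduced_word_inv: "reduced w \<Longrightarrow> reduced (word_inv w)"
proof (induction w)
  case (Cons b w)
  show ?case
  proof (cases w)
    case (Cons b' w')
    then have "last (word_inv w) = inv_letter b'" by (simp add: word_inv_Cons)
    then show ?thesis
      using Cons.IH Cons.prems Cons
      by (auto simp: word_inv_Cons[of b] reduced_append reduced_Cons reduced_Nil)
  qed (simp add: word_inv_Cons reduced_def)
qed simp

lemma foldr_push_append: "reduced (u @ w) \<Longrightarrow> foldr push_letter u w = u @ w"
proof (induction u)
  case (Cons a u)
  then have "foldr push_letter u w = u @ w" by (simp add: reduced_Cons)
  then show ?case using Cons.prems by (cases "u @ w") (auto simp: reduced_Cons)
qed simp

lemma foldr_push_word_inv: "foldr push_letter (word_inv v) (v @ w) = w"
  by (induction v) (simp_all add: word_inv_Cons)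

abbreviation free_carrier :: "nat \<Rightarrow> letter list set" where
  "free_carrier n \<equiv> carrier (free_group n)"

lemma free_carrier_iff: "w \<in> free_carrier n \<longleftrightarrow> reduced w \<and> fst ` set w \<subseteq> {..<n}"
  by (simp add: free_group_def)

lemma free_carrier_append_D: "u @ w \<in> free_carrier n \<Longrightarrow> u \<in> free_carrier n \<and> w \<in> free_carrier n"
  by (auto simp: free_carrier_iff reduced_append)

lemma word_inv_carrier: assumes "w \<in> free_carrier n" shows "word_inv w \<in> free_carrier n"
proof -
  have "fst ` set (word_inv w) = fst ` set w" by (simp add: word_inv_def image_image)
  then show ?thesis using assms by (simp add: free_carrier_iff reduced_word_inv)
qed

lemma free_one [simp]: "\<one>\<^bsub>free_group n\<^esub> = []"
  by (simp add: free_group_def)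

text \<open>Once the common suffix w is stripped, the last letters of u and v differ, so nothing
  cancels at the junction of u with the inverse of v.\<close>

lemma free_group_div:
  assumes g: "u @ w \<in> free_carrier n" and h: "v @ w \<in> free_carrier n"
    and uv: "u = [] \<or> v = [] \<or> last u \<noteq> last v"
  shows "u @ word_inv v \<in> free_carrier n"
    and "(u @ w) \<otimes>\<^bsub>free_group n\<^esub> inv\<^bsub>free_group n\<^esub> (v @ w) = u @ word_inv v"
proof -
  interpret group "free_group n" by (rule group_free_group)
  have "hd (word_inv v) = inv_letter (last v)" if "v \<noteq> []"
    using that by (simp add: word_inv_def hd_rev last_map)
  then have "reduced (u @ word_inv v)"
    using g h uv by (auto simp: free_carrier_iff reduced_append reduced_word_inv inv_letter_inject)
  then show c: "u @ word_inv v \<in> free_carrier n"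
    using g h by (auto simp: free_carrier_iff word_inv_def)
  have "(u @ word_inv v) \<otimes>\<^bsub>free_group n\<^esub> (v @ w) = foldr push_letter u (foldr push_letter (word_inv v) (v @ w))"
    by (simp add: free_group_def)
  also have "\<dots> = u @ w"
    using g by (simp add: foldr_push_word_inv foldr_push_append free_carrier_iff)
  finally show "(u @ w) \<otimes>\<^bsub>free_group n\<^esub> inv\<^bsub>free_group n\<^esub> (v @ w) = u @ word_inv v"
    using c g h by (simp add: inv_solve_right')
qed

lemma free_inv: "v \<in> free_carrier n \<Longrightarrow> inv\<^bsub>free_group n\<^esub> v = word_inv v"
proof -
  assume v: "v \<in> free_carrier n"
  interpret group "free_group n" by (rule group_free_group)
  have "[] \<in> free_carrier n" by (simp add: free_carrier_iff reduced_Nil)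
  then show ?thesis using free_group_div(2)[of "[]" "[]" n v] v l_one[of "inv\<^bsub>free_group n\<^esub> v"] by simp
qed

lemma common_suffix: "\<exists>u v w. g = u @ w \<and> h = v @ w \<and> (u = [] \<or> v = [] \<or> last u \<noteq> last v)"
proof (induction g arbitrary: h rule: rev_induct)
  case (snoc a g)
  show ?case
  proof (cases "h \<noteq> [] \<and> last h = a")
    case True
    then obtain h' where h: "h = h' @ [a]" by (metis append_butlast_last_id)
    obtain u v w where "g = u @ w" "h' = v @ w" "u = [] \<or> v = [] \<or> last u \<noteq> last v"
      using snoc[of h'] by blast
    then have "g @ [a] = u @ (w @ [a]) \<and> h = v @ (w @ [a]) \<and> (u = [] \<or> v = [] \<or> last u \<noteq> last v)"
      using h by simp
    then show ?thesis by blast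
  next
    case False
    then have "g @ [a] = (g @ [a]) @ [] \<and> h = h @ [] \<and> (g @ [a] = [] \<or> h = [] \<or> last (g @ [a]) \<noteq> last h)"
      by auto
    then show ?thesis by blast
  qed
qed (rule exI[of _ "[]"], rule exI, rule exI[of _ "[]"], simp)

section \<open>Cauchy-Schwarz estimates for tripod sums\<close>

lemma sum_prod_le:
  fixes b :: "'i \<Rightarrow> 'j \<Rightarrow> real"
  assumes "finite L" "finite K" and x: "(\<Sum>u\<in>L. (x u)\<^sup>2) \<le> s" and y: "(\<Sum>v\<in>K. (y v)\<^sup>2) \<le> s"
    and b: "(\<Sum>u\<in>L. \<Sum>v\<in>K. (b u v)\<^sup>2) \<le> \<alpha>\<^sup>2" and \<alpha>: "0 \<le> \<alpha>" and s: "0 \<le> s"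
  shows "(\<Sum>u\<in>L. \<Sum>v\<in>K. x u * y v * b u v) \<le> s * \<alpha>"
proof -
  have "(\<Sum>u\<in>L. \<Sum>v\<in>K. x u * y v * b u v)\<^sup>2 = (\<Sum>p\<in>L \<times> K. (x (fst p) * y (snd p)) * b (fst p) (snd p))\<^sup>2"
    by (simp add: sum.cartesian_product split_def)
  also have "\<dots> \<le> (\<Sum>p\<in>L \<times> K. (x (fst p) * y (snd p))\<^sup>2) * (\<Sum>p\<in>L \<times> K. (b (fst p) (snd p))\<^sup>2)"
    by (rule Cauchy_Schwarz_ineq_sum)
  also have "(\<Sum>p\<in>L \<times> K. (x (fst p) * y (snd p))\<^sup>2) = (\<Sum>u\<in>L. (x u)\<^sup>2) * (\<Sum>v\<in>K. (y v)\<^sup>2)"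
    by (simp add: sum_product sum.cartesian_product split_def power_mult_distrib)
  also have "(\<Sum>p\<in>L \<times> K. (b (fst p) (snd p))\<^sup>2) = (\<Sum>u\<in>L. \<Sum>v\<in>K. (b u v)\<^sup>2)"
    by (simp add: sum.cartesian_product split_def)
  also have "(\<Sum>u\<in>L. (x u)\<^sup>2) * (\<Sum>v\<in>K. (y v)\<^sup>2) * (\<Sum>u\<in>L. \<Sum>v\<in>K. (b u v)\<^sup>2) \<le> (s * s) * \<alpha>\<^sup>2"
    using x y b s by (intro mult_mono) (auto intro!: sum_nonneg mult_nonneg_nonneg)
  also have "\<dots> = (s * \<alpha>)\<^sup>2" by (simp add: power2_eq_square)
  finally show ?thesis by (rule power2_le_imp_le) (use \<alpha> s in simp)
qed

text \<open>The sum is the trace of a product of three matrices, bounded by their Hilbert-Schmidt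
  norms: Cauchy-Schwarz over w, then over the pairs (u, v).\<close>

lemma sum_triangle_le:
  fixes b b' :: "'i \<Rightarrow> 'i \<Rightarrow> real"
  assumes L: "finite L" and b: "(\<Sum>u\<in>L. \<Sum>v\<in>L. (b u v)\<^sup>2) \<le> \<alpha>\<^sup>2"
    and b': "(\<Sum>u\<in>L. \<Sum>v\<in>L. (b' u v)\<^sup>2) \<le> \<alpha>\<^sup>2" and \<alpha>: "0 \<le> \<alpha>"
  shows "(\<Sum>u\<in>L. \<Sum>v\<in>L. \<Sum>w\<in>L. b u w * b v w * b' u v) \<le> \<alpha> ^ 3"
proof -
  let ?r = "\<lambda>u. \<Sum>w\<in>L. (b u w)\<^sup>2"
  have "(\<Sum>u\<in>L. \<Sum>v\<in>L. \<Sum>w\<in>L. b u w * b v w * b' u v) = (\<Sum>u\<in>L. \<Sum>v\<in>L. (\<Sum>w\<in>L. b u w * b v w) * b' u v)"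
    by (simp add: sum_distrib_right)
  also have "\<dots> \<le> (\<Sum>u\<in>L. \<Sum>v\<in>L. sqrt (?r u) * sqrt (?r v) * \<bar>b' u v\<bar>)"
  proof (intro sum_mono)
    fix u v
    have "(\<Sum>w\<in>L. b u w * b v w)\<^sup>2 \<le> (sqrt (?r u) * sqrt (?r v))\<^sup>2"
      using Cauchy_Schwarz_ineq_sum[of "b u" "b v" L] by (simp add: power_mult_distrib sum_nonneg)
    moreover have "0 \<le> sqrt (?r u) * sqrt (?r v)" by (simp add: sum_nonneg)
    ultimately have "\<bar>\<Sum>w\<in>L. b u w * b v w\<bar> \<le> sqrt (?r u) * sqrt (?r v)"
      by (simp only: power2_le_iff_abs_le)
    then have "\<bar>\<Sum>w\<in>L. b u w * b v w\<bar> * \<bar>b' u v\<bar> \<le> sqrt (?r u) * sqrt (?r v) * \<bar>b' u v\<bar>"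
      by (rule mult_right_mono) simp
    then show "(\<Sum>w\<in>L. b u w * b v w) * b' u v \<le> sqrt (?r u) * sqrt (?r v) * \<bar>b' u v\<bar>"
      using abs_ge_self[of "(\<Sum>w\<in>L. b u w * b v w) * b' u v"] by (simp only: abs_mult)
  qed
  also have "\<dots> \<le> \<alpha>\<^sup>2 * \<alpha>"
    \<comment> \<open>The row norms act as x and y; their squares sum to at most \<alpha>^2, which
      takes the role of s.\<close>
    by (rule sum_prod_le[OF L L, of _ "\<alpha>\<^sup>2"]) (use b b' \<alpha> in \<open>auto simp: sum_nonneg\<close>)
  finally show ?thesis by (simp add: power2_eq_square power3_eq_cube)
qed

text \<open>The weights c stand for the moduli of the coefficients of x, and their invariance under
  inversion is what self-adjointness leaves behind. The energy bounds are asked on finite sets only,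
  which is where the combinatorics takes place.\<close>

locale tripod =
  fixes n :: nat and c :: "letter list \<Rightarrow> real" and s \<alpha> :: real
  assumes c_nonneg: "0 \<le> c g"
    and c_inv: "g \<in> free_carrier n \<Longrightarrow> c (word_inv g) = c g"
    and c_s: "finite K \<Longrightarrow> K \<subseteq> free_carrier n - {[]} \<Longrightarrow> (\<Sum>k\<in>K. (c k)\<^sup>2) \<le> s"
    and c_\<alpha>: "finite K \<Longrightarrow> K \<subseteq> free_carrier n - {[]} \<Longrightarrow> (\<Sum>k\<in>K. real (length k - 1) * (c k)\<^sup>2) \<le> \<alpha>\<^sup>2"
    and \<alpha>_nonneg: "0 \<le> \<alpha>"
begin

lemma s_nonneg: "0 \<le> s"
  using c_s[of "{}"] by simp

text \<open>Like \<open>b\<close>, extended by zero, since the sums run over all words of a finite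
  set, whether or not they form an admissible tripod.\<close>

definition c' :: "letter list \<Rightarrow> real" where
  "c' u = (if u \<in> free_carrier n - {[]} then c u else 0)"

definition b :: "letter list \<Rightarrow> letter list \<Rightarrow> real" where
  "b u w = (if u \<noteq> [] \<and> w \<noteq> [] \<and> u @ w \<in> free_carrier n then c (u @ w) else 0)"

lemma c'_nonneg: "0 \<le> c' u" and b_nonneg: "0 \<le> b u w"
  by (simp_all add: c'_def b_def c_nonneg)

lemma sum_c': "finite L \<Longrightarrow> (\<Sum>u\<in>L. (c' u)\<^sup>2) \<le> s"
proof -
  assume L: "finite L"
  have "(\<Sum>u\<in>L. (c' u)\<^sup>2) = (\<Sum>u\<in>L \<inter> (free_carrier n - {[]}). (c u)\<^sup>2)"
    unfolding c'_def by (subst sum.inter_restrict[OF L]) (auto intro!: sum.cong)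
  also have "\<dots> \<le> s" by (rule c_s) (use L in auto)
  finally show ?thesis .
qed

text \<open>A word of length \<open>k\<close> splits into two nonempty words in \<open>k - 1\<close> ways.\<close>

lemma sum_b:
  assumes A: "finite A"
  shows "(\<Sum>p\<in>A. (b (fst p) (snd p))\<^sup>2) \<le> \<alpha>\<^sup>2"
proof -
  define A' where "A' = {p\<in>A. fst p \<noteq> [] \<and> snd p \<noteq> [] \<and> fst p @ snd p \<in> free_carrier n}"
  \<comment> \<open>A pair of words is recovered from its concatenation and the position of the
    cut.\<close>
  define f :: "letter list \<times> letter list \<Rightarrow> _" where "f p = (fst p @ snd p, length (fst p))" for p
  define K where "K = (\<lambda>p. fst p @ snd p) ` A'"
  have fin: "finite A'" "finite K" using A by (simp_all add: A'_def K_def)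
  have inj: "inj_on f A'" by (auto simp: inj_on_def f_def)
  have "(\<Sum>p\<in>A. (b (fst p) (snd p))\<^sup>2) = (\<Sum>p\<in>A'. (c (fst p @ snd p))\<^sup>2)"
    unfolding A'_def b_def by (subst sum.inter_filter[OF A]) (auto intro!: sum.cong)
  also have "\<dots> = (\<Sum>q\<in>f ` A'. (c (fst q))\<^sup>2)"
    by (subst sum.reindex[OF inj]) (simp add: f_def)
  also have "\<dots> \<le> (\<Sum>q\<in>Sigma K (\<lambda>k. {1..<length k}). (c (fst q))\<^sup>2)"
  proof (rule sum_mono2)
    show "f ` A' \<subseteq> Sigma K (\<lambda>k. {1..<length k})"
      by (auto simp: f_def K_def A'_def Suc_le_eq)
  qed (use fin in auto)
  also have "\<dots> = (\<Sum>k\<in>K. \<Sum>i\<in>{1..<length k}. (c k)\<^sup>2)"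
    using fin by (subst sum.Sigma) (auto simp: split_def)
  also have "\<dots> = (\<Sum>k\<in>K. real (length k - 1) * (c k)\<^sup>2)" by simp
  also have "\<dots> \<le> \<alpha>\<^sup>2" by (rule c_\<alpha>[OF fin(2)]) (auto simp: K_def A'_def)
  finally show ?thesis .
qed

lemma sum_b2: "finite L \<Longrightarrow> (\<Sum>u\<in>L. \<Sum>w\<in>L. (b u w)\<^sup>2) \<le> \<alpha>\<^sup>2"
  using sum_b[of "L \<times> L"] by (simp add: sum.cartesian_product split_def)

lemma sum_b2_inv: "finite L \<Longrightarrow> (\<Sum>u\<in>L. \<Sum>w\<in>L. (b u (word_inv w))\<^sup>2) \<le> \<alpha>\<^sup>2"
proof -
  assume L: "finite L"
  have "inj_on (\<lambda>p. (fst p, word_inv (snd p))) (L \<times> L)" by (auto simp: inj_on_def dest: inj_word_inv)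
  from sum.reindex[OF this, of "\<lambda>p. (b (fst p) (snd p))\<^sup>2"] sum_b[of "(\<lambda>p. (fst p, word_inv (snd p))) ` (L \<times> L)"] L
  show ?thesis by (simp add: sum.cartesian_product split_def)
qed

text \<open>
  A product \<open>c g * c (g h\<^sup>-\<^sup>1) * c h\<close> is indexed by a tripod: \<open>g = u w\<close>, \<open>h = v w\<close> and
  \<open>g h\<^sup>-\<^sup>1 = u v\<^sup>-\<^sup>1\<close> without cancellation.  At most one of the legs \<open>u\<close>, \<open>v\<close>, \<open>w\<close> is empty.
\<close>

definition R :: "letter list \<Rightarrow> letter list \<Rightarrow> letter list \<Rightarrow> real" where
  "R u v w = (if w = [] then c' u * c' v * b u (word_inv v) else 0) +
     (if u = [] then c' v * c' w * b v w else 0) + (if v = [] then c' u * c' w * b u w else 0) +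
     b u w * b v w * b u (word_inv v)"

lemma R_nonneg: "0 \<le> R u v w"
  by (simp add: R_def c'_nonneg b_nonneg)

text \<open>Each of the three degenerate types, with one empty leg, pairs two vectors of squared
  norm at most s with a kernel of norm at most \<alpha>. The proper tripods form a triangle of three
  such kernels.\<close>

lemma sum_R:
  assumes L: "finite L"
  shows "(\<Sum>u\<in>L. \<Sum>v\<in>L. \<Sum>w\<in>L. R u v w) \<le> 3 * s * \<alpha> + \<alpha> ^ 3"
proof -
  have delta: "(\<Sum>z\<in>L. if z = [] then f else 0) \<le> f" if "0 \<le> f" for f :: real
    using L that by (simp add: sum.delta)
  have bb: "(\<Sum>u\<in>L. \<Sum>w\<in>L. c' u * c' w * b u w) \<le> s * \<alpha>"
    by (rule sum_prod_le[OF L L sum_c'[OF L] sum_c'[OF L] sum_b2[OF L] \<alpha>_nonneg s_nonneg])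
  have bi: "(\<Sum>u\<in>L. \<Sum>w\<in>L. c' u * c' w * b u (word_inv w)) \<le> s * \<alpha>"
    by (rule sum_prod_le[OF L L sum_c'[OF L] sum_c'[OF L] sum_b2_inv[OF L] \<alpha>_nonneg s_nonneg])
  have 1: "(\<Sum>u\<in>L. \<Sum>v\<in>L. \<Sum>w\<in>L. if w = [] then c' u * c' v * b u (word_inv v) else 0) \<le> s * \<alpha>"
    by (rule order_trans[OF _ bi]) (intro sum_mono delta mult_nonneg_nonneg c'_nonneg b_nonneg)
  have "(\<Sum>u\<in>L. \<Sum>v\<in>L. \<Sum>w\<in>L. if u = [] then c' v * c' w * b v w else 0) =
      (\<Sum>v\<in>L. \<Sum>w\<in>L. \<Sum>u\<in>L. if u = [] then c' v * c' w * b v w else 0)"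
    by (subst sum.swap, rule sum.cong[OF refl], rule sum.swap)
  also have "\<dots> \<le> s * \<alpha>"
    by (rule order_trans[OF _ bb]) (intro sum_mono delta mult_nonneg_nonneg c'_nonneg b_nonneg)
  finally have 2: "(\<Sum>u\<in>L. \<Sum>v\<in>L. \<Sum>w\<in>L. if u = [] then c' v * c' w * b v w else 0) \<le> s * \<alpha>" .
  have "(\<Sum>u\<in>L. \<Sum>v\<in>L. \<Sum>w\<in>L. if v = [] then c' u * c' w * b u w else 0) =
      (\<Sum>u\<in>L. \<Sum>w\<in>L. \<Sum>v\<in>L. if v = [] then c' u * c' w * b u w else 0)"
    by (rule sum.cong[OF refl], rule sum.swap)
  also have "\<dots> \<le> s * \<alpha>"
    by (rule order_trans[OF _ bb]) (intro sum_mono delta mult_nonneg_nonneg c'_nonneg b_nonneg)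
  finally have 3: "(\<Sum>u\<in>L. \<Sum>v\<in>L. \<Sum>w\<in>L. if v = [] then c' u * c' w * b u w else 0) \<le> s * \<alpha>" .
  have 4: "(\<Sum>u\<in>L. \<Sum>v\<in>L. \<Sum>w\<in>L. b u w * b v w * b u (word_inv v)) \<le> \<alpha> ^ 3"
    by (rule sum_triangle_le[OF L sum_b2[OF L] sum_b2_inv[OF L] \<alpha>_nonneg])
  show ?thesis unfolding R_def sum.distrib using 1 2 3 4 by linarith
qed

lemma term_le_R:
  assumes g: "u @ w \<in> free_carrier n" and h: "v @ w \<in> free_carrier n"
    and uv: "u = [] \<or> v = [] \<or> last u \<noteq> last v"
    and ne: "u @ w \<noteq> []" "v @ w \<noteq> []" "u @ w \<noteq> v @ w"
  shows "c (u @ w) * c ((u @ w) \<otimes>\<^bsub>free_group n\<^esub> inv\<^bsub>free_group n\<^esub> (v @ w)) * c (v @ w) \<le> R u v w"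
proof -
  note d = free_group_div[OF g h uv]
  have on: "u \<in> free_carrier n" "v \<in> free_carrier n" "w \<in> free_carrier n"
    using g h free_carrier_append_D by blast+
  \<comment> \<open>Two empty legs would make g or h trivial, or g equal to h.\<close>
  consider "w = []" "u \<noteq> []" "v \<noteq> []" | "w \<noteq> []" "u = []" "v \<noteq> []" | "w \<noteq> []" "u \<noteq> []" "v = []"
    | "w \<noteq> []" "u \<noteq> []" "v \<noteq> []" using ne by auto
  then show ?thesis
    by cases (use on g h d in \<open>auto simp: R_def c'_def b_def c_inv mult_ac\<close>)
qed

text \<open>Pairs (g, h) embed injectively into triples of legs. As \<open>R\<close> is nonnegative,
  the sum may be enlarged to the full cube over the finite set L of occurring legs.\<close>

lemma sum_offdiagonal:
  assumes S: "finite S" "S \<subseteq> free_carrier n - {[]}"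
  shows "(\<Sum>g\<in>S. \<Sum>h\<in>S - {g}. c g * c (g \<otimes>\<^bsub>free_group n\<^esub> inv\<^bsub>free_group n\<^esub> h) * c h) \<le> 3 * s * \<alpha> + \<alpha> ^ 3"
proof -
  define t where "t p = c (fst p) * c (fst p \<otimes>\<^bsub>free_group n\<^esub> inv\<^bsub>free_group n\<^esub> snd p) * c (snd p)" for p
  define S2 where "S2 = Sigma S (\<lambda>g. S - {g})"
  have "\<forall>p. \<exists>q. fst p = fst q @ snd (snd q) \<and> snd p = fst (snd q) @ snd (snd q) \<and>
      (fst q = [] \<or> fst (snd q) = [] \<or> last (fst q) \<noteq> last (fst (snd q)))"
    for p :: "letter list \<times> letter list"
    using common_suffix by (metis fst_conv snd_conv)
  then obtain \<phi> :: "letter list \<times> letter list \<Rightarrow> letter list \<times> letter list \<times> letter list"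
    where \<phi>: "\<And>p. fst p = fst (\<phi> p) @ snd (snd (\<phi> p))" "\<And>p. snd p = fst (snd (\<phi> p)) @ snd (snd (\<phi> p))"
      "\<And>p. fst (\<phi> p) = [] \<or> fst (snd (\<phi> p)) = [] \<or> last (fst (\<phi> p)) \<noteq> last (fst (snd (\<phi> p)))"
    by metis
  define L where "L = (fst \<circ> \<phi>) ` S2 \<union> (fst \<circ> snd \<circ> \<phi>) ` S2 \<union> (snd \<circ> snd \<circ> \<phi>) ` S2"
  have fin: "finite S2" "finite L" using S by (auto simp: S2_def L_def)
  have inj: "inj_on \<phi> S2" by (metis \<phi>(1,2) inj_onI prod_eqI)
  have "(\<Sum>g\<in>S. \<Sum>h\<in>S - {g}. c g * c (g \<otimes>\<^bsub>free_group n\<^esub> inv\<^bsub>free_group n\<^esub> h) * c h) = (\<Sum>p\<in>S2. t p)"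
    unfolding S2_def t_def using S by (subst sum.Sigma) (auto simp: split_def)
  also have "\<dots> \<le> (\<Sum>p\<in>S2. R (fst (\<phi> p)) (fst (snd (\<phi> p))) (snd (snd (\<phi> p))))"
  proof (rule sum_mono)
    fix p assume "p \<in> S2"
    then have p: "fst p \<in> free_carrier n - {[]}" "snd p \<in> free_carrier n - {[]}" "fst p \<noteq> snd p"
      using S(2) by (auto simp: S2_def)
    show "t p \<le> R (fst (\<phi> p)) (fst (snd (\<phi> p))) (snd (snd (\<phi> p)))"
      unfolding t_def using p \<phi>(1)[of p] \<phi>(2)[of p] term_le_R[OF _ _ \<phi>(3)[of p]] by (metis DiffD1 DiffD2 singletonI)
  qed
  also have "\<dots> = (\<Sum>q\<in>\<phi> ` S2. R (fst q) (fst (snd q)) (snd (snd q)))"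
    by (subst sum.reindex[OF inj]) simp
  also have "\<dots> \<le> (\<Sum>q\<in>L \<times> L \<times> L. R (fst q) (fst (snd q)) (snd (snd q)))"
  proof (rule sum_mono2)
    have "\<phi> p \<in> L \<times> L \<times> L" if "p \<in> S2" for p
      using imageI[OF that, of "fst \<circ> \<phi>"] imageI[OF that, of "fst \<circ> snd \<circ> \<phi>"]
        imageI[OF that, of "snd \<circ> snd \<circ> \<phi>"]
      unfolding L_def mem_Times_iff comp_def by blast
    then show "\<phi> ` S2 \<subseteq> L \<times> L \<times> L" by blast
  qed (use fin in \<open>auto simp: R_nonneg\<close>)
  also have "\<dots> = (\<Sum>u\<in>L. \<Sum>v\<in>L. \<Sum>w\<in>L. R u v w)"
    by (simp add: sum.cartesian_product split_def)
  also have "\<dots> \<le> 3 * s * \<alpha> + \<alpha> ^ 3" by (rule sum_R[OF fin(2)])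
  finally show ?thesis .
qed

text \<open>The terms in which g, h or g h^-1 is trivial produce m^3 + 3 m s with m = c []; all
  others are off-diagonal.\<close>

theorem sum_convolution:
  assumes S: "finite S" "S \<subseteq> free_carrier n"
  shows "(\<Sum>g\<in>S. \<Sum>h\<in>S. c g * c (g \<otimes>\<^bsub>free_group n\<^esub> inv\<^bsub>free_group n\<^esub> h) * c h)
    \<le> (c [])^3 + 3 * c [] * s + 3 * s * \<alpha> + \<alpha> ^ 3"
proof -
  interpret group "free_group n" by (rule group_free_group)
  let ?t = "\<lambda>g h. c g * c (g \<otimes>\<^bsub>free_group n\<^esub> inv\<^bsub>free_group n\<^esub> h) * c h"
  define S0 where "S0 = S - {[]}"
  have S0: "finite S0" "S0 \<subseteq> free_carrier n - {[]}" using S by (auto simp: S0_def)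
  have e: "[] \<in> free_carrier n" using one_closed by simp
  have t0: "0 \<le> ?t g h" for g h by (simp add: c_nonneg)
  have te: "?t [] h = c [] * (c h)\<^sup>2" if "h \<in> free_carrier n" for h
  proof -
    have "[] \<otimes>\<^bsub>free_group n\<^esub> inv\<^bsub>free_group n\<^esub> h = word_inv h"
      using l_one[of "inv\<^bsub>free_group n\<^esub> h"] that by (simp add: free_inv word_inv_carrier)
    then show ?thesis using that by (simp add: c_inv power2_eq_square)
  qed
  have te': "?t g [] = c [] * (c g)\<^sup>2" if "g \<in> free_carrier n" for g
  proof -
    have "g \<otimes>\<^bsub>free_group n\<^esub> inv\<^bsub>free_group n\<^esub> [] = g"
      using r_one[OF that] inv_one by simp
    then show ?thesis by (simp add: power2_eq_square mult_ac)
  qed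
  have td: "?t g g = c [] * (c g)\<^sup>2" if "g \<in> free_carrier n" for g
    using r_inv[OF that] by (simp add: power2_eq_square mult_ac)
  have sub: "S \<subseteq> insert [] S0" by (auto simp: S0_def)
  have ins: "(\<Sum>h\<in>insert [] S0. f h) = f [] + (\<Sum>h\<in>S0. f h)" for f :: "letter list \<Rightarrow> real"
    using S0 by (subst sum.insert) auto
  have "(\<Sum>g\<in>S. \<Sum>h\<in>S. ?t g h) \<le> (\<Sum>g\<in>insert [] S0. \<Sum>h\<in>insert [] S0. ?t g h)"
    by (rule order_trans[OF sum_mono sum_mono2]) (use S0 sub t0 in \<open>auto intro!: sum_mono2 sum_nonneg\<close>)
  also have "\<dots> = ?t [] [] + (\<Sum>h\<in>S0. ?t [] h) + ((\<Sum>g\<in>S0. ?t g []) + (\<Sum>g\<in>S0. \<Sum>h\<in>S0. ?t g h))"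
    by (simp only: ins sum.distrib)
  also have "(\<Sum>g\<in>S0. \<Sum>h\<in>S0. ?t g h) = (\<Sum>g\<in>S0. ?t g g + (\<Sum>h\<in>S0 - {g}. ?t g h))"
    by (rule sum.cong[OF refl], rule sum.remove[OF S0(1)])
  also have "\<dots> = (\<Sum>g\<in>S0. ?t g g) + (\<Sum>g\<in>S0. \<Sum>h\<in>S0 - {g}. ?t g h)" by (rule sum.distrib)
  finally have "(\<Sum>g\<in>S. \<Sum>h\<in>S. ?t g h) \<le> ?t [] [] + (\<Sum>h\<in>S0. ?t [] h) + ((\<Sum>g\<in>S0. ?t g []) +
      ((\<Sum>g\<in>S0. ?t g g) + (\<Sum>g\<in>S0. \<Sum>h\<in>S0 - {g}. ?t g h)))" .
  moreover have "?t [] [] = (c [])^3" unfolding te[OF e] by (simp add: power2_eq_square power3_eq_cube)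
  moreover have sq: "(\<Sum>g\<in>S0. c [] * (c g)\<^sup>2) \<le> c [] * s"
    unfolding sum_distrib_left[symmetric] by (intro mult_left_mono c_s S0 c_nonneg)
  moreover have "(\<Sum>h\<in>S0. ?t [] h) = (\<Sum>g\<in>S0. c [] * (c g)\<^sup>2)"
    by (rule sum.cong[OF refl te]) (use S0 in auto)
  moreover have "(\<Sum>g\<in>S0. ?t g []) = (\<Sum>g\<in>S0. c [] * (c g)\<^sup>2)"
    by (rule sum.cong[OF refl te']) (use S0 in auto)
  moreover have "(\<Sum>g\<in>S0. ?t g g) = (\<Sum>g\<in>S0. c [] * (c g)\<^sup>2)"
    by (rule sum.cong[OF refl td]) (use S0 in auto)
  ultimately show ?thesis using sum_offdiagonal[OF S0] by linarith
qed

end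

section \<open>The entropy estimate\<close>

text \<open>The right side minus the left has derivative 2 (t - 1)^3 / (3 t^3), hence its minimum,
  zero, at 1. The right side is the cubic Taylor polynomial of w^2 ln (w^2) at 1, divided by
  w^2.\<close>

lemma ln_cubic_bound:
  fixes w :: real
  assumes w: "0 < w"
  shows "2 * ln w \<le> 1 / (3 * w\<^sup>2) - 2 / w + 1 + 2 / 3 * w"
proof -
  define h where "h t = 1 / (3 * t\<^sup>2) - 2 / t + 1 + 2 / 3 * t - 2 * ln t" for t :: real
  have der: "(h has_real_derivative 2 * (t - 1) ^ 3 / (3 * t ^ 3)) (at t)" if "0 < t" for t
  proof -
    have "(h has_real_derivative - (2 / (3 * t ^ 3)) + 2 / t\<^sup>2 + 2 / 3 - 2 / t) (at t)"
      unfolding h_def[abs_def] using that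
      by (auto intro!: derivative_eq_intros simp: field_simps power2_eq_square power3_eq_cube)
    moreover have "- (2 / (3 * t ^ 3)) + 2 / t\<^sup>2 + 2 / 3 - 2 / t = 2 * (t - 1) ^ 3 / (3 * t ^ 3)"
      using that by (simp add: field_simps power2_eq_square power3_eq_cube)
    ultimately show ?thesis by simp
  qed
  have "h 1 \<le> h w"
  proof (cases "1 \<le> w")
    case True
    show ?thesis
    proof (rule DERIV_nonneg_imp_nondecreasing[OF True])
      fix t :: real assume "1 \<le> t" "t \<le> w"
      then show "\<exists>y. (h has_real_derivative y) (at t) \<and> 0 \<le> y"
        using der[of t] by (intro exI[of _ "2 * (t - 1) ^ 3 / (3 * t ^ 3)"]) simp
    qed
  next
    case False
    show ?thesis
    proof (rule DERIV_nonpos_imp_nonincreasing[of w 1])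
      fix t :: real assume t: "w \<le> t" "t \<le> 1"
      then have "0 < t" using w by simp
      have "(t - 1) ^ 3 \<le> 0" using t by (simp add: power3_eq_cube mult_nonneg_nonpos mult_nonpos_nonpos)
      then show "\<exists>y. (h has_real_derivative y) (at t) \<and> y \<le> 0"
        using der[OF \<open>0 < t\<close>] \<open>0 < t\<close>
        by (intro exI[of _ "2 * (t - 1) ^ 3 / (3 * t ^ 3)"]) (simp add: divide_nonpos_pos)
    qed (use False in simp)
  qed
  then show ?thesis by (simp add: h_def)
qed

text \<open>Since the fourth derivative of \<open>u\<^sup>2 ln u\<^sup>2\<close> is negative, its cubic Taylor polynomial at \<open>\<kappa>\<close> is an upper bound.\<close>

lemma entropy_cubic_bound:
  fixes u :: real
  assumes u: "0 \<le> u" and \<kappa>: "0 < \<kappa>"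
  shows "u\<^sup>2 * ln (u\<^sup>2) \<le> u\<^sup>2 * ln (\<kappa>\<^sup>2) + \<kappa>\<^sup>2 / 3 - 2 * \<kappa> * u + u\<^sup>2 + 2 / (3 * \<kappa>) * u ^ 3"
proof (cases "u = 0")
  case False
  then have u: "0 < u" using u by simp
  define w where "w = u / \<kappa>"
  have w: "0 < w" "u = \<kappa> * w" using u \<kappa> by (simp_all add: w_def)
  have "ln (u\<^sup>2) = ln (\<kappa>\<^sup>2) + 2 * ln w"
    using w \<kappa> by (simp add: power_mult_distrib ln_mult ln_realpow)
  then have "u\<^sup>2 * ln (u\<^sup>2) = u\<^sup>2 * ln (\<kappa>\<^sup>2) + u\<^sup>2 * (2 * ln w)" by (simp add: algebra_simps)
  also have "\<dots> \<le> u\<^sup>2 * ln (\<kappa>\<^sup>2) + u\<^sup>2 * (1 / (3 * w\<^sup>2) - 2 / w + 1 + 2 / 3 * w)"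
    by (intro add_left_mono mult_left_mono ln_cubic_bound w) simp
  also have "u\<^sup>2 * (1 / (3 * w\<^sup>2) - 2 / w + 1 + 2 / 3 * w) = \<kappa>\<^sup>2 / 3 - 2 * \<kappa> * u + u\<^sup>2 + 2 / (3 * \<kappa>) * u ^ 3"
    using w(1) \<kappa> unfolding w(2) by (simp add: field_simps power2_eq_square power3_eq_cube)
  finally show ?thesis by simp
qed simp

text \<open>Supplies the lower half of the domination of u^2 ln (u^2); the cubic at \<kappa> = 1
  supplies the upper half.\<close>

lemma mult_ln_lower:
  fixes t :: real
  assumes "0 \<le> t"
  shows "- 1 \<le> t * ln t"
proof (cases "t = 0")
  case False
  then have t: "0 < t" using assms by simp
  have "- ln t = ln (1 / t)" using t by (simp add: ln_div)
  also have "\<dots> \<le> 1 / t - 1" using t by (intro ln_le_minus_one) simp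
  finally have "t * (- ln t) \<le> t * (1 / t - 1)" using t by (intro mult_left_mono) auto
  also have "\<dots> = 1 - t" using t by (simp add: field_simps)
  finally show ?thesis using t by simp
qed simp

text \<open>The choice \<open>\<kappa> = m + \<alpha>\<close> makes the cubic bound collapse to \<open>N ln (\<kappa>\<^sup>2 / N) \<le> \<kappa>\<^sup>2 - N\<close>.\<close>

lemma entropy_algebra:
  fixes m s \<alpha> :: real
  assumes "0 \<le> m" "0 \<le> s" "0 \<le> \<alpha>" and \<kappa>: "0 < m + \<alpha>" and N: "N = m\<^sup>2 + s"
  shows "N * ln ((m + \<alpha>)\<^sup>2) + (m + \<alpha>)\<^sup>2 / 3 - 2 * (m + \<alpha>) * m + N
      + 2 / (3 * (m + \<alpha>)) * (m ^ 3 + 3 * m * s + 3 * s * \<alpha> + \<alpha> ^ 3) \<le> N * ln N + 2 * (s + \<alpha>\<^sup>2)"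
proof -
  define \<kappa> where "\<kappa> = m + \<alpha>"
  have \<kappa>0: "0 < \<kappa>" using \<kappa> by (simp add: \<kappa>_def)
  have "0 \<le> N" using assms by simp
  have "N * ln (\<kappa>\<^sup>2) - N * ln N \<le> \<kappa>\<^sup>2 - N"
  proof (cases "N = 0")
    case False
    then have "0 < N" using \<open>0 \<le> N\<close> by simp
    then have "N * (ln (\<kappa>\<^sup>2) - ln N) \<le> N * (\<kappa>\<^sup>2 / N - 1)"
      using ln_le_minus_one[of "\<kappa>\<^sup>2 / N"] \<kappa>0 by (intro mult_left_mono) (simp_all add: ln_div)
    then show ?thesis using \<open>0 < N\<close> by (simp add: right_diff_distrib)
  qed simp
  \<comment> \<open>Divisibility by \<kappa> removes the denominator, after which everything is
    quadratic in m and \<alpha> and linear in s.\<close>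
  moreover have "m ^ 3 + 3 * m * s + 3 * s * \<alpha> + \<alpha> ^ 3 = \<kappa> * (m\<^sup>2 - m * \<alpha> + \<alpha>\<^sup>2 + 3 * s)"
    by (simp add: \<kappa>_def power2_eq_square power3_eq_cube algebra_simps)
  then have "2 / (3 * \<kappa>) * (m ^ 3 + 3 * m * s + 3 * s * \<alpha> + \<alpha> ^ 3) = 2 / 3 * (m\<^sup>2 - m * \<alpha> + \<alpha>\<^sup>2 + 3 * s)"
    using \<kappa>0 by simp
  moreover have "\<kappa>\<^sup>2 / 3 - 2 * \<kappa> * m + N + 2 / 3 * (m\<^sup>2 - m * \<alpha> + \<alpha>\<^sup>2 + 3 * s) - 2 * (s + \<alpha>\<^sup>2) = N - \<kappa>\<^sup>2"
    unfolding \<kappa>_def N by (simp add: power2_eq_square field_simps)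
  ultimately show ?thesis unfolding \<kappa>_def[symmetric] by linarith
qed

lemma entropy_integral_bound:
  fixes M :: "real measure" and m s \<alpha> :: real
  assumes M: "finite_measure M" "sets M = sets borel" "measure M UNIV = 1" and pos: "AE u in M. 0 \<le> u"
    and i1: "integrable M (\<lambda>u. u)" "(\<integral>u. u \<partial>M) = m"
    and i2: "integrable M (\<lambda>u. u\<^sup>2)" "(\<integral>u. u\<^sup>2 \<partial>M) = m\<^sup>2 + s"
    and i3: "(\<integral>\<^sup>+u. ennreal (u ^ 3) \<partial>M) \<le> ennreal (m ^ 3 + 3 * m * s + 3 * s * \<alpha> + \<alpha> ^ 3)"
    and nonneg: "0 \<le> s" "0 \<le> \<alpha>"
  shows "integrable M (\<lambda>u. u\<^sup>2 * ln (u\<^sup>2))"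
    and "(\<integral>u. u\<^sup>2 * ln (u\<^sup>2) \<partial>M) \<le> (m\<^sup>2 + s) * ln (m\<^sup>2 + s) + 2 * (s + \<alpha>\<^sup>2)"
proof -
  interpret finite_measure M by fact
  have [measurable_cong]: "sets M = sets borel" by fact
  define C where "C = m ^ 3 + 3 * m * s + 3 * s * \<alpha> + \<alpha> ^ 3"
  have m: "0 \<le> m" unfolding i1(2)[symmetric] by (rule integral_nonneg_AE[OF pos])
  have C: "0 \<le> C" using m nonneg by (simp add: C_def)
  have i3': "integrable M (\<lambda>u. u ^ 3)" and int3: "(\<integral>u. u ^ 3 \<partial>M) \<le> C"
  proof -
    have "(\<integral>\<^sup>+u. ennreal (norm (u ^ 3)) \<partial>M) = (\<integral>\<^sup>+u. ennreal (u ^ 3) \<partial>M)"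
      by (rule nn_integral_cong_AE) (use pos in eventually_elim, simp)
    also have "\<dots> < \<infinity>" by (rule order_le_less_trans[OF i3]) simp
    finally show int: "integrable M (\<lambda>u. u ^ 3)" by (intro integrableI_bounded) simp_all
    have "AE u in M. 0 \<le> u ^ 3" using pos by eventually_elim simp
    then have "ennreal (\<integral>u. u ^ 3 \<partial>M) \<le> ennreal C"
      using i3 nn_integral_eq_integral[OF int] by (simp add: C_def)
    then show "(\<integral>u. u ^ 3 \<partial>M) \<le> C" using C by (simp add: ennreal_le_iff)
  qed
  let ?p = "\<lambda>\<kappa> u. u\<^sup>2 * ln (\<kappa>\<^sup>2) + \<kappa>\<^sup>2 / 3 - 2 * \<kappa> * u + u\<^sup>2 + 2 / (3 * \<kappa>) * u ^ 3"
  have ip: "integrable M (?p \<kappa>)" for \<kappa>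
    using i1(1) i2(1) i3' by (auto intro!: Bochner_Integration.integrable_add Bochner_Integration.integrable_diff)
  show int: "integrable M (\<lambda>u. u\<^sup>2 * ln (u\<^sup>2))"
  proof (rule Bochner_Integration.integrable_bound)
    show "integrable M (\<lambda>u. 1 + \<bar>?p 1 u\<bar>)" by (intro Bochner_Integration.integrable_add integrable_abs ip) simp
    show "AE u in M. norm (u\<^sup>2 * ln (u\<^sup>2)) \<le> norm (1 + \<bar>?p 1 u\<bar>)"
      using pos
    proof eventually_elim
      case (elim u)
      show ?case using entropy_cubic_bound[OF elim, of 1] mult_ln_lower[of "u\<^sup>2"] by auto
    qed
  qed simp
  show "(\<integral>u. u\<^sup>2 * ln (u\<^sup>2) \<partial>M) \<le> (m\<^sup>2 + s) * ln (m\<^sup>2 + s) + 2 * (s + \<alpha>\<^sup>2)"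
  \<comment> \<open>If the mean vanishes, \<kappa> could be 0, but then u is zero almost
    everywhere.\<close>
  proof (cases "m = 0")
    case True
    then have "AE u in M. u = 0" using integral_nonneg_eq_0_iff_AE[OF i1(1) pos] i1(2) by simp
    then have "AE u in M. u\<^sup>2 = 0" "AE u in M. u\<^sup>2 * ln (u\<^sup>2) = 0" by (eventually_elim, simp)+
    then have "(\<integral>u. u\<^sup>2 \<partial>M) = 0" "(\<integral>u. u\<^sup>2 * ln (u\<^sup>2) \<partial>M) = 0" by (auto intro!: integral_eq_zero_AE)
    then show ?thesis using i2(2) True nonneg by simp
  next
    case False
    define \<kappa> where "\<kappa> = m + \<alpha>"
    have \<kappa>: "0 < \<kappa>" using False m nonneg by (simp add: \<kappa>_def)
    have "(\<integral>u. u\<^sup>2 * ln (u\<^sup>2) \<partial>M) \<le> (\<integral>u. ?p \<kappa> u \<partial>M)"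
      by (rule integral_mono_AE[OF int ip]) (use pos in eventually_elim, rule entropy_cubic_bound, use \<kappa> in auto)
    also have "\<dots> = (m\<^sup>2 + s) * ln (\<kappa>\<^sup>2) + \<kappa>\<^sup>2 / 3 - 2 * \<kappa> * m + (m\<^sup>2 + s) + 2 / (3 * \<kappa>) * (\<integral>u. u ^ 3 \<partial>M)"
      using i1 i2 i3' M(3) sets_eq_imp_space_eq[OF M(2)] by simp
    also have "\<dots> \<le> (m\<^sup>2 + s) * ln (\<kappa>\<^sup>2) + \<kappa>\<^sup>2 / 3 - 2 * \<kappa> * m + (m\<^sup>2 + s) + 2 / (3 * \<kappa>) * C"
      using int3 \<kappa> by (intro add_left_mono mult_left_mono) auto
    also have "\<dots> \<le> (m\<^sup>2 + s) * ln (m\<^sup>2 + s) + 2 * (s + \<alpha>\<^sup>2)"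
      unfolding C_def \<kappa>_def by (rule entropy_algebra) (use m nonneg \<kappa> in \<open>auto simp: \<kappa>_def\<close>)
    finally show ?thesis .
  qed
qed

section \<open>Lower semicontinuity of the quadratic form\<close>

context positive_operator
begin

lemma M_Q: "C \<in> sets borel \<Longrightarrow> M (Q C \<xi>) = density (M \<xi>) (indicator C)"
  by (intro density_indicator_eqI finite_measure_M) (simp_all add: norm_Q[symmetric] Q_Int)

lemma nn_integral_M_Q:
  assumes "C \<in> sets borel" "f \<in> borel_measurable borel"
  shows "(\<integral>\<^sup>+u. f u \<partial>M (Q C \<xi>)) = (\<integral>\<^sup>+u. f u * indicator C u \<partial>M \<xi>)"
  unfolding M_Q[OF assms(1)] using assms by (subst nn_integral_density) (auto simp: mult.commute)

text \<open>Below the spectral level r the operator is bounded by r, so its truncated form is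
  continuous in norm.\<close>

lemma X_cut:
  assumes on: "\<xi> \<in> l2_on I" and r: "0 \<le> r"
  shows "\<exists>\<eta>. X (Q {0..r} \<xi>) \<eta> \<and> norm \<eta> \<le> r * norm \<xi>"
proof -
  interpret finite_measure "M \<xi>" by (rule finite_measure_M)
  have "(\<integral>\<^sup>+u. ennreal (u\<^sup>2) \<partial>M (Q {0..r} \<xi>)) = (\<integral>\<^sup>+u. ennreal (u\<^sup>2) * indicator {0..r} u \<partial>M \<xi>)"
    by (rule nn_integral_M_Q) simp_all
  also have "\<dots> \<le> (\<integral>\<^sup>+u. ennreal (r\<^sup>2) \<partial>M \<xi>)"
    by (rule nn_integral_mono) (auto simp: indicator_def intro!: ennreal_leI power_mono)
  also have "\<dots> = ennreal ((r * norm \<xi>)\<^sup>2)"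
    by (simp add: emeasure_eq_measure measure_M_UNIV power_mult_distrib ennreal_mult)
  finally have le: "(\<integral>\<^sup>+u. ennreal (u\<^sup>2) \<partial>M (Q {0..r} \<xi>)) \<le> ennreal ((r * norm \<xi>)\<^sup>2)" .
  have "(\<integral>\<^sup>+u. ennreal (u\<^sup>2) \<partial>M (Q {0..r} \<xi>)) < \<infinity>" by (rule order_le_less_trans[OF le]) simp
  moreover have "Q {0..r} \<xi> \<in> l2_on I" by (rule Q_on[OF _ on]) simp
  ultimately obtain \<eta> where X: "X (Q {0..r} \<xi>) \<eta>" using X_domain by blast
  have "ennreal ((norm \<eta>)\<^sup>2) \<le> ennreal ((r * norm \<xi>)\<^sup>2)" unfolding X_norm[OF X] by (rule le)
  then have "(norm \<eta>)\<^sup>2 \<le> (r * norm \<xi>)\<^sup>2" by (simp add: ennreal_le_iff)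
  then have "norm \<eta> \<le> r * norm \<xi>" by (rule power2_le_imp_le) (use r in simp)
  with X show ?thesis by blast
qed

lemma inner_cut:
  assumes X: "X (Q {0..r} \<xi>) \<eta>"
  shows "ennreal (inner (Q {0..r} \<xi>) \<eta>) = (\<integral>\<^sup>+u. ennreal u * indicator {0..r} u \<partial>M \<xi>)"
proof -
  have "ennreal (inner (Q {0..r} \<xi>) \<eta>) = (\<integral>\<^sup>+u. ennreal u \<partial>M (Q {0..r} \<xi>))"
    unfolding X_inner(2)[OF X] by (rule nn_integral_eq_integral[symmetric, OF X_inner(1)[OF X] AE_M_nonneg[OF X_on(1)[OF X]]])
  also have "\<dots> = (\<integral>\<^sup>+u. ennreal u * indicator {0..r} u \<partial>M \<xi>)" by (rule nn_integral_M_Q) simp_all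
  finally show ?thesis .
qed

text \<open>The form truncated at level r is norm continuous and lies below the full form, so the
  bound C passes to \<xi>. Monotone convergence in r then removes the truncation; \<xi> may lie
  outside the domain of x.\<close>

lemma form_lsc:
  assumes on: "\<xi> \<in> l2_on I" and C: "0 \<le> C"
    and approx: "\<And>\<epsilon>. 0 < \<epsilon> \<Longrightarrow> \<exists>\<xi>' \<eta>'. X \<xi>' \<eta>' \<and> norm (\<xi>' - \<xi>) < \<epsilon> \<and> inner \<xi>' \<eta>' \<le> C"
  shows "(\<integral>\<^sup>+u. ennreal u \<partial>M \<xi>) \<le> ennreal C"
proof -
  have cut: "(\<integral>\<^sup>+u. ennreal u * indicator {0..r} u \<partial>M \<xi>) \<le> ennreal C" if r: "0 \<le> r" for r
  proof -
    interpret Q: bounded_linear "Q {0..r}" by (rule bounded_linear_Q) simp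
    have "\<forall>k. \<exists>\<xi>' \<eta>'. X \<xi>' \<eta>' \<and> norm (\<xi>' - \<xi>) < 1 / real (Suc k) \<and> inner \<xi>' \<eta>' \<le> C"
      using approx by simp
    then obtain z y where zy: "\<And>k. X (z k) (y k)" "\<And>k. norm (z k - \<xi>) < 1 / real (Suc k)" "\<And>k. inner (z k) (y k) \<le> C"
      by metis
    have "\<forall>k. \<exists>v. X (Q {0..r} (z k)) v" using X_cut[OF X_on(1)[OF zy(1)] r] by blast
    then obtain v where v: "\<And>k. X (Q {0..r} (z k)) (v k)" by metis
    obtain w where w: "X (Q {0..r} \<xi>) w" using X_cut[OF on r] by blast
    have vw: "norm (v k - w) \<le> r * norm (z k - \<xi>)" for k
    proof -
      have "X (Q {0..r} (z k - \<xi>)) (v k - w)" unfolding Q.diff by (rule X_diff[OF v w])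
      moreover obtain v' where "X (Q {0..r} (z k - \<xi>)) v'" "norm v' \<le> r * norm (z k - \<xi>)"
        using X_cut[OF subspace_diff[OF subspace_l2_on X_on(1)[OF zy(1)] on] r] by blast
      ultimately show ?thesis using X_unique by metis
    qed
    have lim0: "(\<lambda>k. norm (z k - \<xi>)) \<longlonglongrightarrow> 0"
      by (rule Lim_null_comparison[OF always_eventually LIMSEQ_Suc[OF lim_1_over_n]])
        (use zy(2) in \<open>auto intro: less_imp_le\<close>)
    then have z: "z \<longlonglongrightarrow> \<xi>" by (rule Lim_null[THEN iffD2, OF tendsto_norm_zero_cancel])
    have "(\<lambda>k. r * norm (z k - \<xi>)) \<longlonglongrightarrow> r * 0" by (rule tendsto_mult_left[OF lim0])
    then have "(\<lambda>k. r * norm (z k - \<xi>)) \<longlonglongrightarrow> 0" by simp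
    then have "(\<lambda>k. v k - w) \<longlonglongrightarrow> 0"
      by (rule Lim_null_comparison[OF always_eventually, rotated]) (use vw in blast)
    then have "v \<longlonglongrightarrow> w" by (rule Lim_null[THEN iffD2])
    then have "(\<lambda>k. inner (Q {0..r} (z k)) (v k)) \<longlonglongrightarrow> inner (Q {0..r} \<xi>) w"
      by (rule tendsto_inner[OF Q.tendsto[OF z]])
    moreover have "inner (Q {0..r} (z k)) (v k) \<le> C" for k
    proof -
      have "ennreal (inner (Q {0..r} (z k)) (v k)) = (\<integral>\<^sup>+u. ennreal u * indicator {0..r} u \<partial>M (z k))"
        by (rule inner_cut[OF v])
      also have "\<dots> \<le> (\<integral>\<^sup>+u. ennreal u \<partial>M (z k))"
        by (rule nn_integral_mono) (simp add: indicator_def)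
      also have "\<dots> = ennreal (inner (z k) (y k))"
        unfolding X_inner(2)[OF zy(1)]
        by (rule nn_integral_eq_integral[OF X_inner(1)[OF zy(1)] AE_M_nonneg[OF X_on(1)[OF zy(1)]]])
      also have "\<dots> \<le> ennreal C" by (rule ennreal_leI[OF zy(3)])
      finally show ?thesis using C by (simp add: ennreal_le_iff)
    qed
    ultimately have "inner (Q {0..r} \<xi>) w \<le> C"
      by (intro tendsto_upperbound[of "\<lambda>k. inner (Q {0..r} (z k)) (v k)" _ sequentially]) auto
    then show ?thesis unfolding inner_cut[OF w, symmetric] by (rule ennreal_leI)
  qed
  have "(\<integral>\<^sup>+u. ennreal u \<partial>M \<xi>) = (\<integral>\<^sup>+u. (SUP k::nat. ennreal u * indicator {0..real k} u) \<partial>M \<xi>)"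
  proof (rule nn_integral_cong)
    fix u :: real
    show "ennreal u = (SUP k::nat. ennreal u * indicator {0..real k} u)"
    proof (cases "0 \<le> u")
      case True
      obtain k where k: "u \<le> real k" using real_arch_simple by blast
      show ?thesis
      proof (rule antisym)
        show "ennreal u \<le> (SUP k::nat. ennreal u * indicator {0..real k} u)"
          by (rule SUP_upper2[of k]) (use k True in auto)
        show "(SUP k::nat. ennreal u * indicator {0..real k} u) \<le> ennreal u"
          by (rule SUP_least) (simp add: indicator_def)
      qed
    qed (simp add: ennreal_neg)
  qed
  also have "\<dots> = (SUP k::nat. \<integral>\<^sup>+u. ennreal u * indicator {0..real k} u \<partial>M \<xi>)"
    by (rule nn_integral_monotone_convergence_SUP)
      (auto simp: incseq_def le_fun_def indicator_def)
  also have "\<dots> \<le> ennreal C" by (rule SUP_least) (rule cut, simp)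
  finally show ?thesis .
qed

end

section \<open>Translations on \<open>\<ell>\<^sub>2(G)\<close>\<close>

lemma coord_delta: "g \<in> I \<Longrightarrow> \<exists>\<xi>\<in>l2_on I. coord \<xi> = delta g"
  by (metis delta_in_ell2 ell2_coordE)

definition unit_vec :: "'g \<Rightarrow> 'g l2" where
  "unit_vec g = (SOME \<xi>. coord \<xi> = delta g)"

lemma coord_unit_vec [simp]: "coord (unit_vec g) = delta g"
  unfolding unit_vec_def using coord_delta[of g UNIV] by (metis (mono_tags) UNIV_I someI_ex)

lemma unit_vec_on: "g \<in> I \<Longrightarrow> unit_vec g \<in> l2_on I"
  by (auto simp: l2_on_def delta_def)

lemma cip_delta: "cip (delta g) f = f g"
proof -
  have "cip (delta g) f = (\<Sum>\<^sub>\<infinity>i\<in>{g}. cnj (delta g i) * f i)"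
    unfolding cip_def by (rule infsum_cong_neutral) (auto simp: delta_def)
  then show ?thesis by (simp add: delta_def)
qed

lemma cip_delta_right: "cip f (delta g) = cnj (f g)"
proof -
  have "cip f (delta g) = (\<Sum>\<^sub>\<infinity>i\<in>{g}. cnj (f i) * delta g i)"
    unfolding cip_def by (rule infsum_cong_neutral) (auto simp: delta_def)
  then show ?thesis by (simp add: delta_def)
qed

lemma norm_unit_vec: "norm (unit_vec g) = 1"
proof -
  have "(norm (unit_vec g))\<^sup>2 = Re (cip (delta g) (delta g))"
    by (simp add: power2_norm_eq_inner inner_l2_def)
  also have "\<dots> = 1" by (simp only: cip_delta) (simp add: delta_def)
  finally show ?thesis by (simp add: power2_eq_1_iff) (metis norm_ge_zero not_one_le_zero le_minus_one_simps(3))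
qed

lemma coord_sum: "coord (\<Sum>g\<in>S. f g) i = (\<Sum>g\<in>S. coord (f g) i)"
  by (induction S rule: infinite_finite_induct) (simp_all add: zero_l2.rep_eq plus_l2.rep_eq)

lemma restr_finite:
  assumes "finite S"
  shows "restr S \<xi> = (\<Sum>g\<in>S. scaleC (coord \<xi> g) (unit_vec g))"
proof (rule l2_eqI)
  fix i
  have "(\<Sum>g\<in>S. coord \<xi> g * delta g i) = (\<Sum>g\<in>S. if g = i then coord \<xi> i else 0)"
    by (rule sum.cong) (auto simp: delta_def)
  then show "coord (restr S \<xi>) i = coord (\<Sum>g\<in>S. scaleC (coord \<xi> g) (unit_vec g)) i"
    using assms by (simp add: coord_sum scaleC.rep_eq restr.rep_eq sum.delta)
qed

lemma restr_approx:
  assumes on: "\<xi> \<in> l2_on I" and \<epsilon>: "0 < \<epsilon>"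
  obtains S where "finite S" "S \<subseteq> I" "norm (restr S \<xi> - \<xi>) < \<epsilon>"
proof -
  let ?f = "\<lambda>i. (cmod (coord \<xi> i))\<^sup>2"
  have "(sum ?f \<longlongrightarrow> (\<Sum>\<^sub>\<infinity>i. ?f i)) (finite_subsets_at_top UNIV)"
    by (rule infsum_tendsto[OF coord_summable])
  then have "eventually (\<lambda>S. dist (sum ?f S) ((norm \<xi>)\<^sup>2) < \<epsilon>\<^sup>2) (finite_subsets_at_top UNIV)"
    unfolding norm_l2_power2 using \<epsilon> by (intro tendstoD) simp_all
  then obtain S0 where S0: "finite S0" "dist (sum ?f S0) ((norm \<xi>)\<^sup>2) < \<epsilon>\<^sup>2"
    by (auto simp: eventually_finite_subsets_at_top)
  define S where "S = S0 \<inter> I"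
  have S: "finite S" "S \<subseteq> I" using S0 by (auto simp: S_def)
  have "sum ?f S = sum ?f S0"
    using S0(1) on by (intro sum.mono_neutral_left) (auto simp: S_def l2_on_def)
  then have "(norm \<xi>)\<^sup>2 - sum ?f S < \<epsilon>\<^sup>2" using S0(2) by (simp add: dist_real_def)
  moreover have "sum ?f S \<le> (norm (restr S \<xi>))\<^sup>2"
    using sum_coord_le_norm[OF S(1), of "restr S \<xi>"] by (simp add: restr.rep_eq cong: sum.cong)
  moreover have "(norm (restr S \<xi> - \<xi>))\<^sup>2 = (norm \<xi>)\<^sup>2 - (norm (restr S \<xi>))\<^sup>2"
  proof -
    have "inner \<xi> (restr S \<xi>) = inner (restr S \<xi>) (restr S \<xi>)"
      by (simp add: restr_sym restr_id[OF restr_l2_on])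
    then show ?thesis
      by (simp add: power2_norm_eq_inner inner_diff_left inner_diff_right inner_commute[of "restr S \<xi>" \<xi>])
  qed
  ultimately have "(norm (restr S \<xi> - \<xi>))\<^sup>2 < \<epsilon>\<^sup>2" by linarith
  then have "norm (restr S \<xi> - \<xi>) < \<epsilon>" by (rule power2_less_imp_less) (use \<epsilon> in simp)
  then show ?thesis using that S by blast
qed

lemma enn2ereal_diff_integral:
  fixes f :: "'a \<Rightarrow> real"
  assumes f: "integrable M f"
  shows "enn2ereal (\<integral>\<^sup>+t. ennreal (f t) \<partial>M) - enn2ereal (\<integral>\<^sup>+t. ennreal (- f t) \<partial>M) = ereal (\<integral>t. f t \<partial>M)"
proof -
  have fin: "(\<integral>\<^sup>+t. ennreal (f t) \<partial>M) \<noteq> \<infinity>" "(\<integral>\<^sup>+t. ennreal (- f t) \<partial>M) \<noteq> \<infinity>"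
    using f by (simp_all add: real_integrable_def)
  have *: "enn2ereal a = ereal (enn2real a)" if "a \<noteq> \<infinity>" for a
    using that by (cases a) (simp_all add: enn2ereal_ennreal)
  show ?thesis using fin by (simp add: * real_lebesgue_integral_def[OF f])
qed

text \<open>These are the unitaries through which affiliation is exploited. The guard keeps the
  image square summable for arbitrary G and h.\<close>

lift_definition right_translation :: "('g, 'm) monoid_scheme \<Rightarrow> 'g \<Rightarrow> 'g l2 \<Rightarrow> 'g l2" is
  "\<lambda>G h f k. if group G \<and> h \<in> carrier G \<and> k \<in> carrier G then f (k \<otimes>\<^bsub>G\<^esub> inv\<^bsub>G\<^esub> h) else 0"
proof -
  fix G :: "('g, 'm) monoid_scheme" and h and f :: "'g \<Rightarrow> complex"
  assume f: "(\<lambda>i. (cmod (f i))\<^sup>2) summable_on UNIV"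
  show "(\<lambda>k. (cmod (if group G \<and> h \<in> carrier G \<and> k \<in> carrier G then f (k \<otimes>\<^bsub>G\<^esub> inv\<^bsub>G\<^esub> h) else 0))\<^sup>2) summable_on UNIV"
  proof (cases "group G \<and> h \<in> carrier G")
    case True
    then interpret group G by blast
    have inj: "inj_on (\<lambda>k. k \<otimes>\<^bsub>G\<^esub> inv\<^bsub>G\<^esub> h) (carrier G)" using True by (auto simp: inj_on_def)
    have "(\<lambda>i. (cmod (f i))\<^sup>2) summable_on (\<lambda>k. k \<otimes>\<^bsub>G\<^esub> inv\<^bsub>G\<^esub> h) ` carrier G"
      by (rule summable_on_subset_banach[OF f]) simp
    then have "(\<lambda>k. (cmod (f (k \<otimes>\<^bsub>G\<^esub> inv\<^bsub>G\<^esub> h)))\<^sup>2) summable_on carrier G"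
      by (simp add: summable_on_reindex[OF inj] comp_def)
    then show ?thesis
      by (rule summable_on_cong_neutral[THEN iffD1, rotated -1]) (use True in auto)
  next
    case False
    then have "(if group G \<and> h \<in> carrier G \<and> k \<in> carrier G then f (k \<otimes>\<^bsub>G\<^esub> inv\<^bsub>G\<^esub> h) else 0) = 0" for k
      by auto
    then show ?thesis by simp
  qed
qed

context group
begin

lemma coord_right_translation:
  "h \<in> carrier G \<Longrightarrow> coord (right_translation G h \<xi>) k = (if k \<in> carrier G then coord \<xi> (k \<otimes> inv h) else 0)"
  using group_axioms by (simp add: right_translation.rep_eq)

lemma right_translation_on: "right_translation G h \<xi> \<in> l2_on (carrier G)"
  by (simp add: l2_on_def right_translation.rep_eq)

lemma right_translation_scaleC: "right_translation G h (scaleC c \<xi>) = scaleC c (right_translation G h \<xi>)"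
  by (rule l2_eqI) (simp add: right_translation.rep_eq scaleC.rep_eq)

lemma right_translation_inner:
  assumes h: "h \<in> carrier G"
  shows "inner (right_translation G h \<xi>) \<eta> = inner \<xi> (right_translation G (inv h) \<eta>)"
proof -
  have bij: "bij_betw (\<lambda>k. k \<otimes> inv h) (carrier G) (carrier G)"
    by (rule bij_betw_byWitness[where f' = "\<lambda>k. k \<otimes> h"]) (use h in \<open>auto simp: m_assoc\<close>)
  have "inner (right_translation G h \<xi>) \<eta> =
      (\<Sum>\<^sub>\<infinity>k\<in>carrier G. Re (cnj (coord \<xi> (k \<otimes> inv h)) * coord \<eta> k))"
    unfolding inner_l2_infsum by (rule infsum_cong_neutral) (auto simp: coord_right_translation h)
  also have "\<dots> = (\<Sum>\<^sub>\<infinity>k\<in>carrier G. Re (cnj (coord \<xi> (k \<otimes> inv h)) * coord \<eta> ((k \<otimes> inv h) \<otimes> h)))"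
    by (rule infsum_cong) (simp add: m_assoc h)
  also have "\<dots> = (\<Sum>\<^sub>\<infinity>k\<in>carrier G. Re (cnj (coord \<xi> k) * coord \<eta> (k \<otimes> h)))"
    by (rule infsum_reindex_bij_betw[OF bij])
  also have "\<dots> = inner \<xi> (right_translation G (inv h) \<eta>)"
    unfolding inner_l2_infsum by (rule infsum_cong_neutral) (auto simp: coord_right_translation h)
  finally show ?thesis .
qed

lemma right_translation_inverse:
  assumes "h \<in> carrier G" "\<xi> \<in> l2_on (carrier G)"
  shows "right_translation G h (right_translation G (inv h) \<xi>) = \<xi>"
    and "right_translation G (inv h) (right_translation G h \<xi>) = \<xi>"
  using assms by (auto intro!: l2_eqI simp: coord_right_translation m_assoc l2_on_def)

lemma bounded_linear_right_translation:
  assumes h: "h \<in> carrier G"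
  shows "bounded_linear (right_translation G h)"
proof (rule bounded_linear_intro[of _ 1])
  show "right_translation G h (\<xi> + \<eta>) = right_translation G h \<xi> + right_translation G h \<eta>" for \<xi> \<eta>
    by (rule l2_eqI) (simp add: right_translation.rep_eq plus_l2.rep_eq)
  show "right_translation G h (r *\<^sub>R \<xi>) = r *\<^sub>R right_translation G h \<xi>" for r \<xi>
    by (rule l2_eqI) (simp add: right_translation.rep_eq scaleR_l2.rep_eq)
  fix \<xi> :: "'a l2"
  have "right_translation G (inv h) (right_translation G h \<xi>) = restr (carrier G) \<xi>"
    by (rule l2_eqI) (simp add: coord_right_translation h m_assoc restr.rep_eq)
  then have "(norm (right_translation G h \<xi>))\<^sup>2 = inner \<xi> (restr (carrier G) \<xi>)"
    by (simp add: power2_norm_eq_inner right_translation_inner h)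
  also have "\<dots> = (norm (restr (carrier G) \<xi>))\<^sup>2"
    by (simp add: power2_norm_eq_inner restr_sym restr_id[OF restr_l2_on])
  also have "\<dots> \<le> (norm \<xi>)\<^sup>2"
    unfolding norm_l2_power2 by (rule infsum_mono[OF coord_summable coord_summable]) (simp add: restr.rep_eq)
  finally have "(norm (right_translation G h \<xi>))\<^sup>2 \<le> (norm \<xi>)\<^sup>2" .
  from power2_le_imp_le[OF this norm_ge_zero] show "norm (right_translation G h \<xi>) \<le> norm \<xi> * 1" by simp
qed

lemma right_translation_unit_vec:
  assumes "h \<in> carrier G"
  shows "right_translation G h (unit_vec \<one>) = unit_vec h"
proof (rule l2_eqI)
  fix k
  have "k \<otimes> inv h = \<one> \<longleftrightarrow> k = h" if "k \<in> carrier G"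
    using that assms by (metis inv_closed inv_equality inv_inv r_inv)
  then show "coord (right_translation G h (unit_vec \<one>)) k = coord (unit_vec h) k"
    using assms by (auto simp: coord_right_translation delta_def)
qed

lemma right_translation_bounded: "h \<in> carrier G \<Longrightarrow> l2_op (carrier G) (right_translation G h) \<in> bounded_ops (carrier G)"
  by (intro l2_op_bounded bounded_linear_right_translation right_translation_scaleC right_translation_on)

lemma right_translation_adjoint:
  "h \<in> carrier G \<Longrightarrow> adjoint_op (carrier G) (l2_op (carrier G) (right_translation G h)) =
    l2_op (carrier G) (right_translation G (inv h))"
  by (rule l2_op_adjoint) (simp_all add: right_translation_scaleC right_translation_on right_translation_inner)

lemma right_translation_unitary:
  assumes h: "h \<in> carrier G"
  shows "unitary_op (carrier G) (l2_op (carrier G) (right_translation G h))"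
proof -
  note cong = l2_op_cong[where F' = "\<lambda>\<xi>. \<xi>"]
  show ?thesis
    unfolding unitary_op_def right_translation_adjoint[OF h] l2_op_id[symmetric]
    by (simp add: l2_op_comp right_translation_on right_translation_bounded h
        cong[where F = "\<lambda>\<xi>. right_translation G h (right_translation G (inv h) \<xi>)"]
        cong[where F = "\<lambda>\<xi>. right_translation G (inv h) (right_translation G h \<xi>)"] right_translation_inverse)
qed

lemma left_translate_ell2:
  assumes g: "g \<in> carrier G" and f: "f \<in> ell2 (carrier G)"
  shows "left_translate G g f \<in> ell2 (carrier G)"
proof -
  have fs: "(\<lambda>i. (cmod (f i))\<^sup>2) summable_on UNIV" using f by (simp add: ell2_def)
  have inj: "inj_on (\<lambda>k. inv g \<otimes> k) (carrier G)" using g by (auto simp: inj_on_def)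
  have "(\<lambda>i. (cmod (f i))\<^sup>2) summable_on (\<lambda>k. inv g \<otimes> k) ` carrier G"
    by (rule summable_on_subset_banach[OF fs]) simp
  then have "(\<lambda>k. (cmod (f (inv g \<otimes> k)))\<^sup>2) summable_on carrier G"
    by (simp add: summable_on_reindex[OF inj] comp_def)
  then have "(\<lambda>k. (cmod (left_translate G g f k))\<^sup>2) summable_on UNIV"
    by (rule summable_on_cong_neutral[THEN iffD1, rotated -1]) (auto simp: left_translate_def)
  then show ?thesis by (simp add: ell2_def left_translate_def)
qed

text \<open>Right translations commute with left ones by associativity, hence lie in the first
  commutant, and every element of \<open>group_vN G\<close> commutes with that.\<close>

lemma right_translation_commutant:
  assumes h: "h \<in> carrier G"
  shows "l2_op (carrier G) (right_translation G h) \<in> commutant (carrier G) (group_vN G)"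
proof -
  let ?U = "l2_op (carrier G) (right_translation G h)"
  have "?U \<circ>\<^sub>o lreg G g = lreg G g \<circ>\<^sub>o ?U" if g: "g \<in> carrier G" for g
  proof -
    have shift: "left_translate G g (coord (right_translation G h \<xi>)) = coord (right_translation G h \<xi>')"
      if "coord \<xi>' = left_translate G g (coord \<xi>)" for \<xi> \<xi>'
      using that g h by (auto simp: fun_eq_iff coord_right_translation left_translate_def m_assoc)
    have "\<exists>\<xi>'. coord \<xi>' = left_translate G g (coord \<xi>) \<and> \<xi>' \<in> l2_on (carrier G)" if "\<xi> \<in> l2_on (carrier G)" for \<xi>
      using left_translate_ell2[OF g, of "coord \<xi>"] that by (metis coord_in_ell2 ell2_coordE)
    then obtain ltr where l: "\<And>\<xi>. \<xi> \<in> l2_on (carrier G) \<Longrightarrow> coord (ltr \<xi>) = left_translate G g (coord \<xi>)"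
      "\<And>\<xi>. \<xi> \<in> l2_on (carrier G) \<Longrightarrow> ltr \<xi> \<in> l2_on (carrier G)" by metis
    have lreg: "lreg G g = l2_op (carrier G) ltr"
    proof (intro equalityI subsetI)
      fix p assume "p \<in> lreg G g"
      then obtain f where f: "p = (f, left_translate G g f)" "f \<in> ell2 (carrier G)" by (auto simp: lreg_def)
      then obtain \<xi> where "f = coord \<xi>" "\<xi> \<in> l2_on (carrier G)" by (metis ell2_coordE)
      then show "p \<in> l2_op (carrier G) ltr" using f l(1) by (auto simp: l2_op_def)
    qed (auto simp: l2_op_def lreg_def l(1) coord_in_ell2)
    have "right_translation G h (ltr \<xi>) = ltr (right_translation G h \<xi>)" if "\<xi> \<in> l2_on (carrier G)" for \<xi>
      using shift[OF l(1)[OF that]] l(1)[OF right_translation_on[of h \<xi>]] by (simp add: coord_inject)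
    then have "l2_op (carrier G) (\<lambda>\<xi>. right_translation G h (ltr \<xi>)) =
        l2_op (carrier G) (\<lambda>\<xi>. ltr (right_translation G h \<xi>))"
      by (rule l2_op_cong)
    moreover have "?U \<circ>\<^sub>o l2_op (carrier G) ltr = l2_op (carrier G) (\<lambda>\<xi>. right_translation G h (ltr \<xi>))"
      by (rule l2_op_comp) (rule l(2))
    moreover have "l2_op (carrier G) ltr \<circ>\<^sub>o ?U = l2_op (carrier G) (\<lambda>\<xi>. ltr (right_translation G h \<xi>))"
      by (rule l2_op_comp) (rule right_translation_on)
    ultimately show ?thesis unfolding lreg by simp
  qed
  then have "?U \<in> commutant (carrier G) (lreg G ` carrier G)"
    using right_translation_bounded[OF h] by (auto simp: commutant_def)
  then show ?thesis
    using right_translation_bounded[OF h] unfolding group_vN_def commutant_def[of _ "commutant _ _"] by (auto simp: commutant_def)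
qed

lemma affiliated_translate:
  assumes x: "affiliated G x" and h: "h \<in> carrier G" and on: "\<xi> \<in> l2_on (carrier G)"
    and X: "(coord \<xi>, coord \<eta>) \<in> x" and \<eta>: "\<eta> \<in> l2_on (carrier G)"
  shows "(coord (right_translation G h \<xi>), coord (right_translation G h \<eta>)) \<in> x"
proof -
  let ?U = "l2_op (carrier G) (right_translation G h)"
  have eq: "?U \<circ>\<^sub>o x \<circ>\<^sub>o adjoint_op (carrier G) ?U = x"
    using x right_translation_commutant[OF h] right_translation_unitary[OF h] unfolding affiliated_def by blast
  have "(coord (right_translation G h \<xi>), coord \<xi>) \<in> adjoint_op (carrier G) ?U"
    unfolding right_translation_adjoint[OF h] l2_op_iff
    by (simp add: right_translation_on right_translation_inverse h on)
  moreover have "(coord \<eta>, coord (right_translation G h \<eta>)) \<in> ?U" by (simp add: l2_op_iff \<eta>)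
  ultimately have "(coord (right_translation G h \<xi>), coord (right_translation G h \<eta>)) \<in> ?U \<circ>\<^sub>o x \<circ>\<^sub>o adjoint_op (carrier G) ?U"
    unfolding op_comp_def using X by blast
  then show ?thesis by (simp only: eq)
qed

end

section \<open>The logarithmic Sobolev inequality\<close>

context positive_operator
begin

lemma X_sum:
  assumes "\<And>g. g \<in> S \<Longrightarrow> X (a g) (b g)"
  shows "X (\<Sum>g\<in>S. a g) (\<Sum>g\<in>S. b g)"
  using assms by (induction S rule: infinite_finite_induct) (simp_all add: X_0 X_add)

lemma spectral_distribution_sq:
  assumes "I = carrier G" "\<one>\<^bsub>G\<^esub> \<in> carrier G"
  shows "spectral_distribution G (x \<circ>\<^sub>o x) = sq_measure (unit_vec \<one>\<^bsub>G\<^esub>)"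
  using vector_measure_sq[OF unit_vec_on[of "\<one>\<^bsub>G\<^esub>" I]] assms
  by (simp add: spectral_distribution_def vtau_def vector_measure_def)

lemma vtau_fun_sq:
  assumes "I = carrier G" "\<one>\<^bsub>G\<^esub> \<in> carrier G" and [measurable]: "f \<in> borel_measurable borel"
  shows "vtau_fun G f (x \<circ>\<^sub>o x) = enn2ereal (\<integral>\<^sup>+u. ennreal (f (u\<^sup>2)) \<partial>M (unit_vec \<one>\<^bsub>G\<^esub>)) -
    enn2ereal (\<integral>\<^sup>+u. ennreal (- f (u\<^sup>2)) \<partial>M (unit_vec \<one>\<^bsub>G\<^esub>))"
  unfolding vtau_fun_def spectral_distribution_sq[OF assms(1,2)]
  by (subst (1 2) nn_integral_sq) simp_all

end

text \<open>Records what the group-algebra case and the unbounded case have in common: x maps each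
  point mass to a right translate of the coefficient vector \<xi>, which has finite energy.\<close>

locale free_positive_operator = positive_operator "free_carrier n" x for n :: nat and x +
  fixes \<xi> :: "letter list l2"
  assumes X_1: "X (unit_vec []) \<xi>"
    and X_translate: "\<And>h. h \<in> free_carrier n \<Longrightarrow> \<exists>\<tau>. X (unit_vec h) \<tau> \<and>
      (\<forall>k\<in>free_carrier n. coord \<tau> k = coord \<xi> (k \<otimes>\<^bsub>free_group n\<^esub> inv\<^bsub>free_group n\<^esub> h))"
    and energy: "(\<lambda>g. real (length g) * (cmod (coord \<xi> g))\<^sup>2) summable_on UNIV"
begin

definition c :: "letter list \<Rightarrow> real" where
  "c g = cmod (coord \<xi> g)"

definition s :: real where
  "s = (\<Sum>\<^sub>\<infinity>g. (if g = [] then 0 else (c g)\<^sup>2))"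

text \<open>Subtraction on naturals makes the term of the empty word vanish.\<close>

definition \<alpha> :: real where
  "\<alpha> = sqrt (\<Sum>\<^sub>\<infinity>g. real (length g - 1) * (c g)\<^sup>2)"

lemma nil_carrier: "[] \<in> free_carrier n"
  by (simp add: free_carrier_iff reduced_Nil)

lemma sum_c: "(\<lambda>g. (c g)\<^sup>2) summable_on UNIV"
  unfolding c_def by (rule coord_summable)

lemma sum_s: "(\<lambda>g. (if g = [] then 0 else (c g)\<^sup>2)) summable_on UNIV"
  by (rule summable_on_comparison_test[OF sum_c]) simp_all

lemma sum_\<alpha>: "(\<lambda>g. real (length g - 1) * (c g)\<^sup>2) summable_on UNIV"
  by (rule summable_on_comparison_test[OF energy]) (auto simp: c_def intro!: mult_right_mono)

lemma \<alpha>_sq: "\<alpha>\<^sup>2 = (\<Sum>\<^sub>\<infinity>g. real (length g - 1) * (c g)\<^sup>2)"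
  unfolding \<alpha>_def by (simp add: infsum_nonneg)

lemma energy_eq: "(\<Sum>\<^sub>\<infinity>g. real (length g) * (cmod (coord \<xi> g))\<^sup>2) = s + \<alpha>\<^sup>2"
  unfolding s_def \<alpha>_sq infsum_add[OF sum_s sum_\<alpha>, symmetric]
  by (rule infsum_cong) (auto simp: c_def Suc_le_eq algebra_simps of_nat_diff)

lemma norm_eq: "(norm \<xi>)\<^sup>2 = (c [])\<^sup>2 + s"
proof -
  have 1: "(\<lambda>g. if g = [] then (c g)\<^sup>2 else 0) summable_on UNIV"
    by (rule summable_on_comparison_test[OF sum_c]) simp_all
  have "(\<Sum>\<^sub>\<infinity>g. if g = [] then (c g)\<^sup>2 else 0) = (\<Sum>\<^sub>\<infinity>g\<in>{[]}. (c g)\<^sup>2)"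
    by (rule infsum_cong_neutral) auto
  then have 2: "(c [])\<^sup>2 = (\<Sum>\<^sub>\<infinity>g. if g = [] then (c g)\<^sup>2 else 0)" by simp
  show ?thesis
    unfolding 2 s_def infsum_add[OF 1 sum_s, symmetric] norm_l2_power2
    by (rule infsum_cong) (simp add: c_def)
qed

text \<open>Self-adjointness tested on the point masses at the identity and at g.\<close>

lemma coord_inv:
  assumes g: "g \<in> free_carrier n"
  shows "coord \<xi> (word_inv g) = cnj (coord \<xi> g)"
proof -
  interpret group "free_group n" by (rule group_free_group)
  obtain \<tau> where \<tau>: "X (unit_vec g) \<tau>" "\<And>k. k \<in> free_carrier n \<Longrightarrow>
      coord \<tau> k = coord \<xi> (k \<otimes>\<^bsub>free_group n\<^esub> inv\<^bsub>free_group n\<^esub> g)"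
    using X_translate[OF g] by blast
  have "coord \<tau> [] = cnj (coord \<xi> g)"
    using X_cip[OF X_1 \<tau>(1)] by (simp add: cip_delta cip_delta_right)
  moreover have "[] \<otimes>\<^bsub>free_group n\<^esub> inv\<^bsub>free_group n\<^esub> g = word_inv g"
    using l_one[of "inv\<^bsub>free_group n\<^esub> g"] g by (simp add: free_inv word_inv_carrier)
  ultimately show ?thesis using \<tau>(2)[OF nil_carrier] by simp
qed

sublocale tripod n c s \<alpha>
proof
  show "0 \<le> c g" for g by (simp add: c_def)
  show "c (word_inv g) = c g" if "g \<in> free_carrier n" for g
    using coord_inv[OF that] by (simp add: c_def)
  fix K assume K: "finite K" "K \<subseteq> free_carrier n - {[]}"
  have "(\<Sum>k\<in>K. (c k)\<^sup>2) = (\<Sum>k\<in>K. if k = [] then 0 else (c k)\<^sup>2)"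
    by (rule sum.cong) (use K in auto)
  also have "\<dots> \<le> s" unfolding s_def by (rule finite_sum_le_infsum[OF sum_s K(1)]) auto
  finally show "(\<Sum>k\<in>K. (c k)\<^sup>2) \<le> s" .
  show "(\<Sum>k\<in>K. real (length k - 1) * (c k)\<^sup>2) \<le> \<alpha>\<^sup>2"
    unfolding \<alpha>_sq by (rule finite_sum_le_infsum[OF sum_\<alpha> K(1)]) auto
next
  show "0 \<le> \<alpha>" by (simp add: \<alpha>_def infsum_nonneg)
qed

lemma inner_1: "inner (unit_vec []) \<xi> = c []"
proof -
  have re: "inner (unit_vec []) \<xi> = Re (coord \<xi> [])" by (simp add: inner_l2_def cip_delta)
  have "coord \<xi> [] = cnj (coord \<xi> [])" using coord_inv[OF nil_carrier] by simp
  then have "Im (coord \<xi> []) = 0" by (simp add: complex_eq_iff)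
  moreover have "0 \<le> Re (coord \<xi> [])" using X_nonneg[OF X_1] by (simp add: re)
  ultimately show ?thesis unfolding re c_def by (simp add: cmod_def)
qed

lemma third_moment:
  "(\<integral>\<^sup>+u. ennreal (u ^ 3) \<partial>M (unit_vec [])) \<le> ennreal (c [] ^ 3 + 3 * c [] * s + 3 * s * \<alpha> + \<alpha> ^ 3)"
proof -
  let ?C = "c [] ^ 3 + 3 * c [] * s + 3 * s * \<alpha> + \<alpha> ^ 3"
  have "ennreal (u ^ 3) = ennreal (u\<^sup>2) * ennreal u" for u :: real
    by (simp add: ennreal_mult'[symmetric] power2_eq_square power3_eq_cube)
  \<comment> \<open>\<open>M \<xi>\<close> has density u^2 over the distribution of x, so the third
    moment is a first moment at \<xi>. As \<xi> need not lie in the domain of x,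
    \<open>form_lsc\<close> is called for.\<close>
  then have "(\<integral>\<^sup>+u. ennreal (u ^ 3) \<partial>M (unit_vec [])) = (\<integral>\<^sup>+u. ennreal u \<partial>M \<xi>)"
    by (subst X_nn_integral[OF X_1]) simp_all
  also have "\<dots> \<le> ennreal ?C"
  proof (rule form_lsc)
    show on: "\<xi> \<in> l2_on (free_carrier n)" by (rule X_on(2)[OF X_1])
    show "0 \<le> ?C" using c_nonneg[of "[]"] s_nonneg \<alpha>_nonneg by simp
    fix \<epsilon> :: real assume "0 < \<epsilon>"
    then obtain S where S: "finite S" "S \<subseteq> free_carrier n" "norm (restr S \<xi> - \<xi>) < \<epsilon>"
      using restr_approx[OF on] by blast
    obtain \<tau> where \<tau>: "\<And>h. h \<in> free_carrier n \<Longrightarrow> X (unit_vec h) (\<tau> h)"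
      "\<And>h k. h \<in> free_carrier n \<Longrightarrow> k \<in> free_carrier n \<Longrightarrow>
        coord (\<tau> h) k = coord \<xi> (k \<otimes>\<^bsub>free_group n\<^esub> inv\<^bsub>free_group n\<^esub> h)"
      using X_translate by metis
    \<comment> \<open>The image under x of the finite truncation of \<xi>, so the form becomes a
      finite convolution sum.\<close>
    define \<eta> where "\<eta> = (\<Sum>h\<in>S. scaleC (coord \<xi> h) (\<tau> h))"
    have "X (restr S \<xi>) \<eta>"
      unfolding restr_finite[OF S(1)] \<eta>_def by (rule X_sum, rule X_scaleC, rule \<tau>(1)) (use S(2) in blast)
    moreover have "inner (restr S \<xi>) \<eta> \<le> ?C"
    proof -
      have "inner (restr S \<xi>) \<eta> = (\<Sum>g\<in>S. \<Sum>h\<in>S. inner (scaleC (coord \<xi> g) (unit_vec g)) (scaleC (coord \<xi> h) (\<tau> h)))"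
        unfolding restr_finite[OF S(1)] \<eta>_def inner_sum_left inner_sum_right by (rule sum.swap)
      also have "\<dots> \<le> (\<Sum>g\<in>S. \<Sum>h\<in>S. c g * c (g \<otimes>\<^bsub>free_group n\<^esub> inv\<^bsub>free_group n\<^esub> h) * c h)"
      proof (intro sum_mono)
        fix g h assume gh: "g \<in> S" "h \<in> S"
        have "inner (scaleC (coord \<xi> g) (unit_vec g)) (scaleC (coord \<xi> h) (\<tau> h)) =
            inner (unit_vec g) (scaleC (cnj (coord \<xi> g)) (scaleC (coord \<xi> h) (\<tau> h)))"
          by (rule inner_scaleC)
        also have "\<dots> = Re (cnj (coord \<xi> g) * (coord \<xi> h * coord (\<tau> h) g))"
          by (simp add: inner_l2_def cip_delta scaleC.rep_eq)
        also have "\<dots> \<le> cmod (cnj (coord \<xi> g) * (coord \<xi> h * coord (\<tau> h) g))" by (rule complex_Re_le_cmod)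
        also have "\<dots> = c g * c (g \<otimes>\<^bsub>free_group n\<^esub> inv\<^bsub>free_group n\<^esub> h) * c h"
        proof -
          have "g \<in> free_carrier n" "h \<in> free_carrier n" using gh S(2) by auto
          then show ?thesis by (simp add: \<tau>(2) norm_mult c_def mult_ac)
        qed
        finally show "inner (scaleC (coord \<xi> g) (unit_vec g)) (scaleC (coord \<xi> h) (\<tau> h)) \<le>
          c g * c (g \<otimes>\<^bsub>free_group n\<^esub> inv\<^bsub>free_group n\<^esub> h) * c h" .
      qed
      also have "\<dots> \<le> ?C" by (rule sum_convolution[OF S(1,2)])
      finally show ?thesis .
    qed
    ultimately show "\<exists>\<xi>' \<eta>'. X \<xi>' \<eta>' \<and> norm (\<xi>' - \<xi>) < \<epsilon> \<and> inner \<xi>' \<eta>' \<le> ?C" using S(3) by blast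
  qed
  finally show ?thesis .
qed

theorem entropy_le: "Ent (free_group n) (x \<circ>\<^sub>o x) \<le> ereal (2 * (s + \<alpha>\<^sup>2))"
proof -
  let ?M = "M (unit_vec [])"
  have I: "free_carrier n = carrier (free_group n)" "\<one>\<^bsub>free_group n\<^esub> \<in> carrier (free_group n)"
    using nil_carrier by simp_all
  have i1: "integrable ?M (\<lambda>u. u)" "(\<integral>u. u \<partial>?M) = c []"
    using X_inner[OF X_1] inner_1 by simp_all
  have n2: "(\<integral>\<^sup>+u. ennreal (u\<^sup>2) \<partial>?M) = ennreal ((c [])\<^sup>2 + s)"
    using X_norm[OF X_1] by (simp add: norm_eq)
  have i2: "integrable ?M (\<lambda>u. u\<^sup>2)" by (rule integrableI_bounded) (simp_all add: n2)
  have int2: "(\<integral>u. u\<^sup>2 \<partial>?M) = (c [])\<^sup>2 + s"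
    using n2 s_nonneg by (subst integral_eq_nn_integral) (simp_all del: ennreal_plus)
  have tot: "measure ?M UNIV = 1" by (simp add: measure_M_UNIV norm_unit_vec)
  note bound = entropy_integral_bound[OF finite_measure_M sets_M tot AE_M_nonneg[OF unit_vec_on[OF nil_carrier]]
      i1 i2 int2 third_moment s_nonneg \<alpha>_nonneg]
  have "vtau_fun (free_group n) (\<lambda>t. t) (x \<circ>\<^sub>o x) = ereal ((c [])\<^sup>2 + s)"
    using vtau_fun_sq[OF I, of "\<lambda>t. t"] enn2ereal_diff_integral[OF i2] by (simp add: int2)
  moreover have "vtau_fun (free_group n) (\<lambda>t. t * ln t) (x \<circ>\<^sub>o x) = ereal (\<integral>u. u\<^sup>2 * ln (u\<^sup>2) \<partial>?M)"
    using vtau_fun_sq[OF I, of "\<lambda>t. t * ln t"] enn2ereal_diff_integral[OF bound(1)] by simp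
  ultimately show ?thesis using bound(2) by (simp add: Ent_def Let_def)
qed

end

section \<open>Transfer to the two forms of the inequality\<close>

lemma L_half_app:
  assumes "f \<in> Domain (L_half n)"
  shows "op_app (L_half n) f = (\<lambda>g. complex_of_real (sqrt (real (length g))) * f g)"
    and "op_app (L_half n) f \<in> ell2 (free_carrier n)"
proof -
  obtain h where h: "(f, h) \<in> L_half n" using assms by blast
  have "op_app (L_half n) f = h"
    unfolding op_app_def by (rule the_equality[of "\<lambda>\<eta>. (f, \<eta>) \<in> L_half n"]) (use h in \<open>auto simp: L_half_def diag_op_def\<close>)
  then show "op_app (L_half n) f = (\<lambda>g. complex_of_real (sqrt (real (length g))) * f g)"
    "op_app (L_half n) f \<in> ell2 (free_carrier n)"
    using h by (auto simp: L_half_def diag_op_def)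
qed

text \<open>The common core of both claims: only the vector f and the translation rule for point
  masses remain to be supplied.\<close>

lemma log_sobolev:
  assumes pos: "positive_op (free_carrier n) x" and f: "(delta [], f) \<in> x" and dom: "f \<in> Domain (L_half n)"
    and tr: "\<And>h. h \<in> free_carrier n \<Longrightarrow> \<exists>g. (delta h, g) \<in> x \<and>
      (\<forall>k\<in>free_carrier n. g k = f (k \<otimes>\<^bsub>free_group n\<^esub> inv\<^bsub>free_group n\<^esub> h))"
  shows "Ent (free_group n) (x \<circ>\<^sub>o x) \<le> ereal (2 * (ell2_norm (op_app (L_half n) f))\<^sup>2)"
proof -
  interpret PO: positive_operator "free_carrier n" x by (standard, rule pos)
  have on: "g \<in> ell2 (free_carrier n)" if "(f', g) \<in> x" for f' g
    using PO.linear that by (auto simp: linear_op_def)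
  obtain \<xi> where \<xi>: "f = coord \<xi>" using ell2_coordE[OF on[OF f]] .
  have sq: "(cmod (complex_of_real (sqrt (real (length g))) * z))\<^sup>2 = real (length g) * (cmod z)\<^sup>2"
    for g :: "letter list" and z
    by (simp add: norm_mult power_mult_distrib)
  have en: "(\<lambda>g. (cmod (op_app (L_half n) f g))\<^sup>2) = (\<lambda>g. real (length g) * (cmod (coord \<xi> g))\<^sup>2)"
    by (rule ext) (simp only: L_half_app(1)[OF dom] sq, simp only: \<xi>)
  interpret free_positive_operator n x \<xi>
  proof
    show "PO.X (unit_vec []) \<xi>" using f by (simp add: PO.X_def \<xi>)
    show "(\<lambda>g. real (length g) * (cmod (coord \<xi> g))\<^sup>2) summable_on UNIV"
      using L_half_app(2)[OF dom] by (simp add: ell2_def en)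
    fix h assume h: "h \<in> free_carrier n"
    obtain g where g: "(delta h, g) \<in> x" "\<And>k. k \<in> free_carrier n \<Longrightarrow>
        g k = f (k \<otimes>\<^bsub>free_group n\<^esub> inv\<^bsub>free_group n\<^esub> h)"
      using tr[OF h] by blast
    obtain \<tau> where "g = coord \<tau>" using ell2_coordE[OF on[OF g(1)]] .
    with g show "\<exists>\<tau>. PO.X (unit_vec h) \<tau> \<and>
        (\<forall>k\<in>free_carrier n. coord \<tau> k = coord \<xi> (k \<otimes>\<^bsub>free_group n\<^esub> inv\<^bsub>free_group n\<^esub> h))"
      by (intro exI[of _ \<tau>]) (simp add: PO.X_def \<xi>)
  qed
  have "(ell2_norm (op_app (L_half n) f))\<^sup>2 = s + \<alpha>\<^sup>2"
    unfolding ell2_norm_def en energy_eq by (simp add: s_nonneg)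
  then show ?thesis using entropy_le by simp
qed

lemma (in group) group_alg_op_delta:
  assumes c: "finite {g. c g \<noteq> 0}" "{g. c g \<noteq> 0} \<subseteq> carrier G" and h: "h \<in> carrier G"
  shows "(delta h, \<lambda>k. if k \<in> carrier G then c (k \<otimes> inv h) else 0) \<in> group_alg_op G c"
proof -
  have "(\<Sum>g | c g \<noteq> 0. c g * left_translate G g (delta h) k) = (if k \<in> carrier G then c (k \<otimes> inv h) else 0)" for k
  proof (cases "k \<in> carrier G")
    case True
    have "inv g \<otimes> k = h \<longleftrightarrow> g = k \<otimes> inv h" if "g \<in> carrier G" for g
      using that True h by (metis inv_closed inv_solve_left inv_solve_right m_closed)
    then have "(\<Sum>g | c g \<noteq> 0. c g * left_translate G g (delta h) k) =
        (\<Sum>g | c g \<noteq> 0. if g = k \<otimes> inv h then c g else 0)"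
      using True c(2) by (intro sum.cong) (auto simp: left_translate_def delta_def)
    then show ?thesis using True c(1) by (simp add: sum.delta)
  qed (simp add: left_translate_def)
  then show ?thesis using delta_in_ell2[OF h] by (auto simp: group_alg_op_def)
qed

lemma group_alg_op_single_valued: "(f, g) \<in> group_alg_op G c \<Longrightarrow> (f, g') \<in> group_alg_op G c \<Longrightarrow> g = g'"
  by (auto simp: group_alg_op_def)

lemma finite_support_ell2:
  assumes "finite {g. c g \<noteq> 0}" "{g. c g \<noteq> 0} \<subseteq> I"
  shows "c \<in> ell2 I"
proof -
  have "(\<lambda>i. (cmod (c i))\<^sup>2) summable_on {g. c g \<noteq> 0}" using assms(1) by simp
  then have "(\<lambda>i. (cmod (c i))\<^sup>2) summable_on UNIV"
    by (rule summable_on_cong_neutral[THEN iffD1, rotated -1]) auto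
  then show ?thesis using assms(2) by (auto simp: ell2_def)
qed

theorem theorem1p2:
  fixes n :: nat
  assumes "n \<ge> 2"
  shows "(\<forall>x \<in> group_algebra (free_group n). positive_op (carrier (free_group n)) x \<longrightarrow>
            Ent (free_group n) (x \<circ>\<^sub>o x)
              \<le> ereal (2 * Re (vtau (free_group n) (x \<circ>\<^sub>o L_alg n x)))) \<and>
         (\<forall>x \<in> nc_L2 (free_group n). positive_op (carrier (free_group n)) x \<longrightarrow>
            L2_vec (free_group n) x \<in> Domain (L_half n) \<longrightarrow>
            Ent (free_group n) (x \<circ>\<^sub>o x)
              \<le> ereal (2 * (ell2_norm (op_app (L_half n) (L2_vec (free_group n) x)))\<^sup>2))"
proof (intro conjI ballI impI)
  interpret group "free_group n" by (rule group_free_group)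
  have nil: "[] \<in> free_carrier n" using one_closed by simp
  {
    fix x assume x: "x \<in> group_algebra (free_group n)" and pos: "positive_op (carrier (free_group n)) x"
    interpret PO: positive_operator "free_carrier n" x by (standard, rule pos)
    obtain c where xc: "x = group_alg_op (free_group n) c"
      and c: "finite {g. c g \<noteq> 0}" "{g. c g \<noteq> 0} \<subseteq> free_carrier n"
      using x by (auto simp: group_algebra_def)
    have at_nil: "(\<lambda>k. if k \<in> free_carrier n then d (k \<otimes>\<^bsub>free_group n\<^esub> inv\<^bsub>free_group n\<^esub> []) else 0) = d"
      if "{g. d g \<noteq> 0} \<subseteq> free_carrier n" for d :: "letter list \<Rightarrow> complex"
    proof
      fix k
      have "k \<otimes>\<^bsub>free_group n\<^esub> inv\<^bsub>free_group n\<^esub> [] = k" if "k \<in> free_carrier n"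
        using r_one[OF that] inv_one by simp
      then show "(if k \<in> free_carrier n then d (k \<otimes>\<^bsub>free_group n\<^esub> inv\<^bsub>free_group n\<^esub> []) else 0) = d k"
        using that by auto
    qed
    have f: "(delta [], c) \<in> x"
      using group_alg_op_delta[OF c nil] unfolding xc at_nil[OF c(2)] .
    have L2: "L2_vec (free_group n) x = c"
      unfolding L2_vec_def op_app_def free_one
      by (rule the_equality[of "\<lambda>\<eta>. (delta [], \<eta>) \<in> x", OF f]) (use f group_alg_op_single_valued xc in blast)
    have ce: "(\<lambda>g. w (length g) * c g) \<in> ell2 (free_carrier n)"
      and ws: "finite {g. w (length g) * c g \<noteq> 0}" "{g. w (length g) * c g \<noteq> 0} \<subseteq> free_carrier n"
      for w :: "nat \<Rightarrow> complex"
    proof -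
      have sub: "{g. w (length g) * c g \<noteq> 0} \<subseteq> {g. c g \<noteq> 0}" by auto
      show 1: "finite {g. w (length g) * c g \<noteq> 0}" "{g. w (length g) * c g \<noteq> 0} \<subseteq> free_carrier n"
        using finite_subset[OF sub c(1)] sub c(2) by auto
      show "(\<lambda>g. w (length g) * c g) \<in> ell2 (free_carrier n)" by (rule finite_support_ell2[OF 1])
    qed
    have ce1: "c \<in> ell2 (free_carrier n)" by (rule finite_support_ell2[OF c])
    have dom: "c \<in> Domain (L_half n)"
      using ce[of "\<lambda>l. complex_of_real (sqrt (real l))"] ce1 by (auto simp: L_half_def diag_op_def)
    have "Ent (free_group n) (x \<circ>\<^sub>o x) \<le> ereal (2 * (ell2_norm (op_app (L_half n) c))\<^sup>2)"
    proof (rule log_sobolev[OF pos f dom])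
      fix h assume h: "h \<in> free_carrier n"
      show "\<exists>g. (delta h, g) \<in> x \<and> (\<forall>k\<in>free_carrier n. g k = c (k \<otimes>\<^bsub>free_group n\<^esub> inv\<^bsub>free_group n\<^esub> h))"
        using group_alg_op_delta[OF c h] unfolding xc by auto
    qed
    also have "(ell2_norm (op_app (L_half n) c))\<^sup>2 = Re (vtau (free_group n) (x \<circ>\<^sub>o L_alg n x))"
    proof -
      define d where "d g = complex_of_real (real (length g)) * c g" for g
      have d: "finite {g. d g \<noteq> 0}" "{g. d g \<noteq> 0} \<subseteq> free_carrier n" "d \<in> ell2 (free_carrier n)"
        unfolding d_def using ws[of "\<lambda>l. complex_of_real (real l)"] ce[of "\<lambda>l. complex_of_real (real l)"] by auto
      have Lc: "op_app (L_gen n) c = d"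
        unfolding op_app_def
        by (rule the_equality[of "\<lambda>\<eta>. (c, \<eta>) \<in> L_gen n"]) (use ce1 d(3) in \<open>auto simp: L_gen_def diag_op_def d_def[abs_def]\<close>)
      have L: "L_alg n x = group_alg_op (free_group n) d" by (simp add: L_alg_def L2 Lc)
      have dd: "(delta [], d) \<in> L_alg n x"
        using group_alg_op_delta[OF d(1,2) nil] unfolding L at_nil[OF d(2)] .
      obtain y where y: "(d, y) \<in> x" using d(3) unfolding xc by (auto simp: group_alg_op_def)
      have "op_app (x \<circ>\<^sub>o L_alg n x) (delta []) = y"
        unfolding op_app_def
      proof (rule the_equality)
        show "(delta [], y) \<in> x \<circ>\<^sub>o L_alg n x" unfolding op_comp_def using dd y by blast
        fix y' assume "(delta [], y') \<in> x \<circ>\<^sub>o L_alg n x"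
        then obtain d' where d': "(delta [], d') \<in> L_alg n x" "(d', y') \<in> x" unfolding op_comp_def by blast
        have "d' = d" by (rule group_alg_op_single_valued[OF d'(1)[unfolded L] dd[unfolded L]])
        with d'(2) y show "y' = y" using group_alg_op_single_valued[OF d'(2)[unfolded xc], of y] by (simp add: xc)
      qed
      then have "vtau (free_group n) (x \<circ>\<^sub>o L_alg n x) = cip (delta []) y" by (simp add: vtau_def)
      \<comment> \<open>Self-adjointness moves x to the other side: \<tau>(x L x) is the pairing of
        c with L c.\<close>
      also have "\<dots> = cip c d" using PO.adj f y unfolding adjoint_op_def by blast
      finally have v: "Re (vtau (free_group n) (x \<circ>\<^sub>o L_alg n x)) = Re (cip c d)" by simp
      obtain \<xi> \<eta> where \<xi>: "c = coord \<xi>" "d = coord \<eta>" using ell2_coordE ce1 d(3) by metis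
      have "Re (cip c d) = (\<Sum>\<^sub>\<infinity>g. Re (cnj (c g) * d g))"
        unfolding \<xi> inner_l2_def[symmetric] by (rule inner_l2_infsum)
      also have "\<dots> = (\<Sum>\<^sub>\<infinity>g. (cmod (op_app (L_half n) c g))\<^sup>2)"
      proof (rule infsum_cong)
        fix g
        have "Re (cnj (c g) * d g) = real (length g) * Re (cnj (c g) * c g)"
          by (simp add: d_def algebra_simps)
        then show "Re (cnj (c g) * d g) = (cmod (op_app (L_half n) c g))\<^sup>2"
          unfolding L_half_app(1)[OF dom] Re_cnj_mult_self by (simp add: norm_mult power_mult_distrib)
      qed
      also have "\<dots> = (ell2_norm (op_app (L_half n) c))\<^sup>2"
        unfolding ell2_norm_def by (simp add: infsum_nonneg)
      finally show ?thesis using v by simp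
    qed
    finally show "Ent (free_group n) (x \<circ>\<^sub>o x) \<le> ereal (2 * Re (vtau (free_group n) (x \<circ>\<^sub>o L_alg n x)))" .
  }
  {
    fix x assume x: "x \<in> nc_L2 (free_group n)" and pos: "positive_op (carrier (free_group n)) x"
      and dom: "L2_vec (free_group n) x \<in> Domain (L_half n)"
    interpret PO: positive_operator "free_carrier n" x by (standard, rule pos)
    have aff: "affiliated (free_group n) x" and fin: "vtau_fun (free_group n) (\<lambda>t. t) (x \<circ>\<^sub>o x) < \<infinity>"
      using x by (simp_all add: nc_L2_def PO.adj)
    \<comment> \<open>Membership in L2 means a finite second moment at the point mass of the
      identity, which puts this vector in the domain of x by \<open>X_domain\<close>.\<close>
    have "vtau_fun (free_group n) (\<lambda>t. t) (x \<circ>\<^sub>o x) = enn2ereal (\<integral>\<^sup>+u. ennreal (u\<^sup>2) \<partial>PO.M (unit_vec []))"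
      using PO.vtau_fun_sq[of "free_group n" "\<lambda>t. t"] nil by (simp add: ennreal_neg zero_ennreal.rep_eq)
    with fin have "(\<integral>\<^sup>+u. ennreal (u\<^sup>2) \<partial>PO.M (unit_vec [])) < \<infinity>"
      by (cases "\<integral>\<^sup>+u. ennreal (u\<^sup>2) \<partial>PO.M (unit_vec [])") auto
    from PO.X_domain[OF unit_vec_on[OF nil] this] obtain \<xi> where X: "PO.X (unit_vec []) \<xi>" by blast
    then have f: "(delta [], coord \<xi>) \<in> x" by (simp add: PO.X_def)
    have sv: "single_valued x" using PO.linear by (simp add: linear_op_def)
    have L2: "L2_vec (free_group n) x = coord \<xi>"
      unfolding L2_vec_def op_app_def free_one
      by (rule the_equality[of "\<lambda>\<eta>. (delta [], \<eta>) \<in> x", OF f]) (use f sv in \<open>blast dest: single_valuedD\<close>)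
    show "Ent (free_group n) (x \<circ>\<^sub>o x) \<le> ereal (2 * (ell2_norm (op_app (L_half n) (L2_vec (free_group n) x)))\<^sup>2)"
      unfolding L2
    proof (rule log_sobolev[OF pos f])
      show "coord \<xi> \<in> Domain (L_half n)" using dom by (simp add: L2)
      fix h assume h: "h \<in> free_carrier n"
      \<comment> \<open>For unbounded x, affiliation takes over from the explicit formula used in
        the group algebra.\<close>
      have "(coord (right_translation (free_group n) h (unit_vec [])), coord (right_translation (free_group n) h \<xi>)) \<in> x"
        by (rule affiliated_translate[OF aff h unit_vec_on[OF nil] _ PO.X_on(2)[OF X]]) (simp add: f)
      moreover have "right_translation (free_group n) h (unit_vec []) = unit_vec h"
        using right_translation_unit_vec[OF h] by simp
      ultimately have "(delta h, coord (right_translation (free_group n) h \<xi>)) \<in> x" by simp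
      then show "\<exists>g. (delta h, g) \<in> x \<and> (\<forall>k\<in>free_carrier n. g k = coord \<xi> (k \<otimes>\<^bsub>free_group n\<^esub> inv\<^bsub>free_group n\<^esub> h))"
        by (rule exI[of _ "coord (right_translation (free_group n) h \<xi>)", OF conjI]) (simp add: coord_right_translation[OF h])
    qed
  }
qed

end
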